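(* Let $E/F$ be the unramified quadratic extension of a non-Archimedean local field $F$ of odd residue characteristic, and let $\bar G=U(1,1)(F)$. Let $\bar\chi$ be a character of $E^*$ and let $\bar\pi$ be an irreducible infinite-dimensional representation of $\bar G$ realized as a subrepresentation of the principal series $\bar\pi(\bar\chi)=\mathrm{Ind}_{\bar B}^{\bar G}(\bar\chi)$. Let $\bar\eta$ be a character of $\mathcal{O}_E^\times$ with $\bar\eta|_{E^1}=\omega_{\bar\pi}$ such that $c_{\bar\eta}(\bar\pi)=c(\bar\pi)$. Let $\psi$ be an additive character of $F$ trivial on $\mathcal{O}_F$ and nontrivial on $\mathcal{P}_F^{-1}$. (i) If $\bar\pi=\bar\pi(\bar\chi)$, $\bar\chi$ is ramified, and $\bar\chi|_{\mathcal{O}_E^\times}={}^s\bar\chi^{-1}|_{\mathcal{O}_E^\times}$, then $\bar\pi$ is $\psi$-generic. Moreover, the space of vectors in $\bar\pi_{\bar\eta}^{\bar K_1}$ on which $\Lambda_\psi$ vanishes is one-dimensional. (ii) If $\bar\pi=\bar\pi^1(\bar\chi)$ (with $\bar\chi|_{F^*}=\omega_{E/F}$), then $\bar\pi$ is $\psi$-generic and $\Lambda_\psi$ is non-zero on the one-dimensional space of newforms $\bar\pi_{\bar\eta}^{\bar K_0}$. (iii) If $\bar\pi=\bar\pi^2(\bar\chi)$ (with $\bar\chi|_{F^*}=\omega_{E/F}$), then $\bar\pi$ is not $\psi$-generic, but it is $\psi_{\varpi}$-generic. Moreover, $\Lambda_{\psi_\varpi}$ is non-zero on the one-dimensional space of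 newforms $\bar\pi_{\bar\eta}^{\bar K_0'}$. (iv) In all other cases, $\bar\pi$ is $\psi$-generic. In addition, if $c=c(\bar\pi)$, then $\Lambda_\psi(v)\neq0$ for any newform $v$ (i.e. any non-zero vector $v$) in $\bar\pi_{\bar\eta}^{\bar K_c}$.
   Context: Fields. $F$ is a non-Archimedean local field of odd residue characteristic with ring of integers $\mathcal{O}_F$, maximal ideal $\mathcal{P}_F$, uniformizer $\varpi=\varpi_F$ and normalized absolute value $|\cdot|_F$. $E/F$ is the unramified quadratic extension (with $\mathcal{O}_E,\mathcal{P}_E,|\cdot|_E$ similarly), $s$ is the nontrivial element of $\mathrm{Gal}(E/F)$, $E^1=\ker(N_{E/F})\subset E^*$, and $\omega_{E/F}$ is the quadratic character of $F^*$ with kernel $N_{E/F}(E^* )$. A character of $E^*$ is ramified if it is nontrivial on $\mathcal{O}_E^\times$. For a character $\bar\chi$ of $E^*$, ${}^s\bar\chi^{-1}(x)=\bar\chi(s(x))^{-1}$. For $a\in F$, $\psi_a(x)=\psi(ax)$. Groups. $\bar G=U(1,1)(F)$ is the group of $g\in GL_2(E)$ with ${}^s g\,J\,{}^t g=J$, where $J=\begin{pmatrix}0&1\\-1&0\end{pmatrix}$. $\bar Z\cong E^1$ is its center, $\bar B=\bar T N$ its upper triangular Borel subgroup, with $\bar T=\{\mathrm{diag}(t,s(t)^{-1}):t\in E^*\}$ and $N$ the group of upper triangular unipotent matrices with entries in $F$. $\bar K_0=\bar K=\bar G\cap GL_2(\mathcal{O}_E)$; for $m\ge1$, $\bar K_m=\{\begin{pmatrix}a&b\\c&d\end{pmatrix}\in\bar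 K_0: c\in\mathcal{P}_E^m\}$; and $\bar K_m'=\alpha^{-1}\bar K_m\alpha$ for $m\ge0$, where $\alpha=\mathrm{diag}(\varpi_F,1)$. With $K_0=SL_2(\mathcal{O}_F)$, $K_m=\bar K_m\cap SL_2(F)$ and $\bar T_0=\bar T\cap\bar K_0$, one has $\bar K_m=K_m\bar T_0$. Conductors. Let $(\bar\pi,V)$ be an irreducible admissible infinite-dimensional representation of $\bar G$ with central character $\omega_{\bar\pi}$ (a character of $E^1$), and let $\bar\eta$ be a character of $\mathcal{O}_E^\times$ with $\bar\eta|_{E^1}=\omega_{\bar\pi}$. For $\bar H=\bar K_m$ or $\bar K'_m$, $$\bar\pi_{\bar\eta}^{\bar H}=\{v\in V:\bar\pi(g)v=\bar\eta(d)v\ \text{ for all } g=\begin{pmatrix}a&b\\c&d\end{pmatrix}\in\bar H\}.$$ For $m=0$, where $d$ need not be a unit, this is understood as follows: if $\bar\eta|_{\mathcal{O}_F^\times}\ne 1$ the space is $0$; if $\bar\eta|_{\mathcal{O}_F^\times}=1$, then $\bar\eta(d)$ is replaced by the character of $\bar K_0=K_0\bar T_0$ sending $k\cdot\mathrm{diag}(t,s(t)^{-1})$ to $\bar\eta(s(t)^{-1})$ (and by its conjugate by $\alpha$ for $\bar K_0'$). Put $$c_{\bar\eta}(\bar\pi)=\min\{m\ge0:\bar\pi_{\bar\eta}^{\bar K_m}\neq0\text{ or }\bar\pi_{\bar\eta}^{\bar K_m'}\ne0\},\qquad c(\bar\pi)=\min\{c_{\bar\eta}(\bar\pi):\bar\eta|_{E^1}=\omega_{\bar\pi}\}.$$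 If $c_{\bar\eta}(\bar\pi)=c(\bar\pi)=c$, a nonzero space $\bar\pi_{\bar\eta}^{\bar K_c}$ or $\bar\pi_{\bar\eta}^{\bar K'_c}$ is called a space of newforms, and its nonzero elements are newforms. Principal series. $\bar\pi(\bar\chi)=\mathrm{Ind}_{\bar B}^{\bar G}(\bar\chi)$ is normalized induction: smooth functions $f$ with $f(bg)=\bar\chi(t)|t|_E^{1/2}f(g)$ for $b\in\bar B$ with diagonal entries $t,s(t)^{-1}$. It is irreducible unless (1) $\bar\chi|_{F^*}=|\cdot|_F^{\pm1}$, when its two constituents are a one-dimensional representation and an infinite-dimensional square-integrable one; or (2) $\bar\chi|_{F^*}=\omega_{E/F}$, when it is a direct sum $\bar\pi^1(\bar\chi)\oplus\bar\pi^2(\bar\chi)$ of two irreducible representations, where $\bar\pi^1(\bar\chi)$ denotes the summand having a nonzero $SL_2(\mathcal{O}_F)$-fixed vector. Whittaker functionals. For a nontrivial additive character $\Psi$ of $F$, a $\Psi$-Whittaker functional on $\bar\pi$ is a linear functional $\ell$ with $\ell(\bar\pi(\begin{pmatrix}1&x\\0&1\end{pmatrix})v)=\Psi(x)\ell(v)$ for all $x\in F$ and all $v$; $\bar\pi$ is $\Psi$-generic if a nonzero one exists. On $\bar\pi(\bar\chi)$ and its subrepresentations, $\Lambda_\Psi$ is the $\Psi$-Whittaker functional $$\Lambda_\Psi f=\lim_{r\to\infty}\int_{\mathcal{P}_F^{-r}}f\left(\begin{pmatrix}0&-1\\1&0\end{pmatrix}\begin{pmatrix}1&x\\0&1\end{pmatrix}\right)\overline{\Psi}(x)\,dx,$$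 with $\mathrm{vol}(\mathcal{O}_F)=1$. *)

theory Defs
  imports "HOL-Analysis.Analysis" "HOL-Library.Function_Algebras" "HOL-Library.Extended_Nat"
begin

section \<open>Local fields\<close>

text \<open>
  Fields are carrier sets inside an ambient field type. A valuation is a function
  \<open>v :: 'e \<Rightarrow> int\<close> whose value at \<open>0\<close> is irrelevant; \<open>pideal K v n\<close> is the fractional ideal
  \<open>\<P>\<^sup>n\<close> of \<open>K\<close>, so that \<open>\<O> = \<P>\<^sup>0\<close>.
\<close>

definition subfield_set :: "'e::field set \<Rightarrow> bool" where
  "subfield_set K \<longleftrightarrow> 0 \<in> K \<and> 1 \<in> K \<and>
     (\<forall>x\<in>K. \<forall>y\<in>K. x - y \<in> K \<and> x * y \<in> K) \<and> (\<forall>x\<in>K. inverse x \<in> K)"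

definition discrete_valuation :: "'e::field set \<Rightarrow> ('e \<Rightarrow> int) \<Rightarrow> bool" where
  "discrete_valuation K v \<longleftrightarrow>
     (\<forall>x\<in>K - {0}. \<forall>y\<in>K - {0}. v (x * y) = v x + v y) \<and>
     (\<forall>x\<in>K - {0}. \<forall>y\<in>K - {0}. x + y \<noteq> 0 \<longrightarrow> min (v x) (v y) \<le> v (x + y)) \<and>
     v ` (K - {0}) = UNIV"

definition pideal :: "'e::field set \<Rightarrow> ('e \<Rightarrow> int) \<Rightarrow> int \<Rightarrow> 'e set" where
  "pideal K v n = {x \<in> K. x = 0 \<or> n \<le> v x}"

abbreviation int_ring :: "'e::field set \<Rightarrow> ('e \<Rightarrow> int) \<Rightarrow> 'e set" where
  "int_ring K v \<equiv> pideal K v 0"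

definition int_units :: "'e::field set \<Rightarrow> ('e \<Rightarrow> int) \<Rightarrow> 'e set" where
  "int_units K v = {x \<in> K. x \<noteq> 0 \<and> v x = 0}"

definition residue_field :: "'e::field set \<Rightarrow> ('e \<Rightarrow> int) \<Rightarrow> 'e set set" where
  "residue_field K v = (\<lambda>x. {y \<in> int_ring K v. y - x \<in> pideal K v 1}) ` int_ring K v"

definition residue_char :: "'e::field set \<Rightarrow> ('e \<Rightarrow> int) \<Rightarrow> nat" where
  "residue_char K v = (LEAST p. 0 < p \<and> of_nat p \<in> pideal K v 1)"

definition norm_abs :: "'e::field set \<Rightarrow> ('e \<Rightarrow> int) \<Rightarrow> 'e \<Rightarrow> real" where
  "norm_abs K v x = (if x = 0 then 0 else real (card (residue_field K v)) powi (- v x))"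

abbreviation val_dist :: "'e::field set \<Rightarrow> ('e \<Rightarrow> int) \<Rightarrow> 'e \<Rightarrow> 'e \<Rightarrow> real" where
  "val_dist K v \<equiv> (\<lambda>x y. norm_abs K v (x - y))"

definition val_top :: "'e::field set \<Rightarrow> ('e \<Rightarrow> int) \<Rightarrow> 'e topology" where
  "val_top K v = Metric_space.mtopology K (val_dist K v)"

definition nonarch_local_field :: "'e::field set \<Rightarrow> ('e \<Rightarrow> int) \<Rightarrow> bool" where
  "nonarch_local_field K v \<longleftrightarrow> subfield_set K \<and> discrete_valuation K v \<and>
     finite (residue_field K v) \<and> Metric_space.mcomplete K (val_dist K v)"

section \<open>The unramified quadratic extension\<close>

text \<open>
  The extension field \<open>E\<close> is the whole type \<open>'e\<close>; \<open>Fld\<close> is \<open>F\<close>, \<open>gal\<close> is the nontrivial element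
  \<open>s\<close> of the Galois group and \<open>unif\<close> is the chosen uniformizer of \<open>F\<close>.
\<close>

record 'e quad_ext =
  Fld :: "'e set"
  val :: "'e \<Rightarrow> int"
  gal :: "'e \<Rightarrow> 'e"
  unif :: 'e

text \<open>
  A single function \<open>val\<close> is the normalized (surjective) valuation both on \<open>E\<close> and, restricted,
  on \<open>F\<close>: the ramification index is \<open>1\<close>.
\<close>

definition unramified_quadratic :: "'e::field quad_ext \<Rightarrow> bool" where
  "unramified_quadratic X \<longleftrightarrow>
     nonarch_local_field (Fld X) (val X) \<and>
     nonarch_local_field UNIV (val X) \<and>
     (\<exists>b. b \<notin> Fld X \<and> (\<forall>x. \<exists>c\<in>Fld X. \<exists>d\<in>Fld X. x = c + d * b)) \<and>
     bij (gal X) \<and>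
     (\<forall>x y. gal X (x + y) = gal X x + gal X y \<and> gal X (x * y) = gal X x * gal X y) \<and>
     (\<forall>x\<in>Fld X. gal X x = x) \<and> gal X \<noteq> id \<and>
     unif X \<in> Fld X \<and> unif X \<noteq> 0 \<and> val X (unif X) = 1"

abbreviation OF :: "'e::field quad_ext \<Rightarrow> 'e set" where "OF X \<equiv> int_ring (Fld X) (val X)"
abbreviation OE :: "'e::field quad_ext \<Rightarrow> 'e set" where "OE X \<equiv> int_ring UNIV (val X)"
abbreviation PF :: "'e::field quad_ext \<Rightarrow> int \<Rightarrow> 'e set" where "PF X n \<equiv> pideal (Fld X) (val X) n"
abbreviation PE :: "'e::field quad_ext \<Rightarrow> int \<Rightarrow> 'e set" where "PE X n \<equiv> pideal UNIV (val X) n"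
abbreviation OF_units :: "'e::field quad_ext \<Rightarrow> 'e set" where
  "OF_units X \<equiv> int_units (Fld X) (val X)"
abbreviation OE_units :: "'e::field quad_ext \<Rightarrow> 'e set" where
  "OE_units X \<equiv> int_units UNIV (val X)"
abbreviation absE :: "'e::field quad_ext \<Rightarrow> 'e \<Rightarrow> real" where "absE X \<equiv> norm_abs UNIV (val X)"

definition E1 :: "'e::field quad_ext \<Rightarrow> 'e set" where
  "E1 X = {z. z * gal X z = 1}"

definition omegaEF :: "'e::field quad_ext \<Rightarrow> 'e \<Rightarrow> complex" where
  "omegaEF X x = (if \<exists>y. y \<noteq> 0 \<and> x = y * gal X y then 1 else - 1)"

text \<open>Characters of a multiplicative subgroup \<open>S\<close> of \<open>E\<^sup>*\<close> are continuous, not necessarily unitary;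
  values outside \<open>S\<close> are irrelevant.\<close>

definition is_char :: "'e::field quad_ext \<Rightarrow> 'e set \<Rightarrow> ('e \<Rightarrow> complex) \<Rightarrow> bool" where
  "is_char X S chi \<longleftrightarrow>
     (\<forall>x\<in>S. chi x \<noteq> 0) \<and> (\<forall>x\<in>S. \<forall>y\<in>S. chi (x * y) = chi x * chi y) \<and>
     continuous_map (subtopology (val_top UNIV (val X)) S) euclidean chi"

definition ramified :: "'e::field quad_ext \<Rightarrow> ('e \<Rightarrow> complex) \<Rightarrow> bool" where
  "ramified X chi \<longleftrightarrow> (\<exists>x\<in>OE_units X. chi x \<noteq> 1)"

definition is_additive_char :: "'e::field quad_ext \<Rightarrow> ('e \<Rightarrow> complex) \<Rightarrow> bool" where
  "is_additive_char X \<Psi> \<longleftrightarrow>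
     (\<forall>x\<in>Fld X. cmod (\<Psi> x) = 1) \<and> (\<forall>x\<in>Fld X. \<forall>y\<in>Fld X. \<Psi> (x + y) = \<Psi> x * \<Psi> y) \<and>
     continuous_map (val_top (Fld X) (val X)) euclidean \<Psi>"

text \<open>Haar measure on \<open>(F,+)\<close>, on the Borel sets of \<open>F\<close>, with \<open>vol(\<O>\<^sub>F) = 1\<close>.\<close>

definition is_haar_measure :: "'e::field quad_ext \<Rightarrow> 'e measure \<Rightarrow> bool" where
  "is_haar_measure X \<mu> \<longleftrightarrow>
     space \<mu> = Fld X \<and>
     sets \<mu> = sigma_sets (Fld X) {U. openin (val_top (Fld X) (val X)) U} \<and>
     (\<forall>A\<in>sets \<mu>. \<forall>a\<in>Fld X. emeasure \<mu> ((\<lambda>x. a + x) ` A) = emeasure \<mu> A) \<and>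
     emeasure \<mu> (OF X) = 1"

section \<open>The group \<open>U(1,1)\<close> and its subgroups\<close>

definition mat2 :: "'e \<Rightarrow> 'e \<Rightarrow> 'e \<Rightarrow> 'e \<Rightarrow> 'e::zero^2^2" where
  "mat2 a b c d = vector [vector [a, b], vector [c, d]]"

definition Jmat :: "'e::field^2^2" where
  "Jmat = mat2 0 1 (- 1) 0"

definition U11 :: "'e::field quad_ext \<Rightarrow> ('e^2^2) set" where
  "U11 X = {g. invertible g \<and> map_matrix (gal X) g ** Jmat ** transpose g = Jmat}"

definition tdiag :: "'e::field quad_ext \<Rightarrow> 'e \<Rightarrow> 'e^2^2" where
  "tdiag X t = mat2 t 0 0 (inverse (gal X t))"

definition unip :: "'e::field \<Rightarrow> 'e^2^2" where
  "unip x = mat2 1 x 0 1"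

definition weyl :: "'e::field^2^2" where
  "weyl = mat2 0 (- 1) 1 0"

definition alpha :: "'e::field quad_ext \<Rightarrow> 'e^2^2" where
  "alpha X = mat2 (unif X) 0 0 1"

definition Borel :: "'e::field quad_ext \<Rightarrow> ('e^2^2) set" where
  "Borel X = {tdiag X t ** unip x | t x. t \<noteq> 0 \<and> x \<in> Fld X}"

definition SL2OF :: "'e::field quad_ext \<Rightarrow> ('e^2^2) set" where
  "SL2OF X = {k. (\<forall>i j. k $ i $ j \<in> OF X) \<and> det k = 1}"

definition GL2OE :: "'e::field quad_ext \<Rightarrow> ('e^2^2) set" where
  "GL2OE X = {g. (\<forall>i j. g $ i $ j \<in> OE X) \<and> det g \<in> OE_units X}"

definition Kbar :: "'e::field quad_ext \<Rightarrow> nat \<Rightarrow> ('e^2^2) set" where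
  "Kbar X m = {g \<in> U11 X \<inter> GL2OE X. g $ 2 $ 1 \<in> PE X (int m)}"

definition Kbar' :: "'e::field quad_ext \<Rightarrow> nat \<Rightarrow> ('e^2^2) set" where
  "Kbar' X m = (\<lambda>g. matrix_inv (alpha X) ** g ** alpha X) ` Kbar X m"

text \<open>The principal congruence subgroups form a neighbourhood base of the identity in \<open>U(1,1)\<close>.\<close>

definition congruence_subgroup :: "'e::field quad_ext \<Rightarrow> nat \<Rightarrow> ('e^2^2) set" where
  "congruence_subgroup X n = {g \<in> U11 X \<inter> GL2OE X. \<forall>i j. (g - mat 1) $ i $ j \<in> PE X (int n)}"

section \<open>Spaces of functions on the group\<close>

definition cscale :: "complex \<Rightarrow> ('a \<Rightarrow> complex) \<Rightarrow> 'a \<Rightarrow> complex" where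
  "cscale c f = (\<lambda>x. c * f x)"

global_interpretation cfun: vector_space "cscale :: complex \<Rightarrow> ('a \<Rightarrow> complex) \<Rightarrow> 'a \<Rightarrow> complex"
  defines cfun_subspace = cfun.subspace and cfun_span = cfun.span and cfun_dim = cfun.dim
  by unfold_locales (auto simp: cscale_def fun_eq_iff algebra_simps)

definition rtrans :: "'e::field^2^2 \<Rightarrow> ('e^2^2 \<Rightarrow> complex) \<Rightarrow> 'e^2^2 \<Rightarrow> complex" where
  "rtrans g f = (\<lambda>h. f (h ** g))"

text \<open>
  Normalized induction. A function on \<open>U(1,1)\<close> is represented by its extension by zero to all
  matrices, a convention preserved by \<open>rtrans g\<close> for \<open>g\<close> in \<open>U(1,1)\<close>.
  Smoothness is invariance under right translation by some open subgroup.
\<close>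

definition principal_series ::
    "'e::field quad_ext \<Rightarrow> ('e \<Rightarrow> complex) \<Rightarrow> ('e^2^2 \<Rightarrow> complex) set" where
  "principal_series X chi = {f.
     (\<forall>g. g \<notin> U11 X \<longrightarrow> f g = 0) \<and>
     (\<exists>n. \<forall>k\<in>congruence_subgroup X n. rtrans k f = f) \<and>
     (\<forall>b\<in>Borel X. \<forall>g\<in>U11 X.
        f (b ** g) = chi (b $ 1 $ 1) * of_real (sqrt (absE X (b $ 1 $ 1))) * f g)}"

definition subrep ::
    "'e::field quad_ext \<Rightarrow> ('e^2^2 \<Rightarrow> complex) set \<Rightarrow> ('e^2^2 \<Rightarrow> complex) set \<Rightarrow> bool" where
  "subrep X W V \<longleftrightarrow> W \<subseteq> V \<and> cfun_subspace W \<and> (\<forall>g\<in>U11 X. \<forall>f\<in>W. rtrans g f \<in> W)"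

definition irreducible_rep :: "'e::field quad_ext \<Rightarrow> ('e^2^2 \<Rightarrow> complex) set \<Rightarrow> bool" where
  "irreducible_rep X V \<longleftrightarrow> V \<noteq> {0} \<and> (\<forall>W. subrep X W V \<longrightarrow> W = {0} \<or> W = V)"

definition infinite_dim :: "('a \<Rightarrow> complex) set \<Rightarrow> bool" where
  "infinite_dim V \<longleftrightarrow> \<not> (\<exists>B. finite B \<and> V \<subseteq> cfun_span B)"

definition central_char ::
    "'e::field quad_ext \<Rightarrow> ('e^2^2 \<Rightarrow> complex) set \<Rightarrow> 'e \<Rightarrow> complex" where
  "central_char X V z = (THE c. \<forall>f\<in>V. rtrans (mat z) f = cscale c f)"

section \<open>Conductors and newforms\<close>

text \<open>\<open>eta_space\<close> and \<open>eta_space'\<close> are the \<open>\<eta>\<close>-isotypic spaces for \<open>Kbar X m\<close> and \<open>Kbar' X m\<close>.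
  For \<open>m = 0\<close> the lower right entry need not be a unit; if \<open>\<eta>\<close> is trivial on \<open>\<O>\<^sub>F\<^sup>\<times>\<close> one uses instead the
  character \<open>k ** tdiag X t \<mapsto> \<eta> (inverse (gal X t))\<close> of \<open>Kbar X 0 = SL\<^sub>2(\<O>\<^sub>F) T\<^sub>0\<close>.\<close>

definition eta_space ::
    "'e::field quad_ext \<Rightarrow> ('e^2^2 \<Rightarrow> complex) set \<Rightarrow> ('e \<Rightarrow> complex) \<Rightarrow> nat \<Rightarrow>
     ('e^2^2 \<Rightarrow> complex) set" where
  "eta_space X V \<eta> m =
    (if m = 0 then
       (if \<forall>u\<in>OF_units X. \<eta> u = 1 then
          {f \<in> V. \<forall>k\<in>SL2OF X. \<forall>t\<in>OE_units X.
             rtrans (k ** tdiag X t) f = cscale (\<eta> (inverse (gal X t))) f}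
        else {0})
     else {f \<in> V. \<forall>g\<in>Kbar X m. rtrans g f = cscale (\<eta> (g $ 2 $ 2)) f})"

definition eta_space' ::
    "'e::field quad_ext \<Rightarrow> ('e^2^2 \<Rightarrow> complex) set \<Rightarrow> ('e \<Rightarrow> complex) \<Rightarrow> nat \<Rightarrow>
     ('e^2^2 \<Rightarrow> complex) set" where
  "eta_space' X V \<eta> m =
    (if m = 0 then
       (if \<forall>u\<in>OF_units X. \<eta> u = 1 then
          {f \<in> V. \<forall>k\<in>SL2OF X. \<forall>t\<in>OE_units X.
             rtrans (matrix_inv (alpha X) ** (k ** tdiag X t) ** alpha X) f =
               cscale (\<eta> (inverse (gal X t))) f}
        else {0})
     else {f \<in> V. \<forall>g\<in>Kbar' X m. rtrans g f = cscale (\<eta> (g $ 2 $ 2)) f})"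

definition eta_compatible ::
    "'e::field quad_ext \<Rightarrow> ('e^2^2 \<Rightarrow> complex) set \<Rightarrow> ('e \<Rightarrow> complex) \<Rightarrow> bool" where
  "eta_compatible X V \<eta> \<longleftrightarrow>
     is_char X (OE_units X) \<eta> \<and> (\<forall>z\<in>E1 X. \<eta> z = central_char X V z)"

text \<open>The minima are taken in \<open>enat\<close>, so that a minimum over the empty set would be \<open>\<infinity>\<close>.\<close>

definition cond_eta ::
    "'e::field quad_ext \<Rightarrow> ('e^2^2 \<Rightarrow> complex) set \<Rightarrow> ('e \<Rightarrow> complex) \<Rightarrow> enat" where
  "cond_eta X V \<eta> = Inf {enat m | m. eta_space X V \<eta> m \<noteq> {0} \<or> eta_space' X V \<eta> m \<noteq> {0}}"

definition conductor :: "'e::field quad_ext \<Rightarrow> ('e^2^2 \<Rightarrow> complex) set \<Rightarrow> enat" where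
  "conductor X V = Inf {cond_eta X V \<eta> | \<eta>. eta_compatible X V \<eta>}"

definition newform_space ::
    "'e::field quad_ext \<Rightarrow> ('e^2^2 \<Rightarrow> complex) set \<Rightarrow> ('e \<Rightarrow> complex) \<Rightarrow>
     ('e^2^2 \<Rightarrow> complex) set \<Rightarrow> bool" where
  "newform_space X V \<eta> W \<longleftrightarrow> W \<noteq> {0} \<and>
     (\<exists>c. cond_eta X V \<eta> = enat c \<and> conductor X V = enat c \<and>
          (W = eta_space X V \<eta> c \<or> W = eta_space' X V \<eta> c))"

section \<open>Reducible principal series and Whittaker functionals\<close>

definition is_pi1 ::
    "'e::field quad_ext \<Rightarrow> ('e \<Rightarrow> complex) \<Rightarrow> ('e^2^2 \<Rightarrow> complex) set \<Rightarrow> bool" where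
  "is_pi1 X chi V \<longleftrightarrow> (\<forall>x\<in>Fld X - {0}. chi x = omegaEF X x) \<and>
     subrep X V (principal_series X chi) \<and> irreducible_rep X V \<and>
     (\<exists>f\<in>V. f \<noteq> 0 \<and> (\<forall>k\<in>SL2OF X. rtrans k f = f))"

definition is_pi2 ::
    "'e::field quad_ext \<Rightarrow> ('e \<Rightarrow> complex) \<Rightarrow> ('e^2^2 \<Rightarrow> complex) set \<Rightarrow> bool" where
  "is_pi2 X chi V \<longleftrightarrow> (\<forall>x\<in>Fld X - {0}. chi x = omegaEF X x) \<and>
     subrep X V (principal_series X chi) \<and> irreducible_rep X V \<and>
     (\<exists>W. is_pi1 X chi W \<and> V \<inter> W = {0} \<and> principal_series X chi = {f + g | f g. f \<in> V \<and> g \<in> W})"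

definition whittaker_functional ::
    "'e::field quad_ext \<Rightarrow> ('e^2^2 \<Rightarrow> complex) set \<Rightarrow> ('e \<Rightarrow> complex) \<Rightarrow>
     (('e^2^2 \<Rightarrow> complex) \<Rightarrow> complex) \<Rightarrow> bool" where
  "whittaker_functional X V \<Psi> l \<longleftrightarrow>
     (\<forall>f\<in>V. \<forall>g\<in>V. l (f + g) = l f + l g) \<and> (\<forall>c. \<forall>f\<in>V. l (cscale c f) = c * l f) \<and>
     (\<forall>x\<in>Fld X. \<forall>f\<in>V. l (rtrans (unip x) f) = \<Psi> x * l f)"

definition generic ::
    "'e::field quad_ext \<Rightarrow> ('e^2^2 \<Rightarrow> complex) set \<Rightarrow> ('e \<Rightarrow> complex) \<Rightarrow> bool" where
  "generic X V \<Psi> \<longleftrightarrow> (\<exists>l. whittaker_functional X V \<Psi> l \<and> (\<exists>f\<in>V. l f \<noteq> 0))"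

definition Lambda ::
    "'e::field quad_ext \<Rightarrow> 'e measure \<Rightarrow> ('e \<Rightarrow> complex) \<Rightarrow> ('e^2^2 \<Rightarrow> complex) \<Rightarrow> complex" where
  "Lambda X \<mu> \<Psi> f =
     lim (\<lambda>r::nat. LINT x : PF X (- int r) | \<mu>. f (weyl ** unip x) * cnj (\<Psi> x))"

end

theory Submission
  imports Defs
begin

text \<open>
  Up to an explicit multiplier, a function \<open>f\<close> in the principal series depends only on the bottom
  row of its argument, so it is determined by \<open>f(1)\<close> and by \<open>\<phi>(x) = f(w n(x))\<close> on \<open>F\<close>. The function
  \<open>\<phi>\<close> is locally constant and a multiple of \<open>\<chi>\<^sup>-\<^sup>1|\<cdot>|\<^sup>-\<^sup>1\<close> near infinity, and \<open>\<Lambda>\<close> for the character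
  \<open>\<psi>\<^sub>a\<close> is its Fourier coefficient at \<open>a\<close>. By Fourier inversion a vector killed by all \<open>\<Lambda>\<close> with
  \<open>a \<noteq> 0\<close> has constant \<open>\<phi>\<close> and would span a one-dimensional subrepresentation, so an irreducible
  infinite-dimensional \<open>V\<close> contains no such vector except \<open>0\<close>.

  If \<open>\<Lambda>\<^sub>\<psi>\<close> kills a newform \<open>v\<close> of level \<open>c\<close>, then by the torus action \<open>v\<close> is killed for every \<open>a\<close> of
  valuation at most \<open>0\<close>, hence \<open>v\<close> is fixed by \<open>n(\<P>\<^sup>-\<^sup>1)\<close>. Together with \<open>K\<^sub>c\<close> this group generates
  \<open>K'\<^sub>c\<^sub>-\<^sub>1\<close> (all of \<open>SL\<^sub>2(F)\<close> if \<open>c = 0\<close>), which contradicts the minimality of \<open>c\<close>.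

  Averaging a vector against \<open>\<psi>\<^sub>a\<close> over a large ball yields the vector with \<open>\<phi> = \<psi>\<^sub>a\<close> on that ball and
  \<open>0\<close> elsewhere. This gives uniqueness of Whittaker functionals. It also puts explicit vectors into
  \<open>V\<close>: if \<open>V\<close> is not \<open>\<psi>\<close>-generic, evaluating \<open>\<Lambda>\<close> on their Weyl translates forces \<open>\<chi> = \<omega>\<close> on \<open>F\<^sup>*\<close>,
  and these vectors show that \<open>V\<close> and its conjugate by \<open>\<alpha>\<close> span the principal series.
\<close>

text \<open>The torus moves the index a of \<open>Lam a\<close> by norms from E, and in the
  unramified case the norms are exactly the elements of even valuation. Hence whether
  \<open>Lam a\<close> kills all of V depends only on the parity of \<open>v a\<close>. The first
  summand carries the even indices and the second the odd ones, which is why (iii) needs another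
  character than \<psi>.

  In parts (i) to (iii) chi is trivial on the units of F; in (i) this holds because every unit of F
  is the norm of a unit. The vectors fixed by SL_2(O_F) then form a line and the Iwahori
  eigenvectors a plane, on which \<open>Lam 1\<close> is nonzero. Its kernel is the line in (i).

  The integral defining \<Lambda> need not converge absolutely. Beyond an explicit radius every
  coset of the next shell integrates to zero, so the limit is one truncated integral, and this is a
  finite sum over representatives.

  A nongeneric V has no vectors at even indices to compute with. Test vectors are built from odd
  indices and moved by the Weyl element; the even coefficients of the result must vanish, and this
  determines chi on F.\<close>

locale unram_ext =
  fixes X :: "'e::field quad_ext"
  assumes ext: "unramified_quadratic X"
    and odd_char: "odd (residue_char (Fld X) (val X))"
begin

abbreviation K where "K \<equiv> Fld X"
abbreviation v where "v \<equiv> val X"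
abbreviation \<sigma> where "\<sigma> \<equiv> gal X"
abbreviation \<pi> where "\<pi> \<equiv> unif X"
abbreviation P where "P n \<equiv> pideal UNIV (val X) n"

definition q :: real where "q = real (card (residue_field K v))"

section \<open>Arithmetic of the subfield F, of the valuation and of the fractional ideals\<close>

lemma K_0 [simp]: "0 \<in> K" and K_1 [simp]: "1 \<in> K"
  and K_diff [simp]: "x \<in> K \<Longrightarrow> y \<in> K \<Longrightarrow> x - y \<in> K"
  and K_mult [simp]: "x \<in> K \<Longrightarrow> y \<in> K \<Longrightarrow> x * y \<in> K"
  and K_inverse [simp]: "x \<in> K \<Longrightarrow> inverse x \<in> K"
  using ext unfolding unramified_quadratic_def nonarch_local_field_def subfield_set_def by auto

lemma K_minus [simp]: "x \<in> K \<Longrightarrow> - x \<in> K"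
  using K_diff[of 0 x] by simp

lemma K_add [simp]: "x \<in> K \<Longrightarrow> y \<in> K \<Longrightarrow> x + y \<in> K"
  using K_diff[of x "- y"] by simp

lemma K_divide [simp]: "x \<in> K \<Longrightarrow> y \<in> K \<Longrightarrow> x / y \<in> K"
  by (simp add: divide_inverse)

lemma K_power [simp]: "x \<in> K \<Longrightarrow> x ^ n \<in> K"
  by (induction n) auto

lemma K_of_nat [simp]: "of_nat n \<in> K"
  by (induction n) auto

lemma K_numeral [simp]: "numeral n \<in> K"
  using K_of_nat[of "numeral n"] by simp

lemma K_power_int [simp]: "x \<in> K \<Longrightarrow> x powi n \<in> K"
  by (auto simp: power_int_def)

lemma K_mult_cancel: "x \<in> K \<Longrightarrow> x \<noteq> 0 \<Longrightarrow> x * y \<in> K \<longleftrightarrow> y \<in> K"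
  using K_mult[of "inverse x" "x * y"] by (auto simp: mult.assoc[symmetric])

lemma unif_K [simp]: "\<pi> \<in> K" and unif_nz [simp]: "\<pi> \<noteq> 0" and v_unif [simp]: "v \<pi> = 1"
  using ext unfolding unramified_quadratic_def by auto

lemma v_mult [simp]: "x \<noteq> 0 \<Longrightarrow> y \<noteq> 0 \<Longrightarrow> v (x * y) = v x + v y"
  and v_add: "x \<noteq> 0 \<Longrightarrow> y \<noteq> 0 \<Longrightarrow> x + y \<noteq> 0 \<Longrightarrow> min (v x) (v y) \<le> v (x + y)"
proof -
  have "discrete_valuation UNIV v"
    using ext unfolding unramified_quadratic_def nonarch_local_field_def by blast
  then show "x \<noteq> 0 \<Longrightarrow> y \<noteq> 0 \<Longrightarrow> v (x * y) = v x + v y"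
    and "x \<noteq> 0 \<Longrightarrow> y \<noteq> 0 \<Longrightarrow> x + y \<noteq> 0 \<Longrightarrow> min (v x) (v y) \<le> v (x + y)"
    unfolding discrete_valuation_def by blast+
qed

lemma v_1 [simp]: "v 1 = 0"
  using v_mult[of 1 1] by simp

lemma v_inverse [simp]: "x \<noteq> 0 \<Longrightarrow> v (inverse x) = - v x"
  using v_mult[of x "inverse x"] by simp

lemma v_divide [simp]: "x \<noteq> 0 \<Longrightarrow> y \<noteq> 0 \<Longrightarrow> v (x / y) = v x - v y"
  by (simp add: divide_inverse)

lemma v_minus_1: "v (- 1) = 0"
  using v_mult[of "-1" "-1"] by simp

lemma v_minus [simp]: "v (- x) = v x"
proof (cases "x = 0")
  case False
  then show ?thesis using v_mult[of "- 1" x] v_minus_1 by simp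
qed simp

lemma v_power [simp]: "x \<noteq> 0 \<Longrightarrow> v (x ^ n) = int n * v x"
  by (induction n) (auto simp: algebra_simps)

lemma v_power_int [simp]: "x \<noteq> 0 \<Longrightarrow> v (x powi n) = n * v x"
  by (auto simp: power_int_def)

lemma P_iff: "x \<in> P n \<longleftrightarrow> x = 0 \<or> n \<le> v x"
  by (simp add: pideal_def)

lemma PF_iff: "x \<in> PF X n \<longleftrightarrow> x \<in> K \<and> x \<in> P n"
  by (simp add: pideal_def)

lemma P_0 [simp]: "0 \<in> P n"
  by (simp add: P_iff)

lemma P_1_iff [simp]: "1 \<in> P n \<longleftrightarrow> n \<le> 0"
  by (simp add: P_iff)

lemma P_minus_iff [simp]: "- x \<in> P n \<longleftrightarrow> x \<in> P n"
  by (simp add: P_iff)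

lemma P_add [intro]: "x \<in> P n \<Longrightarrow> y \<in> P n \<Longrightarrow> x + y \<in> P n"
  using v_add[of x y] by (cases "x + y = 0") (force simp: P_iff)+

lemma P_diff [intro]: "x \<in> P n \<Longrightarrow> y \<in> P n \<Longrightarrow> x - y \<in> P n"
  using P_add[of x n "- y"] by simp

lemma P_mult: "x \<in> P m \<Longrightarrow> y \<in> P n \<Longrightarrow> x * y \<in> P (m + n)"
  by (cases "x = 0"; cases "y = 0") (auto simp: P_iff)

lemma P_mult': "x \<in> P m \<Longrightarrow> y \<in> P n \<Longrightarrow> k \<le> m + n \<Longrightarrow> x * y \<in> P k"
  by (cases "x = 0"; cases "y = 0") (auto simp: P_iff)

lemma P_mono: "x \<in> P m \<Longrightarrow> n \<le> m \<Longrightarrow> x \<in> P n"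
  by (auto simp: P_iff)

lemma P_diff_swap: "x - y \<in> P n \<Longrightarrow> y - x \<in> P n"
  using P_minus_iff[of "x - y" n] by simp

lemma P_trans: "x - y \<in> P n \<Longrightarrow> y - z \<in> P n \<Longrightarrow> x - z \<in> P n"
  using P_add[of "x - y" n "y - z"] by simp

lemma v_add_eq: "x \<noteq> 0 \<Longrightarrow> y \<in> P (v x + 1) \<Longrightarrow> x + y \<noteq> 0 \<and> v (x + y) = v x"
proof -
  assume x: "x \<noteq> 0" and y: "y \<in> P (v x + 1)"
  have nz: "x + y \<noteq> 0"
  proof
    assume "x + y = 0"
    hence "x = - y" by (simp add: eq_neg_iff_add_eq_0)
    then show False using x y by (auto simp: P_iff)
  qed
  show "x + y \<noteq> 0 \<and> v (x + y) = v x"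
  proof (cases "y = 0")
    case False
    have "min (v x) (v y) \<le> v (x + y)" using v_add[of x y] nz x False by auto
    moreover have "min (v (x + y)) (v (- y)) \<le> v x" using v_add[of "x+y" "- y"] nz x False by auto
    ultimately show ?thesis using nz False y by (auto simp: P_iff)
  qed (use x in auto)
qed

lemma v_add_eq': "x \<noteq> 0 \<Longrightarrow> y - x \<in> P (v x + 1) \<Longrightarrow> y \<noteq> 0 \<and> v y = v x"
  using v_add_eq[of x "y - x"] by simp

subsection \<open>Residue fields and completeness\<close>

lemma card_residue_ge2:
  assumes "finite (residue_field L v)" "1 \<in> L" "0 \<in> L"
  shows "2 \<le> card (residue_field L v)"
proof -
  let ?c = "\<lambda>x. {y \<in> int_ring L v. y - x \<in> pideal L v 1}"
  have "1 \<in> ?c 1" "1 \<notin> ?c 0" using assms(2,3) by (auto simp: pideal_def)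
  hence "?c 0 \<noteq> ?c 1" by blast
  moreover have "0 \<in> int_ring L v" "1 \<in> int_ring L v"
    using assms(2,3) by (auto simp: pideal_def)
  hence "{?c 0, ?c 1} \<subseteq> residue_field L v"
    unfolding residue_field_def by blast
  ultimately show ?thesis
    using card_mono[OF assms(1), of "{?c 0, ?c 1}"] by auto
qed

lemma fin_residue: "finite (residue_field K v)" "finite (residue_field UNIV v)"
  using ext unfolding unramified_quadratic_def nonarch_local_field_def by auto

lemma q_ge2: "2 \<le> q"
  using card_residue_ge2[OF fin_residue(1)] by (auto simp: q_def)

lemma q_gt0 [simp]: "0 < q" and q_gt1 [simp]: "1 < q" and q_nz [simp]: "q \<noteq> 0"
  using q_ge2 by auto

lemma q_powi_pos [simp]: "0 < q powi n" "0 \<le> q powi n"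
  by (auto intro!: zero_less_power_int less_imp_le[OF zero_less_power_int])

text \<open>Stated for a set L because it serves F and E alike: the bases of the two absolute values
  differ, but both metrics are governed by the ideals \<open>P n\<close>.\<close>

lemma metric_space_val:
  assumes "finite (residue_field L v)" "1 \<in> L" "0 \<in> L"
  shows "Metric_space L (val_dist L v)"
proof -
  define Q where "Q = real (card (residue_field L v))"
  have Q: "1 < Q" using card_residue_ge2[OF assms] by (auto simp: Q_def)
  have na: "norm_abs L v x = (if x = 0 then 0 else Q powi (- v x))" for x
    by (simp add: norm_abs_def Q_def)
  have ge: "0 \<le> norm_abs L v x" for x using Q by (auto simp: na)
  show ?thesis
  proof
    fix x y z :: 'e
    show "norm_abs L v (x - y) = norm_abs L v (y - x)"
      using v_minus[of "x - y"] by (auto simp: na)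
    show "norm_abs L v (x - y) = 0 \<longleftrightarrow> x = y" using Q by (auto simp: na)
    show "norm_abs L v (x - z) \<le> norm_abs L v (x - y) + norm_abs L v (y - z)"
    proof (cases "x = z \<or> x = y \<or> y = z")
      case False
      then have "min (v (x - y)) (v (y - z)) \<le> v (x - z)"
        using v_add[of "x - y" "y - z"] by auto
      hence "Q powi (- v (x - z)) \<le> Q powi (- min (v (x - y)) (v (y - z)))"
        using Q by (intro power_int_increasing) auto
      also have "\<dots> \<le> Q powi (- v (x - y)) + Q powi (- v (y - z))"
        using Q by (auto simp: min_def)
      finally show ?thesis using False by (auto simp: na)
    qed (use ge[of "x - y"] ge[of "y - z"] in \<open>auto simp: na\<close>)
  qed (use ge in auto)
qed

lemma small_dist:
  assumes "finite (residue_field L v)" "1 \<in> L" "0 \<in> L" and "0 < (e::real)"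
  obtains N :: nat where "\<And>x n. x \<in> P n \<Longrightarrow> int N \<le> n \<Longrightarrow> norm_abs L v x < e"
proof -
  define Q where "Q = real (card (residue_field L v))"
  have Q: "1 < Q" using card_residue_ge2[OF assms(1-3)] by (auto simp: Q_def)
  obtain N where N: "inverse Q ^ N < e"
    using real_arch_pow_inv[of e "inverse Q"] Q assms(4) by (auto simp: field_simps)
  have "norm_abs L v x < e" if "x \<in> P n" "int N \<le> n" for x n
  proof (cases "x = 0")
    case True then show ?thesis using assms(4) by (simp add: norm_abs_def)
  next
    case False
    have "norm_abs L v x = Q powi (- v x)" using False by (simp add: norm_abs_def Q_def)
    also have "\<dots> \<le> Q powi (- int N)"
      using Q that False by (intro power_int_increasing) (auto simp: P_iff)
    also have "\<dots> = inverse Q ^ N" by (simp add: power_int_minus power_inverse)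
    finally show ?thesis using N by simp
  qed
  then show ?thesis using that by blast
qed

lemma dist_less_P:
  assumes "finite (residue_field L v)" "1 \<in> L" "0 \<in> L"
    and "norm_abs L v x < real (card (residue_field L v)) powi (- n)"
  shows "x \<in> P n"
proof (cases "x = 0")
  case False
  define Q where "Q = real (card (residue_field L v))"
  have Q: "1 < Q" using card_residue_ge2[OF assms(1-3)] by (auto simp: Q_def)
  have "Q powi (- v x) < Q powi (- n)" using assms(4) False by (simp add: norm_abs_def Q_def)
  hence "- v x < - n" using Q
    by (meson linorder_not_le power_int_increasing less_imp_le)
  then show ?thesis by (simp add: P_iff)
qed simp

text \<open>Turns metric completeness into a statement about congruences, the form needed for the
  successive approximations below.\<close>

lemma complete_val:
  assumes L: "L = K \<or> L = UNIV"
    and y: "\<And>n. y n \<in> L" "\<And>n. y (Suc n) - y n \<in> P (int n)"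
  obtains l where "l \<in> L" "\<And>n. l - y n \<in> P (int n)"
proof -
  have fin: "finite (residue_field L v)" "1 \<in> L" "0 \<in> L" using L fin_residue by auto
  interpret M: Metric_space L "val_dist L v" by (rule metric_space_val[OF fin])
  have mc: "M.mcomplete"
    using L ext unfolding unramified_quadratic_def nonarch_local_field_def by auto
  have step: "y (n + k) - y n \<in> P (int n)" for n k
  proof (induction k)
    case (Suc k)
    have "y (Suc (n + k)) - y (n + k) \<in> P (int n)" using y(2)[of "n + k"] by (rule P_mono) simp
    then show ?case using Suc P_trans by fastforce
  qed simp
  have step': "y n' - y n \<in> P (int m)" if "m \<le> n" "m \<le> n'" for n n' m
    using P_trans[OF step[of m "n' - m"] P_diff_swap[OF step[of m "n - m"]]] that by simp
  have "M.MCauchy y" unfolding M.MCauchy_def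
  proof (intro conjI allI impI)
    show "range y \<subseteq> L" using y by auto
    fix e :: real assume "0 < e"
    then obtain N where N: "\<And>x n. x \<in> P n \<Longrightarrow> int N \<le> n \<Longrightarrow> norm_abs L v x < e"
      using small_dist[OF fin] by blast
    show "\<exists>N. \<forall>n n'. N \<le> n \<longrightarrow> N \<le> n' \<longrightarrow> norm_abs L v (y n - y n') < e"
      using N step' by (meson order_refl)
  qed
  then obtain l where l: "limitin M.mtopology y l sequentially" using mc M.mcomplete_def by auto
  have lL: "l \<in> L" using l by (simp add: M.limit_metric_sequentially)
  have "l - y n \<in> P (int n)" for n
  proof -
    have "0 < real (card (residue_field L v)) powi (- int n)"
      using card_residue_ge2[OF fin] by simp
    then obtain N where N: "\<And>m. N \<le> m \<Longrightarrow> norm_abs L v (y m - l) < real (card (residue_field L v)) powi (- int n)"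
      using l unfolding M.limit_metric_sequentially by blast
    have "y (max n N) - l \<in> P (int n)" by (rule dist_less_P[OF fin N]) simp
    moreover have "y (max n N) - y n \<in> P (int n)" by (rule step') auto
    ultimately show ?thesis using P_trans[OF P_diff_swap] by blast
  qed
  with lL that show ?thesis by blast
qed

lemma P_all_imp_0: "(\<And>n::nat. x \<in> P (int n)) \<Longrightarrow> x = 0"
proof (rule ccontr)
  assume a: "\<And>n::nat. x \<in> P (int n)" "x \<noteq> 0"
  have "v x + 1 \<le> int (nat (v x + 1))" by simp
  also have "\<dots> \<le> v x" using a(1)[of "nat (v x + 1)"] a(2) by (simp add: P_iff)
  finally show False by simp
qed

subsection \<open>The unramified quadratic extension\<close>

lemma gal_add [simp]: "\<sigma> (x + y) = \<sigma> x + \<sigma> y" and gal_mult [simp]: "\<sigma> (x * y) = \<sigma> x * \<sigma> y"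
  and gal_K [simp]: "x \<in> K \<Longrightarrow> \<sigma> x = x" and gal_not_id: "\<sigma> \<noteq> id"
  using ext unfolding unramified_quadratic_def by blast+

lemma gal_0 [simp]: "\<sigma> 0 = 0" and gal_1 [simp]: "\<sigma> 1 = 1"
  using gal_K[of 0] gal_K[of 1] by auto

lemma gal_minus [simp]: "\<sigma> (- x) = - \<sigma> x"
  using gal_add[of x "- x"] by (simp add: eq_neg_iff_add_eq_0 add.commute)

lemma gal_diff [simp]: "\<sigma> (x - y) = \<sigma> x - \<sigma> y"
  using gal_add[of x "- y"] by simp

lemma gal_inverse [simp]: "\<sigma> (inverse x) = inverse (\<sigma> x)"
proof (cases "x = 0")
  case False
  have "\<sigma> x * \<sigma> (inverse x) = 1" using False gal_mult[of x "inverse x"] by simp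
  then show ?thesis by (metis inverse_unique)
qed simp

lemma gal_eq_0_iff [simp]: "\<sigma> x = 0 \<longleftrightarrow> x = 0"
proof
  assume "\<sigma> x = 0"
  then show "x = 0" using gal_mult[of x "inverse x"] by (cases "x = 0") auto
qed simp

lemma gal_divide [simp]: "\<sigma> (x / y) = \<sigma> x / \<sigma> y"
  by (simp add: divide_inverse)

lemma two_unit: "(2::'e) \<noteq> 0" "v 2 = 0"
proof -
  have "2 \<notin> P 1"
  proof
    assume "2 \<in> P 1"
    hence 2: "0 < (2::nat) \<and> of_nat 2 \<in> pideal K v 1" using PF_iff[of 2 1] by auto
    have le: "residue_char K v \<le> 2" unfolding residue_char_def by (rule Least_le) (rule 2)
    have "0 < residue_char K v \<and> of_nat (residue_char K v) \<in> pideal K v 1"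
      unfolding residue_char_def by (rule LeastI) (rule 2)
    moreover from le this odd_char have "residue_char K v = 1" by (cases "residue_char K v = 2") auto
    ultimately have "1 \<in> P 1" using PF_iff[of 1 1] by auto
    then show False by simp
  qed
  moreover have "2 \<in> P 0" using P_add[of 1 0 1] by simp
  ultimately show "(2::'e) \<noteq> 0" "v 2 = 0" by (auto simp: P_iff)
qed

lemma four_nonzero [simp]: "(4::'e) \<noteq> 0"
proof -
  have "(4::'e) = 2 * 2" by simp
  then show ?thesis using two_unit(1) by (metis mult_eq_0_iff)
qed

lemma P_half: "2 * x \<in> P n \<Longrightarrow> x \<in> P n"
  using two_unit by (cases "x = 0") (auto simp: P_iff)

lemma P_div_2: "x \<in> P n \<Longrightarrow> x / 2 \<in> P n"
  using P_half[of "x/2" n] two_unit by simp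

lemma P1_prime: "x * y \<in> P 1 \<Longrightarrow> x \<in> P 0 \<Longrightarrow> y \<in> P 0 \<Longrightarrow> x \<in> P 1 \<or> y \<in> P 1"
  by (cases "x = 0"; cases "y = 0") (auto simp: P_iff)

lemma P_div_unif: "x \<in> P n \<Longrightarrow> x / \<pi> ^ m \<in> P (n - int m)"
  by (cases "x = 0") (auto simp: P_iff)

text \<open>The residue field grows. If every integer of E were congruent to one of F modulo
  \<open>P 1\<close>, then, \<open>\<pi>\<close> being a uniformizer of both fields, a \<pi>-adic
  expansion with digits in F would put all of E into F.\<close>

lemma ex_residue_generator:
  obtains \<theta> where "\<theta> \<in> P 0" "\<And>c. c \<in> K \<Longrightarrow> c \<in> P 0 \<Longrightarrow> \<theta> - c \<notin> P 1"
proof -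
  have False if "\<forall>x\<in>P 0. \<exists>c\<in>K. c \<in> P 0 \<and> x - c \<in> P 1"
  proof -
    from that obtain r where r: "\<And>x. x \<in> P 0 \<Longrightarrow> r x \<in> K \<and> r x \<in> P 0 \<and> x - r x \<in> P 1" by metis
    have inK: "x \<in> K" if x: "x \<in> P 0" for x
    proof -
      \<comment> \<open>Partial sums of the \<pi>-adic expansion of x, with the digits chosen in F
        by r.\<close>
      define y where "y = rec_nat 0 (\<lambda>n t. t + \<pi> ^ n * r ((x - t) / \<pi> ^ n))"
      have y0: "y 0 = 0" and yS: "y (Suc n) = y n + \<pi> ^ n * r ((x - y n) / \<pi> ^ n)" for n
        by (auto simp: y_def)
      have inv: "y n \<in> K \<and> x - y n \<in> P (int n)" for n
      proof (induction n)
        case (Suc n)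
        let ?t = "(x - y n) / \<pi> ^ n"
        have t: "?t \<in> P 0" using Suc P_div_unif[of "x - y n" n n] by simp
        have "\<pi> ^ n * ?t = x - y n" by simp
        hence "x - y (Suc n) = \<pi> ^ n * (?t - r ?t)" unfolding yS right_diff_distrib by simp
        moreover have "\<pi> ^ n * (?t - r ?t) \<in> P (int n + 1)"
          using r[OF t] by (intro P_mult) (auto simp: P_iff)
        ultimately have "x - y (Suc n) \<in> P (int (Suc n))" by (simp add: add.commute)
        moreover have "y (Suc n) \<in> K" using Suc r[OF t] by (simp add: yS)
        ultimately show ?case by blast
      qed (use x y0 in auto)
      have st: "y (Suc n) - y n \<in> P (int n)" for n
      proof -
        have "(x - y n) / \<pi> ^ n \<in> P 0" using inv[of n] P_div_unif[of "x - y n" n n] by simp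
        from r[OF this] have "\<pi> ^ n * r ((x - y n) / \<pi> ^ n) \<in> P (int n + 0)"
          by (intro P_mult) (auto simp: P_iff)
        then show ?thesis by (simp add: yS)
      qed
      obtain l where l: "l \<in> K" "\<And>n. l - y n \<in> P (int n)"
        by (rule complete_val[of K y]) (use inv st in simp_all)
      have "x - l \<in> P (int n)" for n
        using P_trans[OF conjunct2[OF inv[of n]] P_diff_swap[OF l(2)]] .
      hence "x - l = 0" by (rule P_all_imp_0)
      with l show ?thesis by simp
    qed
    obtain b where b: "b \<notin> K" using ext unfolding unramified_quadratic_def by auto
    hence "b \<noteq> 0" by auto
    let ?t = "\<pi> powi (- v b)"
    have "?t * b \<in> K" using \<open>b \<noteq> 0\<close> by (intro inK) (auto simp: P_iff)
    with b show False using K_mult_cancel[of ?t b] by auto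
  qed
  with that show ?thesis by blast
qed

text \<open>A residue generator \<theta> gives integral coordinates over F. Subtracting its
  conjugate makes the trace zero, and since 2 is a unit the coordinates stay integral.\<close>

lemma ex_delta:
  "\<exists>\<delta>. \<delta> \<in> P 0 \<and> \<delta> \<noteq> 0 \<and> \<sigma> \<delta> = - \<delta> \<and> (\<forall>x. \<exists>c\<in>K. \<exists>d\<in>K. x = c + d * \<delta>) \<and>
     (\<forall>c\<in>K. \<forall>d\<in>K. \<forall>n. c + d * \<delta> \<in> P n \<longrightarrow> c \<in> P n \<and> d \<in> P n)"
proof -
  obtain \<theta> where th: "\<theta> \<in> P 0" "\<And>c. c \<in> K \<Longrightarrow> c \<in> P 0 \<Longrightarrow> \<theta> - c \<notin> P 1"
    using ex_residue_generator by blast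
  \<comment> \<open>If d had too small a valuation, dividing by d would make \<theta> congruent to
    an element of F.\<close>
  have coord: "c \<in> P n \<and> d \<in> P n" if cd: "c \<in> K" "d \<in> K" "c + d * \<theta> \<in> P n" for c d n
  proof -
    have d: "d \<in> P n"
    proof (rule ccontr)
      assume nd: "d \<notin> P n"
      hence d0: "d \<noteq> 0" and vd: "v d < n" by (auto simp: P_iff)
      have "inverse d * (c + d * \<theta>) \<in> P (- v d + n)"
        using d0 cd by (intro P_mult) (auto simp: P_iff)
      moreover have "inverse d * (c + d * \<theta>) = \<theta> - (- c / d)" using d0 by (simp add: field_simps)
      ultimately have 1: "\<theta> - (- c / d) \<in> P 1" using vd P_mono[of _ "- v d + n" 1] by simp
      have "- c / d \<in> P 0" using P_diff[OF th(1) P_mono[OF 1, of 0]] by simp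
      with 1 th(2)[of "- c / d"] cd show False by auto
    qed
    have "c + d * \<theta> - d * \<theta> \<in> P n" using cd d P_mult[OF d th(1)] by (intro P_diff) auto
    with d show ?thesis by simp
  qed
  have thK: "\<theta> \<notin> K" using th(2)[of \<theta>] th(1) by auto
  obtain b where b: "\<forall>x. \<exists>c\<in>K. \<exists>d\<in>K. x = c + d * b"
    using ext unfolding unramified_quadratic_def by auto
  then obtain c0 d0 where c0: "c0 \<in> K" "d0 \<in> K" "\<theta> = c0 + d0 * b" by blast
  have d0: "d0 \<noteq> 0" using c0 thK by auto
  have gen: "\<exists>c\<in>K. \<exists>d\<in>K. x = c + d * \<theta>" for x
  proof -
    obtain c d where cd: "c \<in> K" "d \<in> K" "x = c + d * b" using b by blast
    have "x = (c - d * c0 / d0) + (d / d0) * \<theta>" using cd c0 d0 by (simp add: field_simps)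
    moreover have "c - d * c0 / d0 \<in> K" "d / d0 \<in> K" using cd c0 by auto
    ultimately show ?thesis by blast
  qed
  obtain \<beta> \<alpha> where ab: "\<beta> \<in> K" "\<alpha> \<in> K" "\<theta> * \<theta> = \<beta> + \<alpha> * \<theta>" using gen by blast
  have "\<theta> * \<theta> \<in> P 0" using P_mult[OF th(1) th(1)] by simp
  hence aP: "\<alpha> \<in> P 0" using coord[of \<beta> \<alpha> 0] ab by simp
  have "\<sigma> \<theta> \<noteq> \<theta>"
  proof
    assume a: "\<sigma> \<theta> = \<theta>"
    have "\<sigma> x = x" for x
    proof -
      obtain c d where "c \<in> K" "d \<in> K" "x = c + d * \<theta>" using gen by blast
      then show ?thesis using a by simp
    qed
    with gal_not_id show False by auto
  qed
  hence "\<sigma> \<theta> - \<theta> \<noteq> 0" by simp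
  \<comment> \<open>Both \<theta> and its conjugate are roots of T^2 - \<alpha>T - \<beta>; being
    distinct, they have sum \<alpha>.\<close>
  moreover have "\<sigma> \<theta> * \<sigma> \<theta> = \<beta> + \<alpha> * \<sigma> \<theta>"
    using arg_cong[OF ab(3), of \<sigma>] ab(1,2) by simp
  hence "(\<sigma> \<theta> - \<theta>) * (\<sigma> \<theta> + \<theta> - \<alpha>) = 0" using ab(3) by (simp add: algebra_simps)
  ultimately have "\<sigma> \<theta> + \<theta> - \<alpha> = 0" using mult_eq_0_iff by blast
  hence sth: "\<sigma> \<theta> = \<alpha> - \<theta>" by (simp add: algebra_simps)
  \<comment> \<open>This is \<theta> minus its conjugate.\<close>
  define \<delta> where "\<delta> = 2 * \<theta> - \<alpha>"
  have two: "\<sigma> 2 = 2" by simp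
  have "\<sigma> \<delta> = - \<delta>" using sth ab two by (simp add: \<delta>_def)
  moreover have "\<delta> \<in> P 0" unfolding \<delta>_def using aP P_add[OF th(1) th(1)] by (intro P_diff) auto
  moreover have "\<exists>c\<in>K. \<exists>d\<in>K. x = c + d * \<delta>" for x
  proof -
    obtain c d where cd: "c \<in> K" "d \<in> K" "x = c + d * \<theta>" using gen by blast
    have "x = (c + d * \<alpha> / 2) + (d / 2) * \<delta>" using cd two_unit by (simp add: \<delta>_def field_simps)
    moreover have "c + d * \<alpha> / 2 \<in> K" "d / 2 \<in> K" using cd ab by auto
    ultimately show ?thesis by blast
  qed
  moreover have co: "c \<in> P n \<and> d \<in> P n" if cd: "c \<in> K" "d \<in> K" "c + d * \<delta> \<in> P n" for c d n
  proof -
    have "(c - d * \<alpha>) + (2 * d) * \<theta> \<in> P n" using cd by (simp add: \<delta>_def algebra_simps)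
    hence *: "c - d * \<alpha> \<in> P n" "2 * d \<in> P n" using coord[of "c - d * \<alpha>" "2 * d" n] cd ab by auto
    have d: "d \<in> P n" using P_half * by blast
    have "c - d * \<alpha> + d * \<alpha> \<in> P n" using * P_mult[OF d aP] by (intro P_add) auto
    with d show ?thesis by simp
  qed
  moreover have "\<delta> \<noteq> 0" using co[of 0 1 1] by auto
  ultimately show ?thesis by blast
qed

definition \<delta> :: 'e where
  "\<delta> = (SOME \<delta>. \<delta> \<in> P 0 \<and> \<delta> \<noteq> 0 \<and> \<sigma> \<delta> = - \<delta> \<and> (\<forall>x. \<exists>c\<in>K. \<exists>d\<in>K. x = c + d * \<delta>) \<and>
     (\<forall>c\<in>K. \<forall>d\<in>K. \<forall>n. c + d * \<delta> \<in> P n \<longrightarrow> c \<in> P n \<and> d \<in> P n))"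

lemma delta: "\<delta> \<in> P 0" "\<delta> \<noteq> 0" "\<sigma> \<delta> = - \<delta>"
  and delta_gen: "\<exists>c\<in>K. \<exists>d\<in>K. x = c + d * \<delta>"
  and delta_coord: "c \<in> K \<Longrightarrow> d \<in> K \<Longrightarrow> c + d * \<delta> \<in> P n \<Longrightarrow> c \<in> P n \<and> d \<in> P n"
  using someI_ex[OF ex_delta] unfolding \<delta>_def[symmetric] by blast+

lemma v_delta: "v \<delta> = 0"
proof -
  have "\<not> 1 \<le> v \<delta>" using delta_coord[of 0 1 1] by (auto simp: P_iff)
  moreover have "0 \<le> v \<delta>" using delta(1,2) by (simp add: P_iff)
  ultimately show ?thesis by simp
qed

lemma delta_P_iff: "c \<in> K \<Longrightarrow> d \<in> K \<Longrightarrow> c + d * \<delta> \<in> P n \<longleftrightarrow> c \<in> P n \<and> d \<in> P n"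
  using delta_coord[of c d n] P_add[of c n "d * \<delta>"] P_mult[of d n \<delta> 0] delta(1) by auto

lemma gal_coord: "c \<in> K \<Longrightarrow> d \<in> K \<Longrightarrow> \<sigma> (c + d * \<delta>) = c - d * \<delta>"
  using delta(3) by simp

lemma gal_gal [simp]: "\<sigma> (\<sigma> x) = x"
proof -
  obtain c d where "c \<in> K" "d \<in> K" "x = c + d * \<delta>" using delta_gen by blast
  then show ?thesis using delta(3) by simp
qed

lemma gal_fixed_iff: "\<sigma> x = x \<longleftrightarrow> x \<in> K"
proof
  assume a: "\<sigma> x = x"
  obtain c d where cd: "c \<in> K" "d \<in> K" "x = c + d * \<delta>" using delta_gen by blast
  have "2 * (d * \<delta>) = x - \<sigma> x" unfolding cd(3) gal_coord[OF cd(1,2)] by simp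
  hence "2 * (d * \<delta>) = 0" using a by simp
  hence "d = 0" using delta(2) two_unit by simp
  then show "x \<in> K" using cd by simp
qed simp

text \<open>Membership in \<open>P n\<close> is a condition on the two coordinates, and \<sigma>
  only changes the sign of the second.\<close>

lemma gal_P_imp: "x \<in> P n \<Longrightarrow> \<sigma> x \<in> P n"
proof -
  assume a: "x \<in> P n"
  obtain c d where cd: "c \<in> K" "d \<in> K" "x = c + d * \<delta>" using delta_gen by blast
  then show "\<sigma> x \<in> P n"
    using a gal_coord[of c d] delta_P_iff[of c d n] delta_P_iff[of c "- d" n] by simp
qed

lemma gal_P_iff [simp]: "\<sigma> x \<in> P n \<longleftrightarrow> x \<in> P n"
  using gal_P_imp[of x n] gal_P_imp[of "\<sigma> x" n] by auto

lemma v_gal [simp]: "v (\<sigma> x) = v x"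
proof (cases "x = 0")
  case False
  then show ?thesis using gal_P_iff[of x "v x"] gal_P_iff[of x "v (\<sigma> x)"] by (simp add: P_iff)
qed simp

lemma norm_K [simp]: "x * \<sigma> x \<in> K"
  by (subst gal_fixed_iff[symmetric]) (simp add: mult.commute)

lemma v_norm [simp]: "x \<noteq> 0 \<Longrightarrow> v (x * \<sigma> x) = 2 * v x"
  by simp

subsection \<open>Representatives of quotients of ideals\<close>

text \<open>Representatives of P^j modulo P^n inside L. They turn every integral of a locally
  constant function into a finite sum.\<close>

definition reps :: "'e set \<Rightarrow> int \<Rightarrow> int \<Rightarrow> 'e set \<Rightarrow> bool" where
  "reps L j n Y \<longleftrightarrow> finite Y \<and> Y \<subseteq> L \<inter> P j \<and> (\<forall>x\<in>L \<inter> P j. \<exists>!y. y \<in> Y \<and> x - y \<in> P n)"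

lemma repsD:
  assumes "reps L j n Y"
  shows "finite Y" "Y \<subseteq> L" "Y \<subseteq> P j" "x \<in> L \<Longrightarrow> x \<in> P j \<Longrightarrow> \<exists>!y. y \<in> Y \<and> x - y \<in> P n"
    "y \<in> Y \<Longrightarrow> y' \<in> Y \<Longrightarrow> y - y' \<in> P n \<Longrightarrow> y = y'"
proof -
  show "finite Y" "Y \<subseteq> L" "Y \<subseteq> P j" "x \<in> L \<Longrightarrow> x \<in> P j \<Longrightarrow> \<exists>!y. y \<in> Y \<and> x - y \<in> P n"
    using assms unfolding reps_def by blast+
  assume a: "y \<in> Y" "y' \<in> Y" "y - y' \<in> P n"
  moreover have "\<exists>!z. z \<in> Y \<and> y - z \<in> P n" using assms a(1) unfolding reps_def by blast
  ultimately show "y = y'" by (metis P_0 diff_self)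
qed

definition rep_of :: "int \<Rightarrow> 'e set \<Rightarrow> 'e \<Rightarrow> 'e" where
  "rep_of n Y x = (THE y. y \<in> Y \<and> x - y \<in> P n)"

lemma rep_of:
  assumes "reps L j n Y" "x \<in> L" "x \<in> P j"
  shows "rep_of n Y x \<in> Y" "x - rep_of n Y x \<in> P n"
  using theI'[OF repsD(4)[OF assms]] by (auto simp: rep_of_def)

lemma rep_of_eq_iff:
  assumes "reps L j n Y" "x \<in> L" "x \<in> P j" "y \<in> L" "y \<in> P j"
  shows "rep_of n Y x = rep_of n Y y \<longleftrightarrow> x - y \<in> P n"
proof
  assume "rep_of n Y x = rep_of n Y y"
  then show "x - y \<in> P n"
    using P_trans[OF rep_of(2)[OF assms(1-3)] P_diff_swap[of y]] rep_of(2)[OF assms(1,4,5)] by simp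
next
  assume "x - y \<in> P n"
  hence "x - rep_of n Y y \<in> P n" using P_trans rep_of(2)[OF assms(1,4,5)] by blast
  then show "rep_of n Y x = rep_of n Y y"
    using repsD(4)[OF assms(1-3)] rep_of[OF assms(1-3)] rep_of(1)[OF assms(1,4,5)] by blast
qed

lemma reps_residue:
  assumes L: "L = K \<or> L = UNIV"
  shows "\<exists>Y. reps L 0 1 Y"
    and "reps L 0 1 Y \<Longrightarrow> card Y = card (residue_field L v)"
proof -
  let ?O = "L \<inter> P 0"
  let ?c = "\<lambda>x. {y \<in> ?O. y - x \<in> P 1}"
  have d: "x \<in> L \<Longrightarrow> y \<in> L \<Longrightarrow> x - y \<in> L" for x y using L by auto
  have O: "int_ring L v = ?O" by (auto simp: pideal_def)
  have c: "x \<in> ?O \<Longrightarrow> {y \<in> int_ring L v. y - x \<in> pideal L v 1} = ?c x" for x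
    using d by (auto simp: pideal_def)
  have rf: "residue_field L v = ?c ` ?O"
    unfolding residue_field_def using c unfolding O by (intro image_cong) auto
  have fin: "finite (residue_field L v)" using L fin_residue by auto
  have ceq: "?c x = ?c y \<longleftrightarrow> x - y \<in> P 1" if "x \<in> ?O" "y \<in> ?O" for x y
  proof
    assume "?c x = ?c y"
    moreover have "x \<in> ?c x" using that by simp
    ultimately show "x - y \<in> P 1" by blast
  next
    assume a: "x - y \<in> P 1"
    have "z - x \<in> P 1 \<longleftrightarrow> z - y \<in> P 1" for z
      using P_trans[of z x 1 y] P_trans[of z y 1 x] a P_diff_swap[OF a] by blast
    then show "?c x = ?c y" by simp
  qed
  show "card Y = card (residue_field L v)" if Y: "reps L 0 1 Y"
  proof (rule bij_betw_same_card)
    have YO: "Y \<subseteq> ?O" using repsD[OF Y] by blast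
    show "bij_betw ?c Y (residue_field L v)" unfolding bij_betw_def
    proof
      show "inj_on ?c Y"
      proof (rule inj_onI)
        fix x y assume "x \<in> Y" "y \<in> Y" "?c x = ?c y"
        then show "x = y" using ceq[of x y] YO repsD(5)[OF Y, of x y] by blast
      qed
      show "?c ` Y = residue_field L v" unfolding rf
      proof
        show "?c ` ?O \<subseteq> ?c ` Y"
        proof
          fix C assume "C \<in> ?c ` ?O"
          then obtain x where x: "x \<in> ?O" "C = ?c x" by blast
          then obtain y where "y \<in> Y" "x - y \<in> P 1" using repsD(4)[OF Y, of x] by blast
          then show "C \<in> ?c ` Y" using ceq[of x y] x YO by blast
        qed
      qed (use YO in blast)
    qed
  qed
  define r where "r C = (SOME x. x \<in> ?O \<and> ?c x = C)" for C
  have r: "r C \<in> ?O \<and> ?c (r C) = C" if "C \<in> residue_field L v" for C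
  proof -
    have "\<exists>x. x \<in> ?O \<and> ?c x = C" using that unfolding rf by blast
    from someI_ex[OF this] show ?thesis unfolding r_def .
  qed
  have rO: "r C \<in> ?O" if "C \<in> residue_field L v" for C using r[OF that] by (rule conjunct1)
  have rc: "?c (r C) = C" if "C \<in> residue_field L v" for C using r[OF that] by (rule conjunct2)
  have "reps L 0 1 (r ` residue_field L v)" unfolding reps_def
  proof (intro conjI ballI)
    show "finite (r ` residue_field L v)" using fin by simp
    show "r ` residue_field L v \<subseteq> ?O" using rO by (rule image_subsetI)
    fix x assume x: "x \<in> ?O"
    have xc: "?c x \<in> residue_field L v" unfolding rf using x by (rule imageI)
    show "\<exists>!y. y \<in> r ` residue_field L v \<and> x - y \<in> P 1"
    proof (rule ex1I[of _ "r (?c x)"])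
      show "r (?c x) \<in> r ` residue_field L v \<and> x - r (?c x) \<in> P 1"
        using rc[OF xc] xc ceq[OF x rO[OF xc]] by simp
      fix y assume y: "y \<in> r ` residue_field L v \<and> x - y \<in> P 1"
      then obtain C where C: "C \<in> residue_field L v" "y = r C" by (elim conjE imageE)
      have "?c x = ?c y" using ceq[OF x rO[OF C(1)]] y unfolding C(2) by simp
      also have "\<dots> = C" unfolding C(2) by (rule rc[OF C(1)])
      finally show "y = r (?c x)" using C(2) by simp
    qed
  qed
  then show "\<exists>Y. reps L 0 1 Y" by blast
qed

text \<open>In the coordinates of \<delta> a residue class of E is a pair of residue classes of F.
  This makes the square root of the absolute value of E an integral power of q.\<close>

lemma card_residue_E: "real (card (residue_field UNIV v)) = q\<^sup>2"
proof -
  obtain Y where Y: "reps K 0 1 Y" using reps_residue(1)[of K] by blast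
  let ?g = "\<lambda>(c, d). c + d * \<delta>"
  have co: "?g p - ?g p' \<in> P 1 \<longleftrightarrow> fst p - fst p' \<in> P 1 \<and> snd p - snd p' \<in> P 1"
    if "p \<in> K \<times> K" "p' \<in> K \<times> K" for p p'
  proof -
    have "?g p - ?g p' = (fst p - fst p') + (snd p - snd p') * \<delta>"
      by (auto simp: case_prod_beta algebra_simps)
    then show ?thesis using delta_P_iff[of "fst p - fst p'" "snd p - snd p'" 1] that by auto
  qed
  have YK: "Y \<subseteq> K" "Y \<subseteq> P 0" using repsD[OF Y] by blast+
  have inj: "inj_on ?g (Y \<times> Y)"
  proof (rule inj_onI)
    fix p p' assume p: "p \<in> Y \<times> Y" "p' \<in> Y \<times> Y" "?g p = ?g p'"
    have "p \<in> K \<times> K" "p' \<in> K \<times> K" using p YK by blast+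
    moreover have "?g p - ?g p' \<in> P 1" using p(3) by simp
    ultimately have "fst p - fst p' \<in> P 1 \<and> snd p - snd p' \<in> P 1" using co by blast
    then show "p = p'" using p(1,2) repsD(5)[OF Y] by (auto simp: prod_eq_iff)
  qed
  have "reps UNIV 0 1 (?g ` (Y \<times> Y))" unfolding reps_def
  proof (intro conjI ballI)
    show "finite (?g ` (Y \<times> Y))" using repsD(1)[OF Y] by simp
    show "?g ` (Y \<times> Y) \<subseteq> UNIV \<inter> P 0" using YK delta_P_iff by (auto simp: subset_iff)
    fix x assume x: "x \<in> UNIV \<inter> P 0"
    obtain c d where cd: "c \<in> K" "d \<in> K" "x = c + d * \<delta>" using delta_gen by blast
    have cd0: "c \<in> P 0" "d \<in> P 0" using delta_P_iff[of c d 0] cd x by auto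
    show "\<exists>!y. y \<in> ?g ` (Y \<times> Y) \<and> x - y \<in> P 1"
    proof (rule ex1I[of _ "?g (rep_of 1 Y c, rep_of 1 Y d)"])
      have r: "rep_of 1 Y c \<in> Y" "rep_of 1 Y d \<in> Y"
        using rep_of(1)[OF Y] cd cd0 by auto
      have "?g (c, d) - ?g (rep_of 1 Y c, rep_of 1 Y d) \<in> P 1"
        using co[of "(c, d)" "(rep_of 1 Y c, rep_of 1 Y d)"] r YK cd rep_of(2)[OF Y] cd0 by auto
      then show "?g (rep_of 1 Y c, rep_of 1 Y d) \<in> ?g ` (Y \<times> Y) \<and>
          x - ?g (rep_of 1 Y c, rep_of 1 Y d) \<in> P 1"
        using r cd by auto
      fix y assume y: "y \<in> ?g ` (Y \<times> Y) \<and> x - y \<in> P 1"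
      then obtain c' d' where c': "c' \<in> Y" "d' \<in> Y" "y = ?g (c', d')" by blast
      have "?g (c, d) - ?g (c', d') \<in> P 1" using y cd c' by simp
      hence "c - c' \<in> P 1 \<and> d - d' \<in> P 1" using co[of "(c,d)" "(c',d')"] c' YK cd by auto
      hence "c' = rep_of 1 Y c" "d' = rep_of 1 Y d"
        using repsD(4)[OF Y] rep_of[OF Y] cd cd0 c' by blast+
      then show "y = ?g (rep_of 1 Y c, rep_of 1 Y d)" using c' by simp
    qed
  qed
  hence "card (residue_field UNIV v) = card (?g ` (Y \<times> Y))" using reps_residue(2)[of UNIV] by auto
  also have "\<dots> = card Y * card Y" using card_image[OF inj] by (simp add: card_cartesian_product)
  finally show ?thesis using reps_residue(2)[of K, OF _ Y] by (simp add: q_def power2_eq_square)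
qed

lemma sqrt_absE: "x \<noteq> 0 \<Longrightarrow> sqrt (absE X x) = q powi (- v x)"
proof -
  assume "x \<noteq> 0"
  hence "absE X x = (q powi (- v x))\<^sup>2"
    by (simp add: norm_abs_def card_residue_E power2_eq_square power_int_mult_distrib)
  moreover have "0 \<le> q powi (- v x)" by (intro zero_le_power_int less_imp_le[OF q_gt0])
  ultimately show ?thesis by simp
qed

section \<open>The norm map from E to F\<close>

lemma card_less_double_image:
  assumes "finite Y" "\<And>c. card {y \<in> Y. f y = c} \<le> 2" "y0 \<in> Y" "card {y \<in> Y. f y = f y0} = 1"
  shows "card Y < 2 * card (f ` Y)"
proof -
  have "card Y = (\<Sum>c\<in>f ` Y. card {y \<in> Y. f y = c})"
    using sum.image_gen[OF assms(1), of "\<lambda>_. 1::nat" f] by simp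
  also have "\<dots> = 1 + (\<Sum>c\<in>f ` Y - {f y0}. card {y \<in> Y. f y = c})"
    using assms by (subst sum.remove[of _ "f y0"]) auto
  also have "\<dots> \<le> 1 + (\<Sum>c\<in>f ` Y - {f y0}. 2)"
    using assms(2) by (intro add_left_mono sum_mono)
  also have "\<dots> = 1 + 2 * (card (f ` Y) - 1)" using assms by simp
  also have "\<dots> < 2 * card (f ` Y)"
    using assms(1,3) by (cases "card (f ` Y)") (auto simp: card_eq_0_iff)
  finally show ?thesis .
qed

text \<open>With \<epsilon> the square of \<delta>, the norm of a + b\<delta> is a^2 -
  \<epsilon>b^2. Modulo P the values a^2 and the values u + \<epsilon>b^2 each fill more than half
  of the residue field, so they meet.\<close>

lemma norm_surj_residue:
  assumes u: "u \<in> K" "u \<in> P 0"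
  obtains y where "y \<in> P 0" "y * \<sigma> y - u \<in> P 1"
proof -
  obtain Y where Y: "reps K 0 1 Y" using reps_residue(1)[of K] by blast
  define \<epsilon> where "\<epsilon> = \<delta>\<^sup>2"
  have eps: "\<epsilon> \<in> K" "\<epsilon> \<noteq> 0" "v \<epsilon> = 0"
    using delta v_delta norm_K[of \<delta>] K_minus[of "\<delta> * - \<delta>"] by (auto simp: \<epsilon>_def power2_eq_square)
  have epsP: "\<epsilon> \<in> P 0" using eps by (simp add: P_iff)
  have sq: "b\<^sup>2 \<in> P 0" if "b \<in> P 0" for b using P_mult[OF that that] by (simp add: power2_eq_square)
  \<comment> \<open>The map b to A + Bb^2 identifies at most b with -b, and the class of 0 is alone
    in its fibre, so the image is strictly more than half.\<close>
  have count: "card Y < 2 * card ((\<lambda>b. rep_of 1 Y (A + B * b\<^sup>2)) ` Y)"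
    if A: "A \<in> K" "A \<in> P 0" "B \<in> K" "B \<noteq> 0" "v B = 0" for A B
  proof -
    have BP: "B \<in> P 0" using A by (simp add: P_iff)
    have inP: "A + B * b\<^sup>2 \<in> K" "A + B * b\<^sup>2 \<in> P 0" if "b \<in> K" "b \<in> P 0" for b
      using that A P_add[OF A(2), of "B * b\<^sup>2"] P_mult[OF BP sq[of b]] by simp_all
    have eq: "rep_of 1 Y (A + B * b\<^sup>2) = rep_of 1 Y (A + B * b'\<^sup>2) \<longleftrightarrow> b - b' \<in> P 1 \<or> b + b' \<in> P 1"
      if b: "b \<in> K" "b \<in> P 0" "b' \<in> K" "b' \<in> P 0" for b b'
    proof -
      have "rep_of 1 Y (A + B * b\<^sup>2) = rep_of 1 Y (A + B * b'\<^sup>2) \<longleftrightarrow> A + B * b\<^sup>2 - (A + B * b'\<^sup>2) \<in> P 1"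
        using inP b by (intro rep_of_eq_iff[OF Y]) auto
      also have "A + B * b\<^sup>2 - (A + B * b'\<^sup>2) = B * ((b - b') * (b + b'))"
        by (simp add: algebra_simps power2_eq_square)
      also have "B * ((b - b') * (b + b')) \<in> P 1 \<longleftrightarrow> (b - b') * (b + b') \<in> P 1"
        using A by (cases "(b - b') * (b + b') = 0") (auto simp: P_iff)
      also have "\<dots> \<longleftrightarrow> b - b' \<in> P 1 \<or> b + b' \<in> P 1"
      proof
        show "(b - b') * (b + b') \<in> P 1 \<Longrightarrow> b - b' \<in> P 1 \<or> b + b' \<in> P 1"
          using b by (intro P1_prime) auto
        have "b + b' \<in> P 0" "b - b' \<in> P 0" using b by auto
        then show "b - b' \<in> P 1 \<or> b + b' \<in> P 1 \<Longrightarrow> (b - b') * (b + b') \<in> P 1"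
          using P_mult[of "b - b'" 1 "b + b'" 0] P_mult[of "b - b'" 0 "b + b'" 1] by auto
      qed
      finally show ?thesis .
    qed
    have YK: "y \<in> K" "y \<in> P 0" if "y \<in> Y" for y using repsD(2,3)[OF Y] that by blast+
    let ?f = "\<lambda>b. rep_of 1 Y (A + B * b\<^sup>2)"
    show ?thesis
    proof (rule card_less_double_image[of Y ?f "rep_of 1 Y 0"])
      show "finite Y" by (rule repsD(1)[OF Y])
      show r0: "rep_of 1 Y 0 \<in> Y" using rep_of(1)[OF Y] by simp
      fix c
      show "card {y \<in> Y. ?f y = c} \<le> 2"
      proof (cases "{y \<in> Y. ?f y = c} = {}")
        case False
        then obtain y where y: "y \<in> Y" "?f y = c" by blast
        have "{y \<in> Y. ?f y = c} \<subseteq> {y, rep_of 1 Y (- y)}"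
        proof
          fix b assume b: "b \<in> {y \<in> Y. ?f y = c}"
          hence "b - y \<in> P 1 \<or> b + y \<in> P 1" using eq[of b y] y YK by auto
          then show "b \<in> {y, rep_of 1 Y (- y)}"
          proof
            assume "b + y \<in> P 1"
            hence "- y - b \<in> P 1" using P_minus_iff[of "- y - b" 1] by (simp add: add.commute)
            hence "b = rep_of 1 Y (- y)"
              using repsD(4)[OF Y, of "- y"] rep_of[OF Y, of "- y"] b YK y by auto
            then show ?thesis by simp
          qed (use repsD(5)[OF Y] b y in auto)
        qed
        hence "card {y \<in> Y. ?f y = c} \<le> card {y, rep_of 1 Y (- y)}" by (intro card_mono) auto
        also have "\<dots> \<le> 2" by (simp add: card_insert_if)
        finally show ?thesis .
      next
        case True
        show ?thesis unfolding True by simp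
      qed
      have "b = rep_of 1 Y 0" if b: "b \<in> Y" "?f b = ?f (rep_of 1 Y 0)" for b
      proof -
        have z: "rep_of 1 Y 0 \<in> P 1" using rep_of(2)[OF Y, of 0] by simp
        have "b - rep_of 1 Y 0 \<in> P 1 \<or> b + rep_of 1 Y 0 \<in> P 1"
          using eq[of b "rep_of 1 Y 0"] b YK r0 by auto
        hence "b - rep_of 1 Y 0 \<in> P 1"
          using P_diff[of "b + rep_of 1 Y 0" 1 "rep_of 1 Y 0 + rep_of 1 Y 0"] P_add[OF z z]
          by (auto simp: algebra_simps)
        then show ?thesis using repsD(5)[OF Y] b r0 by blast
      qed
      hence "{y \<in> Y. ?f y = ?f (rep_of 1 Y 0)} = {rep_of 1 Y 0}" using r0 by blast
      then show "card {y \<in> Y. ?f y = ?f (rep_of 1 Y 0)} = 1" by simp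
    qed
  qed
  let ?f = "\<lambda>b. rep_of 1 Y (0 + 1 * b\<^sup>2)" and ?g = "\<lambda>b. rep_of 1 Y (u + \<epsilon> * b\<^sup>2)"
  have YK: "y \<in> K" "y \<in> P 0" if "y \<in> Y" for y using repsD(2,3)[OF Y] that by blast+
  have inE: "u + \<epsilon> * b\<^sup>2 \<in> P 0" if "b \<in> P 0" for b
    using P_add[OF u(2), of "\<epsilon> * b\<^sup>2"] P_mult[OF epsP sq[OF that]] by simp
  have sub: "?f ` Y \<subseteq> Y" "?g ` Y \<subseteq> Y"
    using YK sq inE u eps by (auto intro!: rep_of(1)[OF Y])
  have fin: "finite Y" by (rule repsD(1)[OF Y])
  have "?f ` Y \<inter> ?g ` Y \<noteq> {}"
  proof
    assume "?f ` Y \<inter> ?g ` Y = {}"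
    hence "card (?f ` Y) + card (?g ` Y) = card (?f ` Y \<union> ?g ` Y)"
      using fin by (intro card_Un_disjoint[symmetric]) auto
    also have "\<dots> \<le> card Y" using sub fin by (intro card_mono) auto
    finally show False using count[of 0 1] count[of u \<epsilon>] u eps by simp
  qed
  then obtain a b where ab: "a \<in> Y" "b \<in> Y" "?f a = ?g b" by blast
  hence "a\<^sup>2 - (u + \<epsilon> * b\<^sup>2) \<in> P 1"
    using rep_of_eq_iff[OF Y, of "a\<^sup>2" "u + \<epsilon> * b\<^sup>2"] YK sq u eps inE
    by simp
  moreover have "(a + b * \<delta>) * \<sigma> (a + b * \<delta>) = a\<^sup>2 - \<epsilon> * b\<^sup>2"
    unfolding gal_coord[OF YK(1)[OF ab(1)] YK(1)[OF ab(2)]]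
    by (simp add: \<epsilon>_def algebra_simps power2_eq_square)
  ultimately have "(a + b * \<delta>) * \<sigma> (a + b * \<delta>) - u \<in> P 1" by (simp only: diff_diff_eq add.commute)
  moreover have "a + b * \<delta> \<in> P 0" using delta_P_iff[of a b 0] YK ab by simp
  ultimately show ?thesis using that by blast
qed

text \<open>Newton iteration started at 1. The derivative 2y is replaced by 2, since y stays
  congruent to 1; this gains one power of P per step, which suffices.\<close>

lemma sqrt_one_unit:
  assumes c: "c \<in> K" "c - 1 \<in> P 1"
  obtains r where "r \<in> K" "r\<^sup>2 = c"
proof -
  define y where "y = rec_nat 1 (\<lambda>n t. t + (c - t\<^sup>2) / 2)"
  have y0: "y 0 = 1" and yS: "y (Suc n) = y n + (c - (y n)\<^sup>2) / 2" for n by (auto simp: y_def)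
  have inv: "y n \<in> K \<and> y n - 1 \<in> P 1 \<and> c - (y n)\<^sup>2 \<in> P (int n + 1)" for n
  proof (induction n)
    case (Suc n)
    let ?e = "c - (y n)\<^sup>2"
    have e: "?e / 2 \<in> P (int n + 1)" using Suc P_div_2 by blast
    \<comment> \<open>With e the old error, the new one is e(1 - y) - (e/2)^2, and both terms lie
      one level deeper than e.\<close>
    have "c - (y (Suc n))\<^sup>2 = ?e * - (y n - 1) - ?e / 2 * (?e / 2)"
      using two_unit by (simp add: yS field_simps power2_eq_square)
    moreover have "- (y n - 1) \<in> P 1" using Suc P_minus_iff by blast
    hence "?e * - (y n - 1) \<in> P (int n + 1 + 1)" using Suc by (intro P_mult) auto
    moreover have "?e / 2 * (?e / 2) \<in> P (int n + 1 + 1)"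
      using P_mult[OF e e] by (rule P_mono) simp
    ultimately have 3: "c - (y (Suc n))\<^sup>2 \<in> P (int (Suc n) + 1)" using P_diff by (simp add: add.commute add.assoc)
    have "y n - 1 + ?e / 2 \<in> P 1" using Suc P_mono[OF e, of 1] by (intro P_add) auto
    hence 2: "y (Suc n) - 1 \<in> P 1" by (simp add: yS algebra_simps)
    have "y (Suc n) \<in> K" using Suc c by (auto simp: yS)
    with 2 3 show ?case by blast
  qed (use c y0 in auto)
  have st: "y (Suc n) - y n \<in> P (int n)" for n
    using P_mono[OF P_div_2[OF conjunct2[OF conjunct2[OF inv[of n]]]], of "int n"] by (simp add: yS)
  obtain r where r: "r \<in> K" "\<And>n. r - y n \<in> P (int n)"
    by (rule complete_val[of K y]) (use inv st in simp_all)
  have "c - r\<^sup>2 \<in> P (int n)" for n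
  proof -
    have y: "y n \<in> P 0" using P_add[OF P_mono[OF conjunct1[OF conjunct2[OF inv[of n]]], of 0], of 1] by simp
    have "r \<in> P 0" using P_add[OF P_mono[OF r(2)[of n], of 0] y] by simp
    hence "(r - y n) * (r + y n) \<in> P (int n + 0)" using y r by (intro P_mult) auto
    moreover have "c - r\<^sup>2 = (c - (y n)\<^sup>2) - (r - y n) * (r + y n)"
      by (simp add: algebra_simps power2_eq_square)
    moreover have "c - (y n)\<^sup>2 \<in> P (int n)" using inv[of n] P_mono by fastforce
    ultimately show ?thesis using P_diff by (simp only: add_0_right)
  qed
  hence "c - r\<^sup>2 = 0" by (rule P_all_imp_0)
  with r that show ?thesis by simp
qed

text \<open>A solution y modulo P is corrected by a square root r in F of the one-unit u/N(y),
  because N(yr) = N(y) r^2.\<close>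

lemma norm_surj_units:
  assumes u: "u \<in> K" "u \<noteq> 0" "v u = 0"
  obtains y where "y \<noteq> 0" "v y = 0" "y * \<sigma> y = u"
proof -
  have "u \<in> P 0" using u by (simp add: P_iff)
  then obtain y where y: "y \<in> P 0" "y * \<sigma> y - u \<in> P 1" using norm_surj_residue u by blast
  let ?N = "y * \<sigma> y"
  have N: "?N \<noteq> 0 \<and> v ?N = 0" using v_add_eq'[of u ?N] u y by simp
  have "inverse ?N * (?N - u) \<in> P (0 + 1)" using N y by (intro P_mult) (auto simp: P_iff)
  hence "1 - u / ?N \<in> P 1" using N by (simp add: field_simps)
  hence "u / ?N - 1 \<in> P 1" by (rule P_diff_swap)
  then obtain r where r: "r \<in> K" "r\<^sup>2 = u / ?N" using sqrt_one_unit[of "u / ?N"] u by auto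
  have eq: "(y * r) * \<sigma> (y * r) = u"
  proof -
    have "(y * r) * \<sigma> (y * r) = ?N * r\<^sup>2" using r(1) by (simp add: power2_eq_square)
    then show ?thesis using r(2) N by simp
  qed
  hence nz: "y * r \<noteq> 0" using u by auto
  have "v (y * r) = 0" using v_norm[OF nz] eq u by simp
  with eq nz that show ?thesis by blast
qed

text \<open>Powers of \<open>\<pi>\<close> have norm of even valuation, so the unit case suffices.
  The nonzero elements of F thus fall into two classes modulo norms, told apart by the parity of the
  valuation.\<close>

lemma norm_surj:
  assumes "u \<in> K" "u \<noteq> 0" "even (v u)"
  obtains y where "y \<noteq> 0" "y * \<sigma> y = u"
proof -
  obtain k where k: "v u = 2 * k" using assms by blast
  let ?t = "\<pi> powi k"
  obtain y where y: "y \<noteq> 0" "y * \<sigma> y = u / (?t * ?t)"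
    by (rule norm_surj_units[of "u / (?t * ?t)"]) (use assms k in auto)
  have "(y * ?t) * \<sigma> (y * ?t) = u" using y by (simp add: field_simps)
  with y that[of "y * ?t"] show ?thesis by auto
qed

lemma omegaEF_eq: "x \<in> K \<Longrightarrow> x \<noteq> 0 \<Longrightarrow> omegaEF X x = (- 1) powi v x"
proof -
  assume x: "x \<in> K" "x \<noteq> 0"
  have "(\<exists>y. y \<noteq> 0 \<and> x = y * \<sigma> y) \<longleftrightarrow> even (v x)"
    using norm_surj[OF x] v_norm x by (metis dvd_triv_left)
  then show ?thesis unfolding omegaEF_def by (auto simp: power_int_minus_left)
qed

section \<open>Representatives over F: refinement, scaling, translation and cardinality\<close>

lemma reps_trivial: "reps K j j {0}"
  by (auto simp: reps_def)

lemma reps_extend: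
  assumes Y: "reps K j i Y" and Z: "reps K i n Z" and le: "j \<le> i" "i \<le> n"
  shows "reps K j n ((\<lambda>(y, z). y + z) ` (Y \<times> Z))" "inj_on (\<lambda>(y, z). y + z) (Y \<times> Z)"
proof -
  note Y' = repsD[OF Y] and Z' = repsD[OF Z]
  have uni: "y = y' \<and> z = z'"
    if "y \<in> Y" "y' \<in> Y" "z \<in> Z" "z' \<in> Z" "(y + z) - (y' + z') \<in> P n" for y y' z z'
  proof -
    have "z - z' \<in> P i" using that Z'(3) by blast
    hence "(y + z - (y' + z')) - (z - z') \<in> P i"
      using P_mono[OF that(5) le(2)] by blast
    hence "y = y'" using Y'(5)[of y y'] that by (simp add: algebra_simps)
    then show ?thesis using Z'(5)[of z z'] that by simp
  qed
  show "inj_on (\<lambda>(y, z). y + z) (Y \<times> Z)"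
  proof (rule inj_onI)
    fix p p' assume a: "p \<in> Y \<times> Z" "p' \<in> Y \<times> Z" "(\<lambda>(y, z). y + z) p = (\<lambda>(y, z). y + z) p'"
    then show "p = p'" using uni[of "fst p" "fst p'" "snd p" "snd p'"] by (auto simp: prod_eq_iff)
  qed
  show "reps K j n ((\<lambda>(y, z). y + z) ` (Y \<times> Z))" unfolding reps_def
  proof (intro conjI ballI)
    show "finite ((\<lambda>(y, z). y + z) ` (Y \<times> Z))" using Y'(1) Z'(1) by simp
    show "(\<lambda>(y, z). y + z) ` (Y \<times> Z) \<subseteq> K \<inter> P j"
      using Y'(2,3) Z'(2,3) le by (auto intro!: P_add intro: P_mono K_add)
    fix x assume x: "x \<in> K \<inter> P j"
    define y where "y = rep_of i Y x"
    have y: "y \<in> Y" "x - y \<in> P i" using rep_of[OF Y] x by (auto simp: y_def)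
    define z where "z = rep_of n Z (x - y)"
    have "x - y \<in> K" using x y Y'(2) by auto
    hence z: "z \<in> Z" "x - y - z \<in> P n" using rep_of[OF Z, of "x - y"] y by (auto simp: z_def)
    show "\<exists>!t. t \<in> (\<lambda>(y, z). y + z) ` (Y \<times> Z) \<and> x - t \<in> P n"
    proof (rule ex1I[of _ "y + z"])
      show "y + z \<in> (\<lambda>(y, z). y + z) ` (Y \<times> Z) \<and> x - (y + z) \<in> P n"
        using y z by (auto simp: diff_diff_eq)
      fix t assume t: "t \<in> (\<lambda>(y, z). y + z) ` (Y \<times> Z) \<and> x - t \<in> P n"
      then obtain y' z' where yz: "y' \<in> Y" "z' \<in> Z" "t = y' + z'" by auto
      have "x - (y + z) \<in> P n" using z(2) by (simp only: diff_diff_eq)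
      hence "t - (y + z) \<in> P n" using P_trans[OF P_diff_swap[of x t n]] t by blast
      then show "t = y + z" using uni[of y' y z' z] yz y z by simp
    qed
  qed
qed

lemma reps_scale:
  assumes Y: "reps K j n Y" and c: "c \<in> K" "c \<noteq> 0"
  shows "reps K (j + v c) (n + v c) ((*) c ` Y)"
proof -
  note Y' = repsD[OF Y]
  have sc: "c * x \<in> P (k + v c) \<longleftrightarrow> x \<in> P k" for x k using c by (cases "x = 0") (auto simp: P_iff)
  have in1: "c * y \<in> P (j + v c)" "c * y \<in> K" if "y \<in> Y" for y using that Y'(2,3) sc c by auto
  show ?thesis unfolding reps_def
  proof (intro conjI ballI)
    show "finite ((*) c ` Y)" using Y'(1) by simp
    show "(*) c ` Y \<subseteq> K \<inter> P (j + v c)" using in1 by blast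
    fix x assume x: "x \<in> K \<inter> P (j + v c)"
    have xx: "x / c \<in> K" "x / c \<in> P j" using x c sc[of "x / c" j] by auto
    have *: "x - c * y \<in> P (n + v c) \<longleftrightarrow> x / c - y \<in> P n" for y
      using sc[of "x / c - y" n] c by (simp add: right_diff_distrib)
    show "\<exists>!y. y \<in> (*) c ` Y \<and> x - y \<in> P (n + v c)"
    proof (rule ex1I[of _ "c * rep_of n Y (x / c)"])
      show "c * rep_of n Y (x / c) \<in> (*) c ` Y \<and> x - c * rep_of n Y (x / c) \<in> P (n + v c)"
        using rep_of[OF Y xx] * by blast
      fix t assume t: "t \<in> (*) c ` Y \<and> x - t \<in> P (n + v c)"
      then obtain y where y: "y \<in> Y" "t = c * y" by blast
      hence "x / c - y \<in> P n" using t * by blast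
      hence "y = rep_of n Y (x / c)" using Y'(4)[OF xx] rep_of[OF Y xx] y by blast
      then show "t = c * rep_of n Y (x / c)" using y by simp
    qed
  qed
qed

lemma reps_translate:
  assumes Y: "reps K j n Y" and u: "u \<in> K" "u \<in> P j"
  shows "reps K j n ((\<lambda>y. y + u) ` Y)"
proof -
  note Y' = repsD[OF Y]
  show ?thesis unfolding reps_def
  proof (intro conjI ballI)
    show "finite ((\<lambda>y. y + u) ` Y)" using Y'(1) by simp
    show "(\<lambda>y. y + u) ` Y \<subseteq> K \<inter> P j" using Y'(2,3) u by auto
    fix x assume x: "x \<in> K \<inter> P j"
    have xx: "x - u \<in> K" "x - u \<in> P j" using x u by auto
    show "\<exists>!y. y \<in> (\<lambda>y. y + u) ` Y \<and> x - y \<in> P n"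
    proof (rule ex1I[of _ "rep_of n Y (x - u) + u"])
      show "rep_of n Y (x - u) + u \<in> (\<lambda>y. y + u) ` Y \<and> x - (rep_of n Y (x - u) + u) \<in> P n"
        using rep_of[OF Y xx] by (simp add: algebra_simps)
      fix t assume t: "t \<in> (\<lambda>y. y + u) ` Y \<and> x - t \<in> P n"
      then obtain y where y: "y \<in> Y" "t = y + u" by blast
      hence "x - u - y \<in> P n" using t by (simp add: algebra_simps)
      hence "y = rep_of n Y (x - u)" using Y'(4)[OF xx] rep_of[OF Y xx] y by blast
      then show "t = rep_of n Y (x - u) + u" using y by simp
    qed
  qed
qed

lemma reps_ex_card:
  assumes "j \<le> n"
  shows "\<exists>Y. reps K j n Y \<and> real (card Y) = q powi (n - j)"
  using assms
proof (induction n rule: int_ge_induct)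
  case base
  then show ?case using reps_trivial by (intro exI[of _ "{0}"]) auto
next
  case (step n)
  then obtain Y where Y: "reps K j n Y" "real (card Y) = q powi (n - j)" by blast
  obtain Z where Z: "reps K 0 1 Z" using reps_residue(1)[of K] by blast
  let ?Z = "(*) (\<pi> powi n) ` Z"
  have Z': "reps K n (n + 1) ?Z" using reps_scale[OF Z, of "\<pi> powi n"] by (simp add: add.commute)
  have cZ: "real (card ?Z) = q"
    using reps_residue(2)[of K, OF _ Z] by (subst card_image) (auto simp: q_def inj_on_def)
  note e = reps_extend[OF Y(1) Z' step(1)]
  have "real (card ((\<lambda>(y, z). y + z) ` (Y \<times> ?Z))) = q powi (n - j) * q"
    using card_image[OF e(2)] Y(2) cZ by (simp add: card_cartesian_product)
  also have "\<dots> = q powi (n + 1 - j)"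
    using power_int_add_1[of q "n - j"] by (simp add: algebra_simps)
  finally show ?case using e(1) by auto
qed

section \<open>Functions on F with a uniform period\<close>

definition periodic :: "int \<Rightarrow> ('e \<Rightarrow> complex) \<Rightarrow> bool" where
  "periodic n h \<longleftrightarrow> (\<forall>x\<in>K. \<forall>y\<in>K. y \<in> P n \<longrightarrow> h (x + y) = h x)"

text \<open>One period serves all of F, but no compact support is required: both the additive
  characters and the functions \<open>phi f\<close> are of this kind.\<close>

definition ulc :: "('e \<Rightarrow> complex) \<Rightarrow> bool" where
  "ulc h \<longleftrightarrow> (\<exists>n. periodic n h)"

lemma periodicI: "(\<And>x y. x \<in> K \<Longrightarrow> y \<in> K \<Longrightarrow> y \<in> P n \<Longrightarrow> h (x + y) = h x) \<Longrightarrow> periodic n h"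
  by (auto simp: periodic_def)

lemma periodicD: "periodic n h \<Longrightarrow> x \<in> K \<Longrightarrow> y \<in> K \<Longrightarrow> y \<in> P n \<Longrightarrow> h (x + y) = h x"
  by (auto simp: periodic_def)

lemma periodic_mono: "periodic m h \<Longrightarrow> m \<le> n \<Longrightarrow> periodic n h"
  unfolding periodic_def using P_mono by blast

lemma ulcI: "periodic n h \<Longrightarrow> ulc h"
  by (auto simp: ulc_def)

lemma ulcE2:
  assumes "ulc f" "ulc g"
  obtains n where "periodic n f" "periodic n g" "j \<le> n"
proof -
  obtain m m' where "periodic m f" "periodic m' g" using assms by (auto simp: ulc_def)
  then show ?thesis using that[of "max j (max m m')"] periodic_mono by (meson max.cobounded1 max.cobounded2 order_trans)
qed

lemma ulc_const [simp, intro]: "ulc (\<lambda>x. c)"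
  by (auto simp: ulc_def periodic_def)

lemma ulc_comp2: "ulc f \<Longrightarrow> ulc g \<Longrightarrow> ulc (\<lambda>x. G (f x) (g x))"
proof -
  assume "ulc f" "ulc g"
  then obtain n where "periodic n f" "periodic n g" by (rule ulcE2[where j = 0])
  hence "periodic n (\<lambda>x. G (f x) (g x))" by (auto simp: periodic_def)
  then show ?thesis by (rule ulcI)
qed

lemma ulc_mult [intro]: "ulc f \<Longrightarrow> ulc g \<Longrightarrow> ulc (\<lambda>x. f x * g x)"
  and ulc_add [intro]: "ulc f \<Longrightarrow> ulc g \<Longrightarrow> ulc (\<lambda>x. f x + g x)"
  and ulc_diff [intro]: "ulc f \<Longrightarrow> ulc g \<Longrightarrow> ulc (\<lambda>x. f x - g x)"
  by (rule ulc_comp2; assumption)+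

lemma ulc_translate:
  assumes "ulc f" "u \<in> K"
  shows "ulc (\<lambda>x. f (x + u))" "ulc (\<lambda>x. f (u + x))"
proof -
  obtain n where n: "periodic n f" using assms(1) by (auto simp: ulc_def)
  have "periodic n (\<lambda>x. f (x + u))"
  proof (rule periodicI)
    fix x y assume "x \<in> K" "y \<in> K" "y \<in> P n"
    then show "f (x + y + u) = f (x + u)" using periodicD[OF n, of "x + u" y] assms(2) by (simp add: add_ac)
  qed
  then show "ulc (\<lambda>x. f (x + u))" by (rule ulcI)
  then show "ulc (\<lambda>x. f (u + x))" by (simp only: add.commute[of u])
qed

lemma P_add_iff: "y \<in> P n \<Longrightarrow> x + y \<in> P n \<longleftrightarrow> x \<in> P n"
  using P_add[of x n y] P_diff[of "x + y" n y] by auto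

lemma ulc_if_P [intro]: "ulc f \<Longrightarrow> ulc g \<Longrightarrow> ulc (\<lambda>x. if x \<in> P i then f x else g x)"
proof -
  assume "ulc f" "ulc g"
  then obtain n where n: "periodic n f" "periodic n g" "i \<le> n" by (rule ulcE2[where j = i])
  have "periodic n (\<lambda>x. if x \<in> P i then f x else g x)"
  proof (rule periodicI)
    fix x y assume xy: "x \<in> K" "y \<in> K" "y \<in> P n"
    then show "(if x + y \<in> P i then f (x + y) else g (x + y)) = (if x \<in> P i then f x else g x)"
      using P_add_iff[OF P_mono[OF xy(3) n(3)], of x] periodicD[OF n(1) xy] periodicD[OF n(2) xy] by simp
  qed
  then show ?thesis by (rule ulcI)
qed

end

subsection \<open>Integration of locally constant functions\<close>

locale unram_haar = unram_ext X for X :: "'e::field quad_ext" +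
  fixes \<mu> :: "'e measure"
  assumes haar: "is_haar_measure X \<mu>"
begin

lemma metric_K: "Metric_space K (val_dist K v)"
  using fin_residue by (intro metric_space_val) auto

lemma coset_sets: "a \<in> K \<Longrightarrow> {x \<in> K. x - a \<in> P n} \<in> sets \<mu>"
proof -
  assume a: "a \<in> K"
  interpret M: Metric_space K "val_dist K v" by (rule metric_K)
  have "openin (val_top K v) {x \<in> K. x - a \<in> P n}" unfolding val_top_def M.openin_mtopology
  proof (intro conjI allI impI)
    fix x assume x: "x \<in> {x \<in> K. x - a \<in> P n}"
    have "y - a \<in> P n" if "y \<in> M.mball x (q powi (- n))" for y
    proof -
      have "norm_abs K v (x - y) < q powi (- n)" using that by simp
      hence "x - y \<in> P n" using fin_residue unfolding q_def by (intro dist_less_P) auto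
      then show ?thesis using P_trans[OF P_diff_swap] x by blast
    qed
    then show "\<exists>r>0. M.mball x r \<subseteq> {x \<in> K. x - a \<in> P n}"
      by (intro exI[of _ "q powi (- n)"]) auto
  qed auto
  then show ?thesis using haar unfolding is_haar_measure_def by (auto intro: sigma_sets.Basic)
qed

lemma space_mu [simp]: "space \<mu> = K"
  using haar by (simp add: is_haar_measure_def)

lemma haar_translate: "A \<in> sets \<mu> \<Longrightarrow> a \<in> K \<Longrightarrow> emeasure \<mu> ((\<lambda>x. a + x) ` A) = emeasure \<mu> A"
  using haar unfolding is_haar_measure_def by blast

lemma emeasure_coset: 
  assumes "a \<in> K"
  shows "emeasure \<mu> {x \<in> K. x - a \<in> P n} = emeasure \<mu> {x \<in> K. x \<in> P n}"
proof -
  have "(\<lambda>x. a + x) ` {x \<in> K. x - 0 \<in> P n} = {x \<in> K. x - a \<in> P n}"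
  proof (intro set_eqI iffI)
    fix x assume "x \<in> {x \<in> K. x - a \<in> P n}"
    then show "x \<in> (\<lambda>x. a + x) ` {x \<in> K. x - 0 \<in> P n}"
      using assms by (intro image_eqI[of _ _ "x - a"]) auto
  qed (use assms in auto)
  moreover have "emeasure \<mu> ((\<lambda>x. a + x) ` {x \<in> K. x - 0 \<in> P n}) = emeasure \<mu> {x \<in> K. x - 0 \<in> P n}"
    using haar_translate[OF coset_sets[of 0 n] assms] by simp
  ultimately show ?thesis by simp
qed

lemma emeasure_ball_reps:
  assumes Y: "reps K j n Y" and "j \<le> n"
  shows "emeasure \<mu> {x \<in> K. x \<in> P j} = of_nat (card Y) * emeasure \<mu> {x \<in> K. x \<in> P n}"
proof -
  note Y' = repsD[OF Y]
  have eq: "{x \<in> K. x \<in> P j} = (\<Union>y\<in>Y. {x \<in> K. x - y \<in> P n})"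
  proof (intro set_eqI iffI)
    fix x assume "x \<in> {x \<in> K. x \<in> P j}"
    then show "x \<in> (\<Union>y\<in>Y. {x \<in> K. x - y \<in> P n})" using rep_of[OF Y] by auto
  next
    fix x assume "x \<in> (\<Union>y\<in>Y. {x \<in> K. x - y \<in> P n})"
    then obtain y where y: "y \<in> Y" "x \<in> K" "x - y \<in> P n" by blast
    hence "y \<in> P j" "x - y \<in> P j" using Y'(3) P_mono assms(2) by blast+
    hence "x \<in> P j" using P_add by fastforce
    with y show "x \<in> {x \<in> K. x \<in> P j}" by simp
  qed
  have disj: "disjoint_family_on (\<lambda>y. {x \<in> K. x - y \<in> P n}) Y"
    unfolding disjoint_family_on_def
  proof (intro ballI impI)
    fix y z assume yz: "y \<in> Y" "z \<in> Y" "y \<noteq> z"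
    have False if "x - y \<in> P n" "x - z \<in> P n" for x
      using P_trans[OF P_diff_swap[OF that(1)] that(2)] Y'(5) yz by blast
    then show "{x \<in> K. x - y \<in> P n} \<inter> {x \<in> K. x - z \<in> P n} = {}" by blast
  qed
  have "emeasure \<mu> {x \<in> K. x \<in> P j} = (\<Sum>y\<in>Y. emeasure \<mu> {x \<in> K. x - y \<in> P n})"
    unfolding eq using disj Y' coset_sets by (intro sum_emeasure[symmetric]) auto
  also have "\<dots> = (\<Sum>y\<in>Y. emeasure \<mu> {x \<in> K. x \<in> P n})"
    using Y'(2) by (intro sum.cong refl emeasure_coset) auto
  finally show ?thesis by simp
qed

text \<open>The cosets of a smaller ball all have the same volume, so their number determines it.
  The normalization on O_F is carried down for n \<ge> 0 and up for n < 0.\<close>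

lemma emeasure_ball: "emeasure \<mu> {x \<in> K. x \<in> P n} = ennreal (q powi (- n))"
proof -
  have O: "emeasure \<mu> {x \<in> K. x \<in> P 0} = 1"
    using haar unfolding is_haar_measure_def by (simp add: pideal_def)
  show ?thesis
  proof (cases "0 \<le> n")
    case True
    obtain Y where Y: "reps K 0 n Y" "real (card Y) = q powi (n - 0)" using reps_ex_card[OF True] by blast
    have "ennreal (q powi n) * emeasure \<mu> {x \<in> K. x \<in> P n} = 1"
      using emeasure_ball_reps[OF Y(1) True] O Y(2)
      by (simp add: ennreal_of_nat_eq_real_of_nat)
    moreover have "ennreal (q powi (- n)) * ennreal (q powi n) = 1"
      by (subst ennreal_mult[symmetric]) (auto simp: power_int_minus less_imp_le)
    ultimately show ?thesis
      by (metis mult.assoc mult.right_neutral mult.left_neutral)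
  next
    case False
    then obtain Y where Y: "reps K n 0 Y" "real (card Y) = q powi (0 - n)"
      using reps_ex_card[of n 0] by auto
    then show ?thesis using emeasure_ball_reps[OF Y(1)] O False
      by (simp add: ennreal_of_nat_eq_real_of_nat)
  qed
qed

definition J :: "int \<Rightarrow> ('e \<Rightarrow> complex) \<Rightarrow> complex" where
  "J j h = (LINT x : PF X j | \<mu>. h x)"

lemma J_cong: "(\<And>x. x \<in> K \<Longrightarrow> x \<in> P j \<Longrightarrow> h x = h' x) \<Longrightarrow> J j h = J j h'"
  unfolding J_def set_lebesgue_integral_def
  by (intro Bochner_Integration.integral_cong) (auto simp: indicator_def PF_iff)

lemma J_restrict: "j \<le> i \<Longrightarrow> J j (\<lambda>x. if x \<in> P i then h x else 0) = J i h"
  unfolding J_def set_lebesgue_integral_def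
  by (intro Bochner_Integration.integral_cong) (auto simp: indicator_def PF_iff P_mono)

text \<open>The link between the measure and finite sums. Additivity, translation, scaling and
  splitting of \<open>J\<close> below become facts about representatives.\<close>

lemma J_reps:
  assumes Y: "reps K j n Y" and h: "periodic n h" and le: "j \<le> n"
  shows "J j h = of_real (q powi (- n)) * sum h Y"
proof -
  note Y' = repsD[OF Y]
  have pt: "indicator (PF X j) x *\<^sub>R h x = (\<Sum>y\<in>Y. indicator {x \<in> K. x - y \<in> P n} x *\<^sub>R h y)"
    if x: "x \<in> space \<mu>" for x
  proof (cases "x \<in> P j")
    case True
    have xK: "x \<in> K" using x by simp
    let ?r = "rep_of n Y x"
    have r: "?r \<in> Y" "x - ?r \<in> P n" using rep_of[OF Y xK True] by auto
    have "(\<Sum>y\<in>Y. indicator {x \<in> K. x - y \<in> P n} x *\<^sub>R h y) = (\<Sum>y\<in>Y. if y = ?r then h y else 0)"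
    proof (rule sum.cong[OF refl])
      fix y assume "y \<in> Y"
      hence "x - y \<in> P n \<longleftrightarrow> y = ?r" using Y'(4)[OF xK True] r by blast
      then show "indicator {x \<in> K. x - y \<in> P n} x *\<^sub>R h y = (if y = ?r then h y else 0)"
        using xK by (simp only: indicator_def) simp
    qed
    also have "\<dots> = h ?r" using r Y'(1) by simp
    also have "\<dots> = h x"
    proof -
      have "?r \<in> K" using r Y'(2) by blast
      then show ?thesis using periodicD[OF h, of ?r "x - ?r"] xK r(2) by simp
    qed
    finally show ?thesis using xK True by (simp add: PF_iff)
  next
    case False
    have "x - y \<notin> P n" if "y \<in> Y" for y
    proof
      assume "x - y \<in> P n"
      hence "x - y \<in> P j" "y \<in> P j" using le P_mono Y'(3) that by blast+
      then show False using False P_add[of "x - y" j y] by simp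
    qed
    then show ?thesis using False by (simp add: PF_iff)
  qed
  have "J j h = (LINT x|\<mu>. (\<Sum>y\<in>Y. indicator {x \<in> K. x - y \<in> P n} x *\<^sub>R h y))"
    unfolding J_def set_lebesgue_integral_def by (intro Bochner_Integration.integral_cong refl pt)
  also have "\<dots> = (\<Sum>y\<in>Y. measure \<mu> {x \<in> K. x - y \<in> P n} *\<^sub>R h y)"
  proof (intro has_bochner_integral_integral_eq has_bochner_integral_sum has_bochner_integral_indicator)
    fix y assume "y \<in> Y"
    hence "y \<in> K" using Y'(2) by blast
    then show "{x \<in> K. x - y \<in> P n} \<in> sets \<mu>" "emeasure \<mu> {x \<in> K. x - y \<in> P n} < \<infinity>"
      using coset_sets emeasure_coset emeasure_ball by simp_all
  qed
  also have "\<dots> = (\<Sum>y\<in>Y. of_real (q powi (- n)) * h y)"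
  proof (rule sum.cong[OF refl])
    fix y assume "y \<in> Y"
    hence "y \<in> K" using Y'(2) by blast
    hence "measure \<mu> {x \<in> K. x - y \<in> P n} = q powi (- n)"
      using emeasure_coset emeasure_ball by (simp add: measure_def)
    then show "measure \<mu> {x \<in> K. x - y \<in> P n} *\<^sub>R h y = of_real (q powi (- n)) * h y"
      by (simp add: scaleR_conv_of_real)
  qed
  finally show ?thesis by (simp add: sum_distrib_left)
qed

lemma ulc_reps:
  assumes "ulc h"
  obtains n Y where "j \<le> n" "periodic n h" "reps K j n Y"
proof -
  obtain n where "periodic n h" "j \<le> n" using ulcE2[OF assms assms] by blast
  with reps_ex_card[of j n] that show ?thesis by blast
qed

lemma J_add: "ulc f \<Longrightarrow> ulc g \<Longrightarrow> J j (\<lambda>x. f x + g x) = J j f + J j g"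
proof -
  assume fg: "ulc f" "ulc g"
  then obtain n where n: "periodic n f" "periodic n g" "j \<le> n" by (rule ulcE2)
  then obtain Y where Y: "reps K j n Y" using reps_ex_card by blast
  have "periodic n (\<lambda>x. f x + g x)" using n by (auto simp: periodic_def)
  then show ?thesis using J_reps[OF Y _ n(3)] n by (simp add: sum.distrib distrib_left)
qed

lemma J_cmult: "J j (\<lambda>x. c * f x) = c * J j f"
  unfolding J_def by simp

lemma J_diff: "ulc f \<Longrightarrow> ulc g \<Longrightarrow> J j (\<lambda>x. f x - g x) = J j f - J j g"
  using J_add[of f "\<lambda>x. (- 1) * g x" j] J_cmult[of j "- 1" g] ulc_comp2[of g g "\<lambda>a b. (- 1) * a"]
  by simp

lemma J_const: "J j (\<lambda>x. c) = of_real (q powi (- j)) * c"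
  using J_reps[OF reps_trivial, of j "\<lambda>x. c"] by (simp add: periodic_def)

lemma J_translate:
  assumes h: "ulc h" and u: "u \<in> K" "u \<in> P j"
  shows "J j (\<lambda>x. h (x + u)) = J j h"
proof -
  obtain n Y where n: "j \<le> n" "periodic n h" "reps K j n Y" using ulc_reps[OF h] by blast
  have "periodic n (\<lambda>x. h (x + u))"
  proof (rule periodicI)
    fix x y assume "x \<in> K" "y \<in> K" "y \<in> P n"
    then show "h (x + y + u) = h (x + u)" using periodicD[OF n(2), of "x + u" y] u by (simp add: add_ac)
  qed
  hence "J j (\<lambda>x. h (x + u)) = of_real (q powi (- n)) * sum h ((\<lambda>y. y + u) ` Y)"
    using J_reps[OF n(3)] n by (subst sum.reindex) (auto simp: inj_on_def)
  also have "\<dots> = J j h" using J_reps[OF reps_translate[OF n(3) u]] n by simp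
  finally show ?thesis .
qed

lemma J_scale:
  assumes h: "ulc h" and c: "c \<in> K" "c \<noteq> 0"
  shows "J j (\<lambda>x. h (c * x)) = of_real (q powi v c) * J (j + v c) h"
proof -
  obtain n Y where n: "j + v c \<le> n" "periodic n h" "reps K (j + v c) n Y" using ulc_reps[OF h] by blast
  obtain Z where Z: "reps K j (n - v c) Z" using reps_ex_card[of j "n - v c"] n(1) by auto
  have cZ: "reps K (j + v c) n ((*) c ` Z)" using reps_scale[OF Z c] by simp
  have p: "periodic (n - v c) (\<lambda>x. h (c * x))"
  proof (rule periodicI)
    fix x y assume xy: "x \<in> K" "y \<in> K" "y \<in> P (n - v c)"
    hence "c * y \<in> P n" using c by (cases "y = 0") (auto simp: P_iff)
    then show "h (c * (x + y)) = h (c * x)"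
      using periodicD[OF n(2), of "c * x" "c * y"] xy c by (simp add: distrib_left)
  qed
  have "J j (\<lambda>x. h (c * x)) = of_real (q powi (- (n - v c))) * sum h ((*) c ` Z)"
    using J_reps[OF Z p] n(1) c by (subst sum.reindex) (auto simp: inj_on_def)
  also have "\<dots> = of_real (q powi v c) * (of_real (q powi (- n)) * sum h ((*) c ` Z))"
  proof -
    have "q powi (- (n - v c)) = q powi v c * q powi (- n)"
      by (subst power_int_add[symmetric]) auto
    then show ?thesis by (simp add: mult.assoc)
  qed
  also have "\<dots> = of_real (q powi v c) * J (j + v c) h" using J_reps[OF cZ n(2,1)] by simp
  finally show ?thesis .
qed

lemma J_split:
  assumes h: "ulc h" and Y: "reps K j i Y" and le: "j \<le> i"
  shows "J j h = (\<Sum>y\<in>Y. J i (\<lambda>x. h (y + x)))"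
proof -
  obtain n Z where n: "i \<le> n" "periodic n h" "reps K i n Z" using ulc_reps[OF h] by blast
  note e = reps_extend[OF Y n(3) le n(1)]
  have "J j h = of_real (q powi (- n)) * (\<Sum>(y, z)\<in>Y \<times> Z. h (y + z))"
    using J_reps[OF e(1) n(2)] le n(1) sum.reindex[OF e(2), of h] by (simp add: case_prod_beta comp_def)
  also have "\<dots> = (\<Sum>y\<in>Y. of_real (q powi (- n)) * (\<Sum>z\<in>Z. h (y + z)))"
    by (simp add: sum.cartesian_product[symmetric] sum_distrib_left)
  also have "\<dots> = (\<Sum>y\<in>Y. J i (\<lambda>x. h (y + x)))"
  proof (rule sum.cong[OF refl])
    fix y assume "y \<in> Y"
    hence yK: "y \<in> K" using repsD(2)[OF Y] by blast
    have "periodic n (\<lambda>x. h (y + x))"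
    proof (rule periodicI)
      fix x u assume "x \<in> K" "u \<in> K" "u \<in> P n"
      then show "h (y + (x + u)) = h (y + x)" using periodicD[OF n(2), of "y + x" u] yK by (simp add: add_ac)
    qed
    then show "of_real (q powi (- n)) * (\<Sum>z\<in>Z. h (y + z)) = J i (\<lambda>x. h (y + x))"
      using J_reps[OF n(3)] n(1) by simp
  qed
  finally show ?thesis .
qed

text \<open>Oscillation: the integral is invariant under the translation and is also multiplied by
  c.\<close>

lemma J_zero_translate:
  assumes "ulc h" "u \<in> K" "u \<in> P j" "c \<noteq> 1"
    and "\<And>x. x \<in> K \<Longrightarrow> x \<in> P j \<Longrightarrow> h (x + u) = c * h x"
  shows "J j h = 0"
proof -
  have "J j h = J j (\<lambda>x. c * h x)"
    using J_translate[OF assms(1-3)] J_cong[of j "\<lambda>x. h (x + u)" "\<lambda>x. c * h x"] assms(5) by simp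
  then show ?thesis using assms(4) by (simp add: J_cmult)
qed

text \<open>The multiplicative analogue: scaling by a unit preserves both the ball and the
  measure.\<close>

lemma J_zero_unit:
  assumes "ulc h" "u \<in> K" "u \<noteq> 0" "v u = 0" "c \<noteq> 1"
    and "\<And>x. x \<in> K \<Longrightarrow> x \<in> P j \<Longrightarrow> h (u * x) = c * h x"
  shows "J j h = 0"
proof -
  have "J j h = J j (\<lambda>x. c * h x)"
    using J_scale[OF assms(1-3), of j] J_cong[of j "\<lambda>x. h (u * x)" "\<lambda>x. c * h x"] assms by simp
  then show ?thesis using assms(5) by (simp add: J_cmult)
qed

end

subsection \<open>Matrices in the unitary group\<close>

lemma mat2_nth [simp]:
  "mat2 a b c d $ 1 $ 1 = a" "mat2 a b c d $ 1 $ 2 = b"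
  "mat2 a b c d $ 2 $ 1 = c" "mat2 a b c d $ 2 $ 2 = d"
  by (simp_all add: mat2_def)

lemma mat2_eta: "mat2 (g $ 1 $ 1) (g $ 1 $ 2) (g $ 2 $ 1) (g $ 2 $ 2) = g"
  by (simp add: vec_eq_iff forall_2)

lemma mat2_cases: obtains a b c d where "g = mat2 a b c d"
  by (metis mat2_eta)

lemma mat2_eq_iff [simp]:
  "mat2 a b c d = mat2 a' b' c' d' \<longleftrightarrow> a = a' \<and> b = b' \<and> c = c' \<and> d = d'"
  by (auto simp: vec_eq_iff forall_2)

lemma mat2_mult [simp]:
  fixes a :: "'a::semiring_1"
  shows "mat2 a b c d ** mat2 a' b' c' d' =
    mat2 (a * a' + b * c') (a * b' + b * d') (c * a' + d * c') (c * b' + d * d')"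
  by (simp add: vec_eq_iff forall_2 matrix_matrix_mult_def sum_2)

lemma mat_mat2: "mat z = mat2 z 0 0 z"
  by (simp add: vec_eq_iff forall_2 mat_def)

lemma det_mat2 [simp]: "det (mat2 a b c d) = a * d - b * c"
  by (simp add: det_2)

lemma transpose_mat2 [simp]: "transpose (mat2 a b c d) = mat2 a c b d"
  by (simp add: vec_eq_iff forall_2 transpose_def)

lemma map_matrix_mat2 [simp]: "map_matrix f (mat2 a b c d) = mat2 (f a) (f b) (f c) (f d)"
  by (simp add: vec_eq_iff forall_2 map_matrix_def)

lemma tdiag_mat2: "tdiag X t = mat2 t 0 0 (inverse (gal X t))"
  by (simp add: tdiag_def)

context unram_ext
begin

text \<open>Of the four entries of the matrix equation one is the conjugate of another, which leaves
  three. The determinant is nonzero because the equations give x = D * \<open>\<sigma>\<close> x for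
  the entries of the first column.\<close>

lemma U11_iff: "mat2 a b c d \<in> U11 X \<longleftrightarrow>
    \<sigma> a * d - \<sigma> b * c = 1 \<and> \<sigma> a * b = \<sigma> b * a \<and> \<sigma> c * d = \<sigma> d * c"
proof
  assume "mat2 a b c d \<in> U11 X"
  then show "\<sigma> a * d - \<sigma> b * c = 1 \<and> \<sigma> a * b = \<sigma> b * a \<and> \<sigma> c * d = \<sigma> d * c"
    by (auto simp: U11_def Jmat_def algebra_simps)
next
  assume a: "\<sigma> a * d - \<sigma> b * c = 1 \<and> \<sigma> a * b = \<sigma> b * a \<and> \<sigma> c * d = \<sigma> d * c"
  have 2: "a * \<sigma> d - b * \<sigma> c = 1" using arg_cong[OF conjunct1[OF a], of \<sigma>] by simp
  have "(a * d - b * c) * \<sigma> a = a" "(a * d - b * c) * \<sigma> c = c" using a 2 by algebra+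
  hence "a * d - b * c \<noteq> 0" using a by auto
  hence "invertible (mat2 a b c d)" by (simp add: invertible_det_nz)
  then show "mat2 a b c d \<in> U11 X" using a 2 by (auto simp: U11_def Jmat_def algebra_simps)
qed

lemma U11_det:
  assumes "mat2 a b c d \<in> U11 X"
  defines "D \<equiv> a * d - b * c"
  shows "D * \<sigma> a = a" "D * \<sigma> b = b" "D * \<sigma> c = c" "D * \<sigma> d = d" "D \<noteq> 0"
    "a * \<sigma> d - b * \<sigma> c = 1" "\<sigma> a * d - \<sigma> b * c = 1"
proof -
  have a: "\<sigma> a * d - \<sigma> b * c = 1" "\<sigma> a * b = \<sigma> b * a" "\<sigma> c * d = \<sigma> d * c"
    using assms(1) by (auto simp: U11_iff)
  have 2: "a * \<sigma> d - b * \<sigma> c = 1" using arg_cong[OF a(1), of \<sigma>] by simp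
  show "a * \<sigma> d - b * \<sigma> c = 1" "\<sigma> a * d - \<sigma> b * c = 1" by fact+
  show e: "D * \<sigma> a = a" "D * \<sigma> b = b" "D * \<sigma> c = c" "D * \<sigma> d = d"
    unfolding D_def using a 2 by algebra+
  show "D \<noteq> 0" using a(1) e by auto
qed

text \<open>An entry x satisfies x = D * \<open>\<sigma>\<close> x with D the determinant, so D
  cancels in quotients. Up to a scalar from E, the matrix therefore has entries in F.\<close>

lemma U11_ratio:
  assumes "mat2 a b c d \<in> U11 X" "x \<in> {a, b, c, d}" "y \<in> {a, b, c, d}"
  shows "x / y \<in> K"
proof -
  let ?D = "a * d - b * c"
  have D: "?D \<noteq> 0" using U11_det[OF assms(1)] by blast
  have "?D * \<sigma> x = x" "?D * \<sigma> y = y" using U11_det(1-4)[OF assms(1)] assms(2,3) by auto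
  hence e: "\<sigma> x = x / ?D" "\<sigma> y = y / ?D" using D by (auto simp: field_simps)
  have "\<sigma> (x / y) = x / y" unfolding gal_divide e using D by simp
  then show ?thesis by (rule iffD1[OF gal_fixed_iff])
qed

lemma U11_mult:
  assumes "g \<in> U11 X" "h \<in> U11 X"
  shows "g ** h \<in> U11 X"
proof -
  obtain a b c d where g: "g = mat2 a b c d" by (rule mat2_cases)
  obtain a' b' c' d' where h: "h = mat2 a' b' c' d'" by (rule mat2_cases)
  have 1: "\<sigma> a * d - \<sigma> b * c = 1" "\<sigma> a * b = \<sigma> b * a" "\<sigma> c * d = \<sigma> d * c"
    using assms(1) by (auto simp: g U11_iff)
  have 2: "\<sigma> a' * d' - \<sigma> b' * c' = 1" "\<sigma> a' * b' = \<sigma> b' * a'" "\<sigma> c' * d' = \<sigma> d' * c'"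
    "a' * \<sigma> d' - b' * \<sigma> c' = 1"
    using assms(2) U11_det(6)[of a' b' c' d'] by (auto simp: h U11_iff)
  show ?thesis unfolding g h mat2_mult U11_iff gal_add gal_mult
    using 1 2 by (intro conjI) algebra+
qed

text \<open>The inverse as the defining equation gives it, without dividing by the determinant: the
  integrality of its entries is then visible.\<close>

definition inv2 :: "'e^2^2 \<Rightarrow> 'e^2^2" where
  "inv2 g = mat2 (\<sigma> (g $ 2 $ 2)) (- \<sigma> (g $ 1 $ 2)) (- \<sigma> (g $ 2 $ 1)) (\<sigma> (g $ 1 $ 1))"

lemma inv2:
  assumes "g \<in> U11 X"
  shows "inv2 g \<in> U11 X" "g ** inv2 g = mat 1" "inv2 g ** g = mat 1"
proof -
  obtain a b c d where g: "g = mat2 a b c d" by (rule mat2_cases)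
  have 1: "\<sigma> a * d - \<sigma> b * c = 1" "\<sigma> a * b = \<sigma> b * a" "\<sigma> c * d = \<sigma> d * c"
    "a * \<sigma> d - b * \<sigma> c = 1" 
    using assms U11_det(6)[of a b c d] by (auto simp: g U11_iff)
  have 2: "(a * d - b * c) * \<sigma> a = a" "(a * d - b * c) * \<sigma> b = b" "(a * d - b * c) * \<sigma> c = c"
    "(a * d - b * c) * \<sigma> d = d" "a * d - b * c \<noteq> 0"
    using U11_det[of a b c d] assms g by auto
  have r: "x * \<sigma> y = \<sigma> x * y" if "x \<in> {a, b, c, d}" "y \<in> {a, b, c, d}" for x y
  proof -
    have "(a * d - b * c) * \<sigma> x = x" "(a * d - b * c) * \<sigma> y = y" using 2 that by auto
    then show ?thesis by (metis mult.assoc mult.commute)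
  qed
  show "inv2 g \<in> U11 X" unfolding inv2_def g mat2_nth U11_iff
    using 1 r[of b c] r[of d b] r[of c a] by (simp add: mult.commute)
  show "g ** inv2 g = mat 1" unfolding inv2_def g mat2_nth mat_mat2 mat2_mult mat2_eq_iff
    using 1 by (simp add: mult.commute)
  show "inv2 g ** g = mat 1" unfolding inv2_def g mat2_nth mat_mat2 mat2_mult mat2_eq_iff
    using 1 r[of a d] r[of b c] r[of d b] r[of c a] by (simp add: mult.commute)
qed

lemma U11_mult_iff: "h \<in> U11 X \<Longrightarrow> g ** h \<in> U11 X \<longleftrightarrow> g \<in> U11 X"
  using U11_mult[of "g ** h" "inv2 h"] U11_mult[of g h] inv2[of h]
  by (auto simp: matrix_mul_assoc[symmetric])

lemma unip_U11 [simp]: "x \<in> K \<Longrightarrow> unip x \<in> U11 X"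
  by (simp add: unip_def U11_iff)

lemma weyl_U11 [simp]: "weyl \<in> U11 X"
  by (simp add: weyl_def U11_iff)

lemma tdiag_U11 [simp]: "t \<noteq> 0 \<Longrightarrow> tdiag X t \<in> U11 X"
  by (simp add: tdiag_mat2 U11_iff)

lemma mat1_U11 [simp]: "mat 1 \<in> U11 X"
  by (simp add: mat_mat2 U11_iff)

lemma lower_U11 [simp]: "x \<in> K \<Longrightarrow> mat2 1 0 x 1 \<in> U11 X"
  by (simp add: U11_iff)

text \<open>The congruences already imply integrality, and x = D * \<open>\<sigma>\<close> x for a
  nonzero entry x forces the determinant D to be a unit.\<close>

lemma congruence_mat2: "mat2 a b c d \<in> congruence_subgroup X n \<longleftrightarrow>
    mat2 a b c d \<in> U11 X \<and> a - 1 \<in> P (int n) \<and> b \<in> P (int n) \<and> c \<in> P (int n) \<and> d - 1 \<in> P (int n)"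
  (is "?L \<longleftrightarrow> ?R")
proof
  show "?L \<Longrightarrow> ?R" by (auto simp: congruence_subgroup_def mat_mat2 forall_2)
next
  assume R: ?R
  have "a \<in> P 0" "d \<in> P 0" using R P_add[of "a - 1" 0 1] P_add[of "d - 1" 0 1] P_mono[of _ "int n" 0] by auto
  moreover have "b \<in> P 0" "c \<in> P 0" using R P_mono[of _ "int n" 0] by auto
  moreover have "a * d - b * c \<in> int_units UNIV v"
  proof -
    let ?D = "a * d - b * c"
    have D: "?D \<noteq> 0" "?D * \<sigma> a = a" "?D * \<sigma> c = c" using U11_det[of a b c d] R by auto
    have "a \<noteq> 0 \<or> c \<noteq> 0" using R by (auto simp: U11_iff)
    hence "v ?D = 0" using D v_mult[of ?D "\<sigma> a"] v_mult[of ?D "\<sigma> c"] by auto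
    then show ?thesis using D by (simp add: int_units_def)
  qed
  ultimately show ?L using R by (auto simp: congruence_subgroup_def mat_mat2 forall_2 GL2OE_def)
qed

lemma congruence_antimono: "m \<le> n \<Longrightarrow> congruence_subgroup X n \<subseteq> congruence_subgroup X m"
  unfolding congruence_subgroup_def using P_mono[of _ "int n" "int m"] by auto

section \<open>Elementary facts about the minima that define conductors\<close>

lemma cond_eta_0: "cond_eta X V \<eta> = 0 \<longleftrightarrow> eta_space X V \<eta> 0 \<noteq> {0} \<or> eta_space' X V \<eta> 0 \<noteq> {0}"
proof -
  let ?S = "{enat m | m. eta_space X V \<eta> m \<noteq> {0} \<or> eta_space' X V \<eta> m \<noteq> {0}}"
  have "Inf ?S = 0 \<longleftrightarrow> 0 \<in> ?S"
  proof
    assume a: "Inf ?S = 0"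
    hence "?S \<noteq> {}" by (metis Inf_enat_def i0_ne_infinity)
    then show "0 \<in> ?S" using a by (metis (no_types, lifting) Inf_enat_def LeastI_ex equals0I)
  next
    assume "0 \<in> ?S"
    hence "Inf ?S \<le> 0" by (rule Inf_lower)
    then show "Inf ?S = 0" by simp
  qed
  then show ?thesis unfolding cond_eta_def by (auto simp: zero_enat_def)
qed

lemma cond_eta_le: "eta_space X V \<eta> m \<noteq> {0} \<or> eta_space' X V \<eta> m \<noteq> {0} \<Longrightarrow> cond_eta X V \<eta> \<le> enat m"
  unfolding cond_eta_def by (rule Inf_lower) auto

lemma conductor_0: "eta_compatible X V \<eta> \<Longrightarrow> cond_eta X V \<eta> = 0 \<Longrightarrow> conductor X V = 0"
proof -
  assume a: "eta_compatible X V \<eta>" "cond_eta X V \<eta> = 0"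
  have "conductor X V \<le> cond_eta X V \<eta>" unfolding conductor_def using a(1) by (intro Inf_lower) blast
  with a(2) show ?thesis by simp
qed

end

text \<open>Repeated squaring: while |w - 1| \<le> 1/2 one has |w + 1| \<ge> 3/2, so |w^2 - 1|
  exceeds |w - 1| by a factor of at least 3/2. Unless z = 1 this cannot go on.\<close>

lemma no_small_subgroup:
  fixes z :: complex
  assumes "\<And>k::nat. cmod (z ^ k - 1) \<le> 1 / 2"
  shows "z = 1"
proof (rule ccontr)
  assume "z \<noteq> 1"
  have ge: "(3 / 2) ^ k * cmod (z - 1) \<le> cmod (z ^ (2 ^ k) - 1)" for k :: nat
  proof (induction k)
    case (Suc k)
    let ?w = "z ^ (2 ^ k)"
    have "2 - cmod (?w - 1) \<le> cmod (?w + 1)"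
      using norm_triangle_ineq4[of "?w + 1" "?w - 1"] by simp
    hence 1: "3 / 2 \<le> cmod (?w + 1)" using assms[of "2 ^ k"] by simp
    have "(3 / 2) ^ Suc k * cmod (z - 1) \<le> 3 / 2 * cmod (?w - 1)" using Suc by (simp add: mult.commute)
    also have "\<dots> \<le> cmod (?w + 1) * cmod (?w - 1)" using 1 by (intro mult_right_mono) auto
    also have "\<dots> = cmod ((?w + 1) * (?w - 1))" by (simp only: norm_mult)
    also have "(?w + 1) * (?w - 1) = z ^ (2 ^ Suc k) - 1"
      by (simp only: mult_2 power_Suc power_add) (simp only: ring_distribs, simp)
    finally show ?case .
  qed simp
  obtain k where "1 / (2 * cmod (z - 1)) < (3 / 2) ^ k" using real_arch_pow[of "3/2"] by auto
  hence "1 / 2 < (3 / 2) ^ k * cmod (z - 1)" using \<open>z \<noteq> 1\<close> by (simp add: field_simps)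
  with ge[of k] assms[of "2 ^ k"] show False by linarith
qed

subsection \<open>Characters and Fourier inversion\<close>

locale unitary_ps = unram_haar X \<mu> for X :: "'e::field quad_ext" and \<mu> +
  fixes chi \<psi> :: "'e \<Rightarrow> complex"
  assumes chi_char: "is_char X (UNIV - {0}) chi"
    and psi_char: "is_additive_char X \<psi>"
    and psi_O: "\<forall>x\<in>OF X. \<psi> x = 1"
    and psi_nontriv: "\<exists>x\<in>PF X (- 1). \<psi> x \<noteq> 1"
begin

abbreviation Q :: complex where "Q \<equiv> complex_of_real q"

lemma chi_mult: "x \<noteq> 0 \<Longrightarrow> y \<noteq> 0 \<Longrightarrow> chi (x * y) = chi x * chi y"
  and chi_nz [simp]: "x \<noteq> 0 \<Longrightarrow> chi x \<noteq> 0"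
  using chi_char by (auto simp: is_char_def)

lemma chi_1 [simp]: "chi 1 = 1"
  using chi_mult[of 1 1] chi_nz[of 1] by simp

lemma chi_inverse: "x \<noteq> 0 \<Longrightarrow> chi (inverse x) = inverse (chi x)"
  using chi_mult[of x "inverse x"] by (simp add: inverse_unique)

lemma chi_power: "x \<noteq> 0 \<Longrightarrow> chi (x ^ n) = chi x ^ n"
  by (induction n) (auto simp: chi_mult)

lemma chi_power_int: "x \<noteq> 0 \<Longrightarrow> chi (x powi n) = chi x powi n"
  by (simp add: power_int_def chi_power chi_inverse)

definition chi_triv :: "int \<Rightarrow> bool" where
  "chi_triv m \<longleftrightarrow> 1 \<le> m \<and> (\<forall>x. x - 1 \<in> P m \<longrightarrow> chi x = 1)"

lemma one_unit_nz: "x - 1 \<in> P m \<Longrightarrow> 1 \<le> m \<Longrightarrow> x \<noteq> 0 \<and> v x = 0"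
  using v_add_eq'[of 1 x] P_mono[of "x - 1" m 1] by simp

lemma one_unit_mult: "x - 1 \<in> P m \<Longrightarrow> y - 1 \<in> P m \<Longrightarrow> 0 \<le> m \<Longrightarrow> x * y - 1 \<in> P m"
proof -
  assume a: "x - 1 \<in> P m" "y - 1 \<in> P m" "0 \<le> m"
  have "(x - 1) * (y - 1) + (x - 1) + (y - 1) \<in> P m"
    using P_mult'[OF a(1,2)] a by (intro P_add) auto
  then show ?thesis by (simp add: algebra_simps)
qed

text \<open>Continuity only brings the values on a small group of one-units within 1/2 of 1. That
  group is closed under powers, so \<open>no_small_subgroup\<close> makes the values equal to
  1.\<close>

lemma ex_chi_triv: "\<exists>m. chi_triv m"
proof -
  interpret M: Metric_space "UNIV :: 'e set" "val_dist UNIV v"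
    using fin_residue by (intro metric_space_val) auto
  have "continuous_map (subtopology (val_top UNIV v) (UNIV - {0})) euclidean chi"
    using chi_char by (simp add: is_char_def)
  hence "openin (subtopology (val_top UNIV v) (UNIV - {0}))
      {x \<in> topspace (subtopology (val_top UNIV v) (UNIV - {0})). chi x \<in> ball 1 (1/2)}"
    by (rule openin_continuous_map_preimage) auto
  then obtain U where U: "openin M.mtopology U"
    "{x \<in> UNIV - {0}. chi x \<in> ball 1 (1/2)} = U \<inter> (UNIV - {0})"
    by (auto simp: openin_subtopology val_top_def)
  have "(1::'e) \<in> U \<inter> (UNIV - {0})" unfolding U(2)[symmetric] by simp
  then obtain r where r: "r > 0" "M.mball 1 r \<subseteq> U" using U(1) unfolding M.openin_mtopology by blast
  then obtain N where N: "\<And>x n. x \<in> P n \<Longrightarrow> int N \<le> n \<Longrightarrow> norm_abs UNIV v x < r"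
    using small_dist[of UNIV r] fin_residue by auto
  let ?m = "max 1 (int N)"
  have close: "cmod (chi x - 1) \<le> 1 / 2" if "x - 1 \<in> P ?m" for x
  proof -
    have "x \<noteq> 0" using one_unit_nz[OF that] by simp
    moreover have "norm_abs UNIV v (1 - x) < r" using N[OF P_diff_swap[OF that]] by simp
    ultimately have "x \<in> {x \<in> UNIV - {0}. chi x \<in> ball 1 (1/2)}" unfolding U(2) using r(2) by auto
    then show ?thesis by (simp add: dist_norm norm_minus_commute)
  qed
  have "chi x = 1" if x: "x - 1 \<in> P ?m" for x
  proof (rule no_small_subgroup)
    fix k :: nat
    have "x ^ k - 1 \<in> P ?m"
    proof (induction k)
      case (Suc k) then show ?case using one_unit_mult[OF x] by simp
    qed simp
    moreover have "x \<noteq> 0" using one_unit_nz[OF x] by simp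
    ultimately show "cmod (chi x ^ k - 1) \<le> 1 / 2" using close[of "x ^ k"] by (simp add: chi_power)
  qed
  hence "chi_triv ?m" by (simp add: chi_triv_def)
  then show ?thesis by blast
qed

text \<open>The asymptotics of \<open>phi f\<close> involve chi on F only. A level for chi on F can
  be smaller than one for chi on E, and the explicit evaluations of \<open>Lam\<close> depend on
  having the small one.\<close>

definition chi_trivK :: "int \<Rightarrow> bool" where
  "chi_trivK m \<longleftrightarrow> 1 \<le> m \<and> (\<forall>x\<in>K. x - 1 \<in> P m \<longrightarrow> chi x = 1)"

lemma chi_triv_imp_chi_trivK: "chi_triv m \<Longrightarrow> chi_trivK m"
  by (simp add: chi_triv_def chi_trivK_def)

lemma psi_add: "x \<in> K \<Longrightarrow> y \<in> K \<Longrightarrow> \<psi> (x + y) = \<psi> x * \<psi> y"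
  and psi_norm: "x \<in> K \<Longrightarrow> cmod (\<psi> x) = 1"
  using psi_char by (auto simp: is_additive_char_def)

lemma psi_nz [simp]: "x \<in> K \<Longrightarrow> \<psi> x \<noteq> 0"
  using psi_norm[of x] by auto

lemma psi_eq_1: "x \<in> K \<Longrightarrow> x \<in> P 0 \<Longrightarrow> \<psi> x = 1"
  using psi_O PF_iff by blast

lemma psi_0 [simp]: "\<psi> 0 = 1"
  by (rule psi_eq_1) auto

lemma psi_minus_mult: "x \<in> K \<Longrightarrow> \<psi> (- x) * \<psi> x = 1"
  using psi_add[of "- x" x] by simp

lemma cnj_psi: "x \<in> K \<Longrightarrow> cnj (\<psi> x) = \<psi> (- x)"
proof -
  assume x: "x \<in> K"
  have "\<psi> x * cnj (\<psi> x) = \<psi> (- x) * \<psi> x"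
    using psi_norm[OF x] psi_minus_mult[OF x] by (simp add: complex_norm_square[symmetric])
  then show ?thesis using psi_nz[OF x] by (simp add: mult.commute)
qed

lemma psi_periodic: "a \<in> K \<Longrightarrow> x \<in> K \<Longrightarrow> y \<in> K \<Longrightarrow> a * y \<in> P 0 \<Longrightarrow> \<psi> (a * (x + y)) = \<psi> (a * x)"
  using psi_add[of "a * x" "a * y"] psi_eq_1[of "a * y"] by (simp add: distrib_left)

lemma periodic_psi:
  assumes "a \<in> K" "a \<in> P (- n)"
  shows "periodic n (\<lambda>x. \<psi> (a * x))"
proof (rule periodicI)
  fix x y assume "x \<in> K" "y \<in> K" "y \<in> P n"
  then show "\<psi> (a * (x + y)) = \<psi> (a * x)" using assms P_mult[of a "- n" y n] by (intro psi_periodic) auto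
qed

lemma ulc_psi [intro, simp]: "a \<in> K \<Longrightarrow> ulc (\<lambda>x. \<psi> (a * x))"
proof -
  assume a: "a \<in> K"
  have "a \<in> P (- (- v a))" by (simp add: P_iff)
  from ulcI[OF periodic_psi[OF a this]] show ?thesis .
qed

text \<open>The witness is x/a, where x has valuation -1 and \<psi> is nontrivial at x. Its exact
  valuation is part of the conclusion because \<open>shell_vanish\<close> has no room to
  spare.\<close>

lemma psi_nontriv_at:
  assumes "a \<in> K" "a \<notin> P (- j)"
  obtains u where "u \<in> K" "u \<in> P j" "u \<noteq> 0" "v u = - v a - 1" "\<psi> (a * u) \<noteq> 1"
proof -
  obtain x where x: "x \<in> K" "x \<in> P (- 1)" "\<psi> x \<noteq> 1" using psi_nontriv PF_iff by blast
  have "x \<notin> P 0" using x psi_eq_1[of x] by blast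
  hence x': "x \<noteq> 0" "v x = - 1" using x(2) by (auto simp: P_iff)
  have a: "a \<noteq> 0" "v a < - j" using assms by (auto simp: P_iff)
  show ?thesis by (rule that[of "x / a"]) (use x x' a assms in \<open>auto simp: P_iff\<close>)
qed

lemma J_psi: "a \<in> K \<Longrightarrow> J j (\<lambda>x. \<psi> (a * x)) = (if a \<in> P (- j) then Q powi (- j) else 0)"
proof (cases "a \<in> P (- j)")
  case True
  assume a: "a \<in> K"
  have "J j (\<lambda>x. \<psi> (a * x)) = J j (\<lambda>x. 1)"
    using a True P_mult[of a "- j" _ j] by (intro J_cong psi_eq_1) auto
  then show ?thesis using True by (simp add: J_const)
next
  case False
  assume a: "a \<in> K"
  obtain u where u: "u \<in> K" "u \<in> P j" "\<psi> (a * u) \<noteq> 1" using psi_nontriv_at[OF a False] by blast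
  have "J j (\<lambda>x. \<psi> (a * x)) = 0"
    by (rule J_zero_translate[OF _ u(1,2), of _ "\<psi> (a * u)"])
      (use u a psi_add in \<open>auto simp: distrib_left mult.commute[of "\<psi> (a * u)"]\<close>)
  then show ?thesis using False by simp
qed

text \<open>Inversion takes place on the finite group \<open>\<P>\<^sup>-\<^sup>r/\<P>\<^sup>n\<close>, whose characters are the \<open>\<psi>\<^sub>a\<close> with
  \<open>a \<in> \<P>\<^sup>-\<^sup>n/\<P>\<^sup>r\<close>.\<close>

lemma fourier_inj:
  assumes h: "ulc h" and supp: "\<And>x. x \<in> K \<Longrightarrow> x \<notin> P (- r) \<Longrightarrow> h x = 0"
    and zero: "\<And>a. a \<in> K \<Longrightarrow> a \<noteq> 0 \<Longrightarrow> J (- r) (\<lambda>x. h x * \<psi> (- a * x)) = 0"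
    and x: "x \<in> K"
  shows "h x = 0"
proof (cases "x \<in> P (- r)")
  case True
  \<comment> \<open>Index 0 is not covered by the hypothesis; on P^(-r) it gives the same character
    as the nonzero index \<pi>^r.\<close>
  have zero': "J (- r) (\<lambda>x. h x * \<psi> (- a * x)) = 0" if a: "a \<in> K" for a
  proof (cases "a = 0")
    case True
    have "J (- r) (\<lambda>x. h x * \<psi> (- (\<pi> powi r) * x)) = 0" by (rule zero) auto
    moreover have "J (- r) (\<lambda>x. h x * \<psi> (- (\<pi> powi r) * x)) = J (- r) h"
    proof (rule J_cong)
      fix x assume "x \<in> K" "x \<in> P (- r)"
      moreover have "- (\<pi> powi r) \<in> P r" by (simp add: P_iff)
      ultimately have "\<psi> (- (\<pi> powi r) * x) = 1" using P_mult[of "- (\<pi> powi r)" r x "- r"] by (intro psi_eq_1) auto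
      then show "h x * \<psi> (- (\<pi> powi r) * x) = h x" by simp
    qed
    ultimately show ?thesis using True by simp
  qed (use zero a in blast)
  obtain n Y where n: "- r \<le> n" "periodic n h" "reps K (- r) n Y" using ulc_reps[OF h] by blast
  obtain Z where Z: "reps K (- n) r Z" using reps_ex_card[of "- n" r] n by auto
  note Y' = repsD[OF n(3)] and Z' = repsD[OF Z]
  have YK: "y \<in> K" "y \<in> P (- r)" if "y \<in> Y" for y using that Y' by blast+
  have ZK: "y \<in> K" "y \<in> P (- n)" if "y \<in> Z" for y using that Z' by blast+
  have orth: "(\<Sum>a\<in>Z. \<psi> (a * (x - y))) = (if x - y \<in> P n then Q powi (r + n) else 0)" if y: "y \<in> Y" for y
  proof -
    have d: "x - y \<in> K" "x - y \<in> P (- r)" using YK[OF y] x True by auto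
    have "J (- n) (\<lambda>a. \<psi> ((x - y) * a)) = Q powi (- r) * (\<Sum>a\<in>Z. \<psi> ((x - y) * a))"
      using J_reps[OF Z periodic_psi[of "x - y" r]] d n by simp
    hence "(\<Sum>a\<in>Z. \<psi> ((x - y) * a)) = Q powi r * J (- n) (\<lambda>a. \<psi> ((x - y) * a))"
      by (simp add: power_int_minus)
    also have "\<dots> = (if x - y \<in> P n then Q powi (r + n) else 0)"
      using J_psi[OF d(1), of "- n"] by (simp add: power_int_add)
    finally show ?thesis by (simp add: mult.commute)
  qed
  have eq: "(\<Sum>y\<in>Y. h y * \<psi> (- a * y)) = 0" if a: "a \<in> Z" for a
  proof -
    have "periodic n (\<lambda>x. \<psi> (- a * x))" using ZK[OF a] by (intro periodic_psi) auto
    hence "periodic n (\<lambda>x. h x * \<psi> (- a * x))" using n(2) by (auto simp: periodic_def)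
    from J_reps[OF n(3) this n(1)] zero'[of a] ZK[OF a] show ?thesis by simp
  qed
  have "0 = (\<Sum>a\<in>Z. \<psi> (a * x) * (\<Sum>y\<in>Y. h y * \<psi> (- a * y)))" using eq by simp
  also have "\<dots> = (\<Sum>a\<in>Z. \<Sum>y\<in>Y. h y * \<psi> (a * (x - y)))"
  proof (simp only: sum_distrib_left, intro sum.cong refl)
    fix a y assume "a \<in> Z" "y \<in> Y"
    hence "\<psi> (a * (x - y)) = \<psi> (a * x) * \<psi> (- a * y)"
      using psi_add[of "a * x" "- a * y"] ZK YK x by (simp add: algebra_simps)
    then show "\<psi> (a * x) * (h y * \<psi> (- a * y)) = h y * \<psi> (a * (x - y))" by simp
  qed
  also have "\<dots> = (\<Sum>y\<in>Y. h y * (\<Sum>a\<in>Z. \<psi> (a * (x - y))))"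
    by (subst sum.swap) (simp only: sum_distrib_left)
  also have "\<dots> = (\<Sum>y\<in>Y. if y = rep_of n Y x then h y * Q powi (r + n) else 0)"
  proof (rule sum.cong[OF refl])
    fix y assume y: "y \<in> Y"
    have "x - y \<in> P n \<longleftrightarrow> y = rep_of n Y x"
      using Y'(4)[OF x True] rep_of[OF n(3) x True] y by blast
    then show "h y * (\<Sum>a\<in>Z. \<psi> (a * (x - y))) = (if y = rep_of n Y x then h y * Q powi (r + n) else 0)"
      using orth[OF y] by simp
  qed
  also have "\<dots> = h (rep_of n Y x) * Q powi (r + n)"
    using rep_of(1)[OF n(3) x True] Y'(1) by simp
  finally have "h (rep_of n Y x) = 0" by simp
  moreover have "h x = h (rep_of n Y x)"
    using periodicD[OF n(2), of "rep_of n Y x" "x - rep_of n Y x"] rep_of[OF n(3) x True] YK x by simp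
  ultimately show ?thesis by simp
qed (use supp x in blast)

subsection \<open>The principal series\<close>

abbreviation PS where "PS \<equiv> principal_series X chi"

definition phi :: "('e^2^2 \<Rightarrow> complex) \<Rightarrow> 'e \<Rightarrow> complex" where
  "phi f x = f (weyl ** unip x)"

text \<open>The character chi^-1 |.|_F^-1 of the nonzero elements of F: the factor between
  \<open>phi f x\<close> and the value of f at the lower unipotent matrix with entry 1/x.\<close>

definition xi :: "'e \<Rightarrow> complex" where
  "xi x = chi (inverse x) * Q powi v x"

lemma phi_mat2: "phi f x = f (mat2 0 (- 1) 1 x)"
  by (simp add: phi_def weyl_def unip_def)

lemma PS_iff: "f \<in> PS \<longleftrightarrow> (\<forall>g. g \<notin> U11 X \<longrightarrow> f g = 0) \<and>
    (\<exists>n. \<forall>k\<in>congruence_subgroup X n. rtrans k f = f) \<and>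
    (\<forall>t x g. t \<noteq> 0 \<longrightarrow> x \<in> K \<longrightarrow> g \<in> U11 X \<longrightarrow>
      f (mat2 t (t * x) 0 (inverse (\<sigma> t)) ** g) = chi t * Q powi (- v t) * f g)"
proof -
  have b: "tdiag X t ** unip x = mat2 t (t * x) 0 (inverse (\<sigma> t))" for t x :: 'e
    by (simp add: tdiag_mat2 unip_def)
  have "(\<forall>b\<in>Borel X. \<forall>g\<in>U11 X.
        f (b ** g) = chi (b $ 1 $ 1) * of_real (sqrt (absE X (b $ 1 $ 1))) * f g) \<longleftrightarrow>
     (\<forall>t x g. t \<noteq> 0 \<longrightarrow> x \<in> K \<longrightarrow> g \<in> U11 X \<longrightarrow>
      f (mat2 t (t * x) 0 (inverse (\<sigma> t)) ** g) = chi t * Q powi (- v t) * f g)" (is "?L \<longleftrightarrow> ?R")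
  proof
    assume L: ?L
    show ?R
    proof (intro allI impI)
      fix t x :: 'e and g assume a: "t \<noteq> 0" "x \<in> K" "g \<in> U11 X"
      have "tdiag X t ** unip x \<in> Borel X" using a by (auto simp: Borel_def)
      from L[rule_format, OF this a(3)]
      show "f (mat2 t (t * x) 0 (inverse (\<sigma> t)) ** g) = chi t * Q powi (- v t) * f g"
        unfolding b mat2_nth sqrt_absE[OF a(1)] by simp
    qed
  next
    assume R: ?R
    show ?L
    proof (intro ballI)
      fix b g assume "b \<in> Borel X" and g: "g \<in> U11 X"
      then obtain t x where t: "t \<noteq> 0" "x \<in> K" "b = mat2 t (t * x) 0 (inverse (\<sigma> t))"
        unfolding Borel_def b by blast
      show "f (b ** g) = chi (b $ 1 $ 1) * of_real (sqrt (absE X (b $ 1 $ 1))) * f g"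
        unfolding t(3) mat2_nth sqrt_absE[OF t(1)] using R t g by simp
    qed
  qed
  then show ?thesis by (simp add: principal_series_def)
qed

lemma PS_D:
  assumes "f \<in> PS"
  shows "g \<notin> U11 X \<Longrightarrow> f g = 0"
    "\<exists>n. \<forall>k\<in>congruence_subgroup X n. rtrans k f = f"
    "t \<noteq> 0 \<Longrightarrow> x \<in> K \<Longrightarrow> g \<in> U11 X \<Longrightarrow>
      f (mat2 t (t * x) 0 (inverse (\<sigma> t)) ** g) = chi t * Q powi (- v t) * f g"
proof -
  note * = assms[unfolded PS_iff]
  show "g \<notin> U11 X \<Longrightarrow> f g = 0" by (rule *[THEN conjunct1, rule_format])
  show "\<exists>n. \<forall>k\<in>congruence_subgroup X n. rtrans k f = f"
    by (rule *[THEN conjunct2, THEN conjunct1])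
  show "t \<noteq> 0 \<Longrightarrow> x \<in> K \<Longrightarrow> g \<in> U11 X \<Longrightarrow>
      f (mat2 t (t * x) 0 (inverse (\<sigma> t)) ** g) = chi t * Q powi (- v t) * f g"
    by (rule *[THEN conjunct2, THEN conjunct2, rule_format])
qed

text \<open>Big Bruhat cell: g is a Borel element times w n(d/c). The torus part of the Borel
  element is \<open>inverse (\<sigma> c)\<close> and its unipotent part is
  \<open>a * \<sigma> c\<close>, which lies in F by the unitary relations.\<close>

lemma PS_row:
  assumes f: "f \<in> PS" and g: "mat2 a b c d \<in> U11 X" and c: "c \<noteq> 0"
  shows "f (mat2 a b c d) = chi (inverse (\<sigma> c)) * Q powi v c * phi f (d / c)"
proof -
  note D = U11_det[OF g]
  have dc: "d / c \<in> K" by (rule U11_ratio[OF g]) auto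
  have "\<sigma> a * ((a * d - b * c) * \<sigma> c) = ((a * d - b * c) * \<sigma> a) * \<sigma> c" by (simp only: mult_ac)
  hence "\<sigma> a * c = a * \<sigma> c" unfolding D(1,3) .
  hence "\<sigma> (a * \<sigma> c) = a * \<sigma> c" by simp
  hence ac: "a * \<sigma> c \<in> K" by (rule iffD1[OF gal_fixed_iff])
  have eq: "c = (a * d - b * c) * \<sigma> c" using D by simp
  have "- inverse (\<sigma> c) + a * (d / c) = b" using eq c by (simp add: field_simps)
  hence m: "mat2 (inverse (\<sigma> c)) (inverse (\<sigma> c) * (a * \<sigma> c)) 0 (inverse (\<sigma> (inverse (\<sigma> c)))) **
      mat2 0 (- 1) 1 (d / c) = mat2 a b c d"
    using c by (simp add: mult.commute[of a] mult.assoc[symmetric])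
  have "mat2 0 (- 1) 1 (d / c) \<in> U11 X" using gal_K[OF dc] by (simp add: U11_iff del: gal_divide)
  then show ?thesis using PS_D(3)[OF f, of "inverse (\<sigma> c)" "a * \<sigma> c" "mat2 0 (- 1) 1 (d / c)"] ac c
    unfolding m phi_mat2 by simp
qed

lemma PS_row0:
  assumes f: "f \<in> PS" and g: "mat2 a b 0 d \<in> U11 X"
  shows "f (mat2 a b 0 d) = chi a * Q powi (- v a) * f (mat 1)" "a \<noteq> 0" "d = inverse (\<sigma> a)" 
proof -
  have ad: "\<sigma> a * d = 1" using g by (simp add: U11_iff)
  then show a: "a \<noteq> 0" "d = inverse (\<sigma> a)" by (auto simp: inverse_unique)
  have "b / a \<in> K" by (rule U11_ratio[OF g]) auto
  then show "f (mat2 a b 0 d) = chi a * Q powi (- v a) * f (mat 1)"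
    using PS_D(3)[OF f a(1), of "b / a" "mat 1"] a by simp
qed

lemma PS_ext:
  assumes "f \<in> PS" "g \<in> PS" "f (mat 1) = g (mat 1)" "\<And>x. x \<in> K \<Longrightarrow> phi f x = phi g x"
  shows "f = g"
proof
  fix m :: "'e^2^2"
  obtain a b c d where m: "m = mat2 a b c d" by (rule mat2_cases)
  show "f m = g m"
  proof (cases "m \<in> U11 X")
    case True
    show ?thesis
    proof (cases "c = 0")
      case True
      then show ?thesis using PS_row0(1)[OF assms(1), of a b d] PS_row0(1)[OF assms(2), of a b d]
          assms(3) \<open>m \<in> U11 X\<close> m by simp
    next
      case False
      have "d / c \<in> K" using True m by (intro U11_ratio[of a b c d]) auto
      then show ?thesis using PS_row[OF assms(1) _ False] PS_row[OF assms(2) _ False] assms(4) True m by simp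
    qed
  qed (use PS_D(1)[OF assms(1)] PS_D(1)[OF assms(2)] in simp)
qed

lemma PS_add:
  assumes "f \<in> PS" "g \<in> PS"
  shows "f + g \<in> PS"
proof -
  obtain n where n: "\<And>k. k \<in> congruence_subgroup X n \<Longrightarrow> rtrans k f = f" using PS_D(2)[OF assms(1)] by blast
  obtain m where m: "\<And>k. k \<in> congruence_subgroup X m \<Longrightarrow> rtrans k g = g" using PS_D(2)[OF assms(2)] by blast
  have "\<forall>k\<in>congruence_subgroup X (max m n). rtrans k (f + g) = f + g"
  proof
    fix k assume "k \<in> congruence_subgroup X (max m n)"
    hence "rtrans k f = f" "rtrans k g = g"
      using n m congruence_antimono[of n "max m n"] congruence_antimono[of m "max m n"] by auto
    then show "rtrans k (f + g) = f + g" by (auto simp: rtrans_def fun_eq_iff)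
  qed
  then show ?thesis using PS_D(1,3)[OF assms(1)] PS_D(1,3)[OF assms(2)]
    unfolding PS_iff by (auto simp: distrib_left intro!: exI[of _ "max m n"])
qed

lemma PS_cscale:
  assumes "f \<in> PS"
  shows "cscale c f \<in> PS"
proof -
  obtain n where n: "\<And>k. k \<in> congruence_subgroup X n \<Longrightarrow> rtrans k f = f" using PS_D(2)[OF assms(1)] by blast
  have "\<forall>k\<in>congruence_subgroup X n. rtrans k (cscale c f) = cscale c f"
    using n by (auto simp: rtrans_def fun_eq_iff cscale_def)
  then show ?thesis using PS_D(1,3)[OF assms] unfolding PS_iff by (auto simp: cscale_def)
qed

lemma PS_0: "0 \<in> PS"
  unfolding PS_iff by (auto simp: rtrans_def)

lemma phi_add [simp]: "phi (f + g) x = phi f x + phi g x"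
  and phi_cscale [simp]: "phi (cscale c f) x = c * phi f x"
  and phi_0 [simp]: "phi 0 x = 0"
  by (auto simp: phi_def cscale_def)

lemma rtrans_add: "rtrans k (f + g) = rtrans k f + rtrans k g"
  and rtrans_cscale: "rtrans k (cscale c f) = cscale c (rtrans k f)"
  by (auto simp: rtrans_def cscale_def fun_eq_iff)

lemma rtrans_rtrans: "rtrans g (rtrans h f) = rtrans (g ** h) f"
  by (auto simp: rtrans_def fun_eq_iff matrix_mul_assoc)

lemma phi_rtrans_unip [simp]: "phi (rtrans (unip y) f) x = phi f (x + y)"
  by (simp add: phi_mat2 rtrans_def unip_def add.commute)

text \<open>Moving the torus element across w n(x) rescales x by a norm. This is how the norm map
  comes to control the functionals \<open>Lam a\<close>.\<close>

lemma phi_rtrans_tdiag: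
  assumes "f \<in> PS" "t \<noteq> 0" "x \<in> K"
  shows "phi (rtrans (tdiag X t) f) x = chi (inverse (\<sigma> t)) * Q powi v t * phi f (x / (t * \<sigma> t))"
proof -
  have e: "phi (rtrans (tdiag X t) f) x = f (mat2 0 (- inverse (\<sigma> t)) t (x * inverse (\<sigma> t)))"
    by (simp add: phi_mat2 rtrans_def tdiag_mat2)
  have "mat2 0 (- inverse (\<sigma> t)) t (x * inverse (\<sigma> t)) \<in> U11 X"
    using assms by (simp add: U11_iff field_simps)
  from PS_row[OF assms(1) this assms(2)] show ?thesis unfolding e by (simp add: divide_inverse mult_ac)
qed

lemma rtrans_tdiag_1:
  assumes "f \<in> PS" "t \<noteq> 0"
  shows "rtrans (tdiag X t) f (mat 1) = chi t * Q powi (- v t) * f (mat 1)"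
  using PS_row0(1)[OF assms(1), of t 0 "inverse (\<sigma> t)"] assms(2)
  by (simp add: rtrans_def tdiag_mat2 U11_iff)

lemma rtrans_unip_1:
  assumes "f \<in> PS" "y \<in> K"
  shows "rtrans (unip y) f (mat 1) = f (mat 1)"
  using PS_row0(1)[OF assms(1), of 1 y 1] assms(2) by (simp add: rtrans_def unip_def U11_iff)

lemma rtrans_weyl_1: "rtrans weyl f (mat 1) = phi f 0"
  by (simp add: rtrans_def phi_mat2 weyl_def)

lemma phi_rtrans_weyl:
  assumes "f \<in> PS" "x \<in> K" 
  shows "x \<noteq> 0 \<Longrightarrow> phi (rtrans weyl f) x = xi x * phi f (- inverse x)"
    "phi (rtrans weyl f) 0 = chi (- 1) * f (mat 1)"
proof -
  have e: "phi (rtrans weyl f) x = f (mat2 (- 1) 0 x (- 1))" for x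
    by (simp add: phi_mat2 rtrans_def weyl_def)
  have u: "mat2 (- 1) 0 x (- 1) \<in> U11 X" if "x \<in> K" for x using that by (simp add: U11_iff)
  show "phi (rtrans weyl f) x = xi x * phi f (- inverse x)" if "x \<noteq> 0"
    using PS_row[OF assms(1) u that] assms(2) unfolding e xi_def by (simp add: divide_inverse)
  show "phi (rtrans weyl f) 0 = chi (- 1) * f (mat 1)"
    using PS_row0(1)[OF assms(1) u[of 0]] unfolding e by simp
qed

lemma ulc_phi [intro]: "f \<in> PS \<Longrightarrow> ulc (phi f)"
proof -
  assume f: "f \<in> PS"
  obtain n where n: "\<And>k. k \<in> congruence_subgroup X n \<Longrightarrow> rtrans k f = f" using PS_D(2)[OF f] by blast
  have "periodic (int n) (phi f)"
  proof (rule periodicI)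
    fix x y assume "x \<in> K" "y \<in> K" "y \<in> P (int n)"
    hence "unip y \<in> congruence_subgroup X n"
      using unip_U11[of y] unfolding unip_def congruence_mat2 by simp
    then show "phi f (x + y) = phi f x" using phi_rtrans_unip[of y f x] n by simp
  qed
  then show ?thesis by (rule ulcI)
qed

definition asymp :: "('e^2^2 \<Rightarrow> complex) \<Rightarrow> int \<Rightarrow> bool" where
  "asymp f R \<longleftrightarrow> (\<forall>x\<in>K. x \<notin> P (- R) \<longrightarrow> phi f x = xi x * f (mat 1))"

text \<open>For large x, w n(x) is a Borel element times the lower unipotent matrix with entry 1/x,
  and the latter lies in a congruence subgroup that fixes f.\<close>

lemma ex_asymp: "f \<in> PS \<Longrightarrow> \<exists>R. asymp f R"
proof -
  assume f: "f \<in> PS"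
  obtain n where n: "\<And>k. k \<in> congruence_subgroup X n \<Longrightarrow> rtrans k f = f" using PS_D(2)[OF f] by blast
  have "phi f x = xi x * f (mat 1)" if x: "x \<in> K" "x \<notin> P (- int n)" for x
  proof -
    have x': "x \<noteq> 0" "v x < - int n" using x by (auto simp: P_iff)
    have "inverse x \<in> P (int n)" using x' by (simp add: P_iff)
    hence k: "mat2 1 0 (inverse x) 1 \<in> congruence_subgroup X n"
      using x by (simp add: congruence_mat2)
    have "phi f x = f (mat2 (inverse x) (inverse x * (- x)) 0 (inverse (\<sigma> (inverse x))) ** mat2 1 0 (inverse x) 1)"
      using x x' by (simp add: phi_mat2)
    also have "\<dots> = chi (inverse x) * Q powi v x * f (mat2 1 0 (inverse x) 1)"
      using x x' by (subst PS_D(3)[OF f]) simp_all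
    also have "f (mat2 1 0 (inverse x) 1) = f (mat 1)"
      using fun_cong[OF n[OF k], of "mat 1"] by (simp add: rtrans_def)
    finally show ?thesis by (simp add: xi_def)
  qed
  then show ?thesis by (auto simp: asymp_def)
qed

lemma xi_mult: "x \<noteq> 0 \<Longrightarrow> y \<noteq> 0 \<Longrightarrow> xi (x * y) = xi x * xi y"
  by (simp add: xi_def chi_mult power_int_add)

lemma xi_nz [simp]: "x \<noteq> 0 \<Longrightarrow> xi x \<noteq> 0"
  by (simp add: xi_def)

lemma xi_one_unit: "chi_trivK m \<Longrightarrow> x \<in> K \<Longrightarrow> x - 1 \<in> P m \<Longrightarrow> xi x = 1"
proof -
  assume a: "chi_trivK m" "x \<in> K" "x - 1 \<in> P m"
  hence "chi x = 1" "x \<noteq> 0 \<and> v x = 0" using one_unit_nz[of x m] by (auto simp: chi_trivK_def)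
  then show ?thesis by (simp add: xi_def chi_inverse)
qed

lemma xi_add:
  assumes "chi_trivK m" "x \<noteq> 0" "u \<in> P (m + v x)" "x \<in> K" "u \<in> K"
  shows "xi (x + u) = xi x"
proof -
  have "u / x \<in> P m" using assms by (cases "u = 0") (auto simp: P_iff)
  hence 1: "(1 + u / x) - 1 \<in> P m" by simp
  hence nz: "1 + u / x \<noteq> 0" using one_unit_nz assms(1) chi_trivK_def by blast
  have "x + u = x * (1 + u / x)" using assms(2) by (simp add: field_simps)
  moreover have "1 + u / x \<in> K" using assms by simp
  ultimately show ?thesis using xi_one_unit[OF assms(1) _ 1] xi_mult[OF assms(2) nz] by simp
qed

subsection \<open>Whittaker functionals\<close>

definition Lam :: "'e \<Rightarrow> ('e^2^2 \<Rightarrow> complex) \<Rightarrow> complex" where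
  "Lam a f = Lambda X \<mu> (\<lambda>x. \<psi> (a * x)) f"

definition trunc :: "int \<Rightarrow> 'e \<Rightarrow> ('e^2^2 \<Rightarrow> complex) \<Rightarrow> complex" where
  "trunc r a f = J (- r) (\<lambda>x. phi f x * \<psi> (- a * x))"

lemma Lam_trunc: "a \<in> K \<Longrightarrow> Lam a f = lim (\<lambda>r::nat. trunc (int r) a f)"
proof -
  assume a: "a \<in> K"
  have "J (- int r) (\<lambda>x. f (weyl ** unip x) * cnj (\<psi> (a * x))) = trunc (int r) a f" for r :: nat
    unfolding trunc_def phi_def[symmetric] using a by (intro J_cong) (simp add: cnj_psi)
  then show ?thesis by (simp add: Lam_def Lambda_def J_def)
qed

lemma ulc_phi_psi: "f \<in> PS \<Longrightarrow> a \<in> K \<Longrightarrow> ulc (\<lambda>x. phi f x * \<psi> (- a * x))"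
  by (intro ulc_mult ulc_phi ulc_psi) auto

text \<open>Translate by u with \<open>v u = - v a - 1\<close> and \<psi> nontrivial at -au. The
  bound \<open>m + v a \<le> r\<close> is exactly what makes u small relative to y + x at level m,
  so that \<open>xi\<close> does not notice the translation.\<close>

lemma shell_vanish:
  assumes f: "f \<in> PS" "asymp f R" and m: "chi_trivK m" and a: "a \<in> K" "a \<noteq> 0"
    and r: "R \<le> r" "m + v a \<le> r" and y: "y \<in> K" "y \<notin> P (- r)"
  shows "J (- r) (\<lambda>x. phi f (y + x) * \<psi> (- a * x)) = 0"
proof -
  have m1: "1 \<le> m" using m by (simp add: chi_trivK_def)
  have "- a \<notin> P (- (- r))" using a r m1 by (simp add: P_iff)
  then obtain u where u: "u \<in> K" "u \<in> P (- r)" "v u = - v (- a) - 1" "\<psi> (- a * u) \<noteq> 1"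
    using psi_nontriv_at[of "- a" "- r"] a by auto
  show ?thesis
  proof (rule J_zero_translate[OF _ u(1,2,4)])
    show "ulc (\<lambda>x. phi f (y + x) * \<psi> (- a * x))"
      using f a y by (intro ulc_mult ulc_translate ulc_phi ulc_psi) auto
    fix x assume x: "x \<in> K" "x \<in> P (- r)"
    have x0: "y + x \<notin> P (- r)" "y + x + u \<notin> P (- r)" using y x u by (auto simp: P_add_iff)
    hence n: "y + x \<notin> P (- R)" "y + x + u \<notin> P (- R)" using r P_mono[of _ "- R" "- r"] by auto
    have nz: "y + x \<noteq> 0" "v (y + x) < - r" using x0 by (auto simp: P_iff)
    hence "u \<in> P (m + v (y + x))" using u(3) r by (simp add: P_iff)
    hence "xi (y + x + u) = xi (y + x)" using xi_add[OF m nz(1)] x(1) y(1) u(1) by simp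
    hence "phi f (y + (x + u)) = phi f (y + x)"
      using f(2) n x y u unfolding asymp_def by (simp add: add.assoc)
    moreover have "\<psi> (- a * (x + u)) = \<psi> (- a * u) * \<psi> (- a * x)"
      using psi_add[of "- a * x" "- a * u"] a x u by (simp add: distrib_left mult.commute)
    ultimately show "phi f (y + (x + u)) * \<psi> (- a * (x + u)) = \<psi> (- a * u) * (phi f (y + x) * \<psi> (- a * x))"
      by simp
  qed
qed

text \<open>Cut the larger ball into cosets of the smaller one: by \<open>shell_vanish\<close> only
  the trivial coset contributes.\<close>

lemma trunc_step:
  assumes f: "f \<in> PS" "asymp f R" and m: "chi_trivK m" and a: "a \<in> K" "a \<noteq> 0"
    and r: "R \<le> r" "m + v a \<le> r"
  shows "trunc (r + 1) a f = trunc r a f"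
proof -
  obtain Y where Y: "reps K (- (r + 1)) (- r) Y" using reps_ex_card[of "- (r + 1)" "- r"] by auto
  note Y' = repsD[OF Y]
  define h where "h = (\<lambda>x. phi f x * \<psi> (- a * x))"
  have uh: "ulc h" unfolding h_def using ulc_phi_psi f a by blast
  define y0 where "y0 = rep_of (- r) Y 0"
  have y0: "y0 \<in> Y" "y0 \<in> P (- r)" using rep_of[OF Y, of 0] by (auto simp: y0_def)
  hence y0K: "y0 \<in> K" using Y' by blast
  have t: "J (- r) (\<lambda>x. h (y + x)) = (if y = y0 then J (- r) h else 0)" if y: "y \<in> Y" for y
  proof (cases "y = y0")
    case True
    then show ?thesis using J_translate[OF uh y0K y0(2)] by (simp add: add.commute)
  next
    case False
    have yK: "y \<in> K" using y Y' by blast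
    have "y \<notin> P (- r)" using Y'(5)[OF y y0(1)] False y0(2) by blast
    hence "J (- r) (\<lambda>x. phi f (y + x) * \<psi> (- a * x)) = 0" using shell_vanish[OF assms yK] by blast
    moreover have "J (- r) (\<lambda>x. h (y + x)) = J (- r) (\<lambda>x. \<psi> (- a * y) * (phi f (y + x) * \<psi> (- a * x)))"
    proof (rule J_cong)
      fix x assume "x \<in> K"
      hence "\<psi> (- a * (y + x)) = \<psi> (- a * y) * \<psi> (- a * x)"
        using psi_add[of "- a * y" "- a * x"] a yK by (simp add: distrib_left)
      then show "h (y + x) = \<psi> (- a * y) * (phi f (y + x) * \<psi> (- a * x))" by (simp add: h_def)
    qed
    ultimately show ?thesis using False by (simp add: J_cmult)
  qed
  have "trunc (r + 1) a f = (\<Sum>y\<in>Y. J (- r) (\<lambda>x. h (y + x)))"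
    using J_split[OF uh Y] by (simp add: trunc_def h_def)
  also have "\<dots> = (\<Sum>y\<in>Y. if y = y0 then J (- r) h else 0)" by (rule sum.cong[OF refl t])
  also have "\<dots> = J (- r) h" using y0 Y' by simp
  finally show ?thesis by (simp add: trunc_def h_def)
qed

text \<open>The limit is eventually constant, and the stage from which it is exact is explicit.
  Concrete values of \<open>Lam\<close> therefore need one truncated integral only.\<close>

lemma Lam_eq:
  assumes f: "f \<in> PS" "asymp f R" and m: "chi_trivK m" and a: "a \<in> K" "a \<noteq> 0"
    and r: "R \<le> r" "m + v a \<le> r"
  shows "Lam a f = trunc r a f"
proof -
  have st: "trunc (r + int k) a f = trunc r a f" for k
  proof (induction k)
    case (Suc k)
    then show ?case using trunc_step[OF f m a, of "r + int k"] r by (simp add: add_ac)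
  qed simp
  have "\<forall>\<^sub>F n in sequentially. trunc (int n) a f = trunc r a f"
    using eventually_ge_at_top[of "nat r"]
  proof eventually_elim
    case (elim n)
    hence "r + int (nat (int n - r)) = int n" by simp
    then show ?case using st[of "nat (int n - r)"] by simp
  qed
  hence "(\<lambda>n::nat. trunc (int n) a f) \<longlonglongrightarrow> trunc r a f" by (rule tendsto_eventually)
  then show ?thesis unfolding Lam_trunc[OF a(1)] by (rule limI)
qed

lemma ex_Lam:
  assumes "f \<in> PS" "a \<in> K" "a \<noteq> 0"
  obtains r0 where "\<And>r. r0 \<le> r \<Longrightarrow> Lam a f = trunc r a f"
proof -
  obtain R m where "asymp f R" "chi_trivK m" using ex_asymp[OF assms(1)] ex_chi_triv chi_triv_imp_chi_trivK by blast
  with Lam_eq[OF assms(1) this assms(2,3)] that[of "max R (m + v a)"] show ?thesis by simp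
qed

lemma Lam_eqI:
  assumes f: "f \<in> PS" "a \<in> K" "a \<noteq> 0" and "\<And>r. r0 \<le> r \<Longrightarrow> trunc r a f = c"
  shows "Lam a f = c"
proof -
  obtain r1 where "\<And>r. r1 \<le> r \<Longrightarrow> Lam a f = trunc r a f" using ex_Lam[OF f] by blast
  with assms(4) show ?thesis by (metis max.cobounded1 max.cobounded2)
qed

lemma trunc_add: "f \<in> PS \<Longrightarrow> g \<in> PS \<Longrightarrow> a \<in> K \<Longrightarrow> trunc r a (f + g) = trunc r a f + trunc r a g"
  using J_add[OF ulc_phi_psi ulc_phi_psi, of f a g a] by (simp add: trunc_def distrib_right)

lemma trunc_cscale: "trunc r a (cscale c f) = c * trunc r a f"
  using J_cmult[of "- r" c] by (simp add: trunc_def mult.assoc)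

lemma Lam_add:
  assumes "f \<in> PS" "g \<in> PS" "a \<in> K" "a \<noteq> 0"
  shows "Lam a (f + g) = Lam a f + Lam a g"
proof -
  obtain r1 where r1: "\<And>r. r1 \<le> r \<Longrightarrow> Lam a f = trunc r a f" using ex_Lam[OF assms(1,3,4)] by blast
  obtain r2 where r2: "\<And>r. r2 \<le> r \<Longrightarrow> Lam a g = trunc r a g" using ex_Lam[OF assms(2,3,4)] by blast
  show ?thesis
    by (rule Lam_eqI[where ?r0.0 = "max r1 r2"]) (use r1 r2 assms in \<open>auto simp: PS_add trunc_add\<close>)
qed

lemma Lam_cscale:
  assumes "f \<in> PS" "a \<in> K" "a \<noteq> 0"
  shows "Lam a (cscale c f) = c * Lam a f"
proof -
  obtain r1 where r1: "\<And>r. r1 \<le> r \<Longrightarrow> Lam a f = trunc r a f" using ex_Lam[OF assms] by blast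
  show ?thesis
    by (rule Lam_eqI[where ?r0.0 = r1]) (use r1 assms in \<open>auto simp: PS_cscale trunc_cscale\<close>)
qed

lemma Lam_unip:
  assumes f: "f \<in> PS" and g: "rtrans (unip y) f \<in> PS" and y: "y \<in> K" and a: "a \<in> K" "a \<noteq> 0"
  shows "Lam a (rtrans (unip y) f) = \<psi> (a * y) * Lam a f"
proof -
  obtain r1 where r1: "\<And>r. r1 \<le> r \<Longrightarrow> Lam a f = trunc r a f" using ex_Lam[OF f a] by blast
  define h where "h = (\<lambda>x. phi f x * \<psi> (- a * x))"
  have uh: "ulc h" unfolding h_def using ulc_phi_psi f a by blast
  show ?thesis
  proof (rule Lam_eqI[where ?r0.0 = "max r1 (- v y)"])
    fix r assume r: "max r1 (- v y) \<le> r"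
    hence yP: "y \<in> P (- r)" by (simp add: P_iff)
    have "trunc r a (rtrans (unip y) f) = J (- r) (\<lambda>x. \<psi> (a * y) * h (x + y))" unfolding trunc_def
    proof (rule J_cong)
      fix x assume x: "x \<in> K"
      have "\<psi> (- a * x) = \<psi> (a * y) * \<psi> (- a * (x + y))"
        using psi_add[of "a * y" "- a * (x + y)"] a x y by (simp add: algebra_simps)
      then show "phi (rtrans (unip y) f) x * \<psi> (- a * x) = \<psi> (a * y) * h (x + y)" by (simp add: h_def)
    qed
    also have "\<dots> = \<psi> (a * y) * J (- r) h" using J_translate[OF uh y yP] by (simp add: J_cmult)
    also have "J (- r) h = Lam a f" using r1[of r] r by (simp add: trunc_def h_def)
    finally show "trunc r a (rtrans (unip y) f) = \<psi> (a * y) * Lam a f" .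
  qed (use g a in auto)
qed

text \<open>Common form of the torus action and of diagonal conjugation: both rescale the coordinate
  x by an element of F.\<close>

lemma Lam_scaled:
  assumes f: "f \<in> PS" and g: "g \<in> PS" and c: "c \<in> K" "c \<noteq> 0" and a: "a \<in> K" "a \<noteq> 0"
    and gf: "\<And>x. x \<in> K \<Longrightarrow> phi g x = k * phi f (x / c)"
  shows "Lam a g = k * Q powi (- v c) * Lam (a * c) f"
proof -
  have ac: "a * c \<in> K" "a * c \<noteq> 0" using a c by auto
  obtain r1 where r1: "\<And>r. r1 \<le> r \<Longrightarrow> Lam (a * c) f = trunc r (a * c) f" using ex_Lam[OF f ac] by blast
  define h where "h = (\<lambda>x. phi f x * \<psi> (- (a * c) * x))"
  have uh: "ulc h" unfolding h_def using ulc_phi_psi[OF f ac(1)] .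
  show ?thesis
  proof (rule Lam_eqI[where ?r0.0 = "r1 - v c"])
    fix r assume r: "r1 - v c \<le> r"
    have "trunc r a g = J (- r) (\<lambda>x. k * h (inverse c * x))" unfolding trunc_def
    proof (rule J_cong)
      fix x assume "x \<in> K"
      then show "phi g x * \<psi> (- a * x) = k * h (inverse c * x)"
        using gf c by (simp add: h_def field_simps)
    qed
    also have "\<dots> = k * (Q powi (- v c) * J (- (r + v c)) h)"
      using J_scale[OF uh, of "inverse c" "- r"] c by (simp add: J_cmult)
    also have "J (- (r + v c)) h = Lam (a * c) f" using r1[of "r + v c"] r by (simp add: trunc_def h_def)
    finally show "trunc r a g = k * Q powi (- v c) * Lam (a * c) f" by simp
  qed (use g a in auto)
qed

lemma Lam_tdiag:
  assumes f: "f \<in> PS" and g: "rtrans (tdiag X t) f \<in> PS" and t: "t \<noteq> 0" and a: "a \<in> K" "a \<noteq> 0"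
  shows "Lam a (rtrans (tdiag X t) f) =
    chi (inverse (\<sigma> t)) * Q powi v t * Q powi (- v (t * \<sigma> t)) * Lam (a * (t * \<sigma> t)) f"
  using phi_rtrans_tdiag[OF f t] t by (intro Lam_scaled[OF f g _ _ a]) auto

subsection \<open>Conjugation by diagonal matrices\<close>

definition dconj :: "'e \<Rightarrow> 'e^2^2 \<Rightarrow> 'e^2^2" where
  "dconj c g = mat2 (g $ 1 $ 1) (g $ 1 $ 2 / c) (g $ 2 $ 1 * c) (g $ 2 $ 2)"

text \<open>For \<open>c = \<pi>\<close> this is conjugation by \<^const>\<open>alpha\<close>: it interchanges the groups \<^const>\<open>Kbar\<close> and
  \<^const>\<open>Kbar'\<close> and moves \<open>\<psi>\<^sub>a\<close> to \<open>\<psi>\<^sub>a\<^sub>\<pi>\<close>, so it exchanges the two parities of \<open>v a\<close>.\<close>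

definition conj_fun :: "'e \<Rightarrow> ('e^2^2 \<Rightarrow> complex) \<Rightarrow> 'e^2^2 \<Rightarrow> complex" where
  "conj_fun c f = (\<lambda>g. f (dconj c g))"

lemma dconj_mat2 [simp]: "dconj c (mat2 x y z w) = mat2 x (y / c) (z * c) w"
  by (simp add: dconj_def)

lemma dconj_mult: "c \<noteq> 0 \<Longrightarrow> dconj c (g ** h) = dconj c g ** dconj c h"
  by (rule mat2_cases[of g], rule mat2_cases[of h]) (simp add: field_simps)

lemma dconj_mat1 [simp]: "dconj c (mat 1) = mat 1"
  by (simp add: mat_mat2)

lemma dconj_dconj: "c \<noteq> 0 \<Longrightarrow> dconj c (dconj (inverse c) g) = g" "c \<noteq> 0 \<Longrightarrow> dconj (inverse c) (dconj c g) = g"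
  by (rule mat2_cases[of g], simp)+

lemma dconj_U11 [simp]: "c \<in> K \<Longrightarrow> c \<noteq> 0 \<Longrightarrow> dconj c g \<in> U11 X \<longleftrightarrow> g \<in> U11 X"
  by (rule mat2_cases[of g]) (simp add: U11_iff)

lemma alpha_conj: "matrix_inv (alpha X) ** g ** alpha X = dconj \<pi> g"
proof -
  have "alpha X ** mat2 (inverse \<pi>) 0 0 1 = mat 1" "mat2 (inverse \<pi>) 0 0 1 ** alpha X = mat 1"
    by (simp_all add: alpha_def mat_mat2)
  moreover from this have "alpha X ** matrix_inv (alpha X) = mat 1"
    unfolding matrix_inv_def by (metis (mono_tags, lifting) someI_ex)
  ultimately have "matrix_inv (alpha X) = mat2 (inverse \<pi>) 0 0 1"
    by (metis matrix_mul_assoc matrix_mul_lid matrix_mul_rid)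
  then show ?thesis by (rule_tac mat2_cases[of g]) (simp add: alpha_def field_simps)
qed

lemma conj_fun_conj_fun: "c \<noteq> 0 \<Longrightarrow> conj_fun c (conj_fun (inverse c) f) = f" "c \<noteq> 0 \<Longrightarrow> conj_fun (inverse c) (conj_fun c f) = f"
  by (simp_all add: conj_fun_def dconj_dconj)

lemma rtrans_conj_fun: "c \<noteq> 0 \<Longrightarrow> rtrans h (conj_fun c f) = conj_fun c (rtrans (dconj c h) f)"
  by (simp add: conj_fun_def rtrans_def dconj_mult)

lemma conj_fun_add: "conj_fun c (f + g) = conj_fun c f + conj_fun c g" and conj_fun_cscale: "conj_fun c (cscale k f) = cscale k (conj_fun c f)"
  and conj_fun_0: "conj_fun c 0 = 0"
  by (auto simp: conj_fun_def cscale_def)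

lemma conj_fun_1: "conj_fun c f (mat 1) = f (mat 1)"
  by (simp add: conj_fun_def)

lemma conj_fun_PS:
  assumes f: "f \<in> PS" and c: "c \<in> K" "c \<noteq> 0"
  shows "conj_fun c f \<in> PS"
  unfolding PS_iff
proof (intro conjI allI impI)
  show "g \<notin> U11 X \<Longrightarrow> conj_fun c f g = 0" for g using PS_D(1)[OF f] c by (simp add: conj_fun_def)
  obtain n where n: "\<And>k. k \<in> congruence_subgroup X n \<Longrightarrow> rtrans k f = f" using PS_D(2)[OF f] by blast
  \<comment> \<open>Conjugation shifts the valuations of the off-diagonal entries by at most |v
    c|.\<close>
  define N where "N = nat (int n + \<bar>v c\<bar>)"
  have "rtrans k (conj_fun c f) = conj_fun c f" if k: "k \<in> congruence_subgroup X N" for k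
  proof -
    obtain x y z w where kk: "k = mat2 x y z w" by (rule mat2_cases)
    have e: "mat2 x y z w \<in> U11 X" "x - 1 \<in> P (int N)" "y \<in> P (int N)" "z \<in> P (int N)" "w - 1 \<in> P (int N)"
      using k unfolding kk congruence_mat2 by auto
    have "x - 1 \<in> P (int n)" "w - 1 \<in> P (int n)" using e P_mono[of _ "int N" "int n"] by (auto simp: N_def)
    moreover have "y / c \<in> P (int n)" using e(3) c by (cases "y = 0") (auto simp: P_iff N_def)
    moreover have "z * c \<in> P (int n)" using e(4) c by (cases "z = 0") (auto simp: P_iff N_def)
    ultimately have "dconj c k \<in> congruence_subgroup X n"
      using dconj_U11[OF c, of "mat2 x y z w"] e(1) unfolding kk dconj_mat2 congruence_mat2 by auto
    then show ?thesis using rtrans_conj_fun[OF c(2)] n by simp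
  qed
  then show "\<exists>n. \<forall>k\<in>congruence_subgroup X n. rtrans k (conj_fun c f) = conj_fun c f" by blast
  fix t x :: 'e and g assume a: "t \<noteq> 0" "x \<in> K" "g \<in> U11 X"
  have "dconj c (mat2 t (t * x) 0 (inverse (\<sigma> t))) = mat2 t (t * (x / c)) 0 (inverse (\<sigma> t))" by simp
  then show "conj_fun c f (mat2 t (t * x) 0 (inverse (\<sigma> t)) ** g) = chi t * Q powi - v t * conj_fun c f g"
    unfolding conj_fun_def dconj_mult[OF c(2)] using PS_D(3)[OF f a(1), of "x / c" "dconj c g"] a c by simp
qed

lemma phi_conj_fun:
  assumes f: "f \<in> PS" and c: "c \<in> K" "c \<noteq> 0" and x: "x \<in> K"
  shows "phi (conj_fun c f) x = xi c * phi f (x / c)"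
proof -
  have "mat2 0 (- (1 / c)) c x \<in> U11 X" using c x by (simp add: U11_iff)
  moreover have "phi (conj_fun c f) x = f (mat2 0 (- (1 / c)) c x)"
    by (simp only: phi_mat2 conj_fun_def dconj_mat2) simp
  ultimately show ?thesis using PS_row[OF f _ c(2), of 0 "- (1 / c)" x] c by (simp add: xi_def)
qed

lemma Lam_conj_fun:
  assumes f: "f \<in> PS" and c: "c \<in> K" "c \<noteq> 0" and a: "a \<in> K" "a \<noteq> 0"
  shows "Lam a (conj_fun c f) = xi c * Q powi (- v c) * Lam (a * c) f"
  using phi_conj_fun[OF f c] by (intro Lam_scaled[OF f conj_fun_PS[OF f c] c a])

subsection \<open>Subrepresentations\<close>

lemma subrepD:
  assumes "subrep X V PS"
  shows "f \<in> V \<Longrightarrow> f \<in> PS" "0 \<in> V" "f \<in> V \<Longrightarrow> g \<in> V \<Longrightarrow> f + g \<in> V" "f \<in> V \<Longrightarrow> cscale c f \<in> V"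
    "f \<in> V \<Longrightarrow> h \<in> U11 X \<Longrightarrow> rtrans h f \<in> V" "f \<in> V \<Longrightarrow> g \<in> V \<Longrightarrow> f - g \<in> V"
    "(\<And>i. i \<in> A \<Longrightarrow> F i \<in> V) \<Longrightarrow> sum F A \<in> V"
proof -
  have 1: "V \<subseteq> PS" and 2: "cfun_subspace V" and 3: "\<forall>h\<in>U11 X. \<forall>f\<in>V. rtrans h f \<in> V"
    using assms unfolding subrep_def by (rule conjunct1, simp_all)
  show "f \<in> V \<Longrightarrow> f \<in> PS" using 1 by blast
  show "f \<in> V \<Longrightarrow> h \<in> U11 X \<Longrightarrow> rtrans h f \<in> V" using 3 by blast
  show "0 \<in> V" by (rule cfun.subspace_0[OF 2])
  show "f \<in> V \<Longrightarrow> g \<in> V \<Longrightarrow> f + g \<in> V" by (rule cfun.subspace_add[OF 2])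
  show "f \<in> V \<Longrightarrow> cscale c f \<in> V" by (rule cfun.subspace_scale[OF 2])
  show "f \<in> V \<Longrightarrow> g \<in> V \<Longrightarrow> f - g \<in> V" by (rule cfun.subspace_diff[OF 2])
  show "(\<And>i. i \<in> A \<Longrightarrow> F i \<in> V) \<Longrightarrow> sum F A \<in> V" by (rule cfun.subspace_sum[OF 2])
qed

lemma phi_sum: "phi (\<Sum>i\<in>A. F i) x = (\<Sum>i\<in>A. phi (F i) x)"
proof (induction A rule: infinite_finite_induct)
  case (insert i A)
  then show ?case by (simp only: sum.insert[OF insert(1,2)] phi_add)
qed (simp_all add: phi_def)

lemma sum_fun_apply: "(\<Sum>i\<in>A. F i) x = (\<Sum>i\<in>A. F i x :: complex)"
  by (induction A rule: infinite_finite_induct) auto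

lemma phi_diff [simp]: "phi (f - g) x = phi f x - phi g x"
  by (simp add: phi_def)

text \<open>f itself need not have compactly supported \<open>phi f\<close>, but the difference of f
  and its translate by n(y) vanishes at 1 and hence near infinity, so Fourier inversion applies to
  the difference.\<close>

lemma phi_const:
  assumes V: "subrep X V PS" and f: "f \<in> V" and z: "\<And>a. a \<in> K \<Longrightarrow> a \<noteq> 0 \<Longrightarrow> Lam a f = 0"
    and y: "y \<in> K"
  shows "phi f y = phi f 0"
proof -
  note VD = subrepD[OF V]
  define g where "g = rtrans (unip y) f - f"
  have fP: "f \<in> PS" and gV: "g \<in> V" and gP: "g \<in> PS" and uP: "rtrans (unip y) f \<in> PS"
    unfolding g_def using VD f y by auto
  obtain r where r: "asymp g r" using ex_asymp[OF gP] by blast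
  have g1: "g (mat 1) = 0" using rtrans_unip_1[OF fP y] by (simp add: g_def)
  have supp: "phi g x = 0" if "x \<in> K" "x \<notin> P (- r)" for x
    using r that g1 by (simp add: asymp_def)
  have "phi g 0 = 0"
  proof (rule fourier_inj[OF ulc_phi[OF gP] supp])
    fix a assume a: "a \<in> K" "a \<noteq> 0"
    have "Lam a g = 0"
    proof -
      have "rtrans (unip y) f = g + f" by (simp add: g_def)
      hence "\<psi> (a * y) * Lam a f = Lam a g + Lam a f"
        using Lam_unip[OF fP uP y a] Lam_add[OF gP fP a] by simp
      then show ?thesis using z[OF a] by simp
    qed
    moreover obtain r1 where r1: "\<And>r. r1 \<le> r \<Longrightarrow> Lam a g = trunc r a g" using ex_Lam[OF gP a] by blast
    moreover have "trunc (max r r1) a g = J (- max r r1) (\<lambda>x. if x \<in> P (- r) then phi g x * \<psi> (- a * x) else 0)"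
      unfolding trunc_def using supp by (intro J_cong) auto
    ultimately show "J (- r) (\<lambda>x. phi g x * \<psi> (- a * x)) = 0"
      using J_restrict[of "- max r r1" "- r" "\<lambda>x. phi g x * \<psi> (- a * x)"] r1[of "max r r1"] by simp
  qed auto
  then show ?thesis by (simp add: g_def)
qed

lemma inf_dim_not_span:
  assumes "infinite_dim V"
  shows "V \<noteq> {cscale c f | c. True}"
proof
  assume "V = {cscale c f | c. True}"
  moreover have "cscale c f \<in> cfun_span {f}" for c
    by (intro cfun.span_scale cfun.span_base) simp
  ultimately have "V \<subseteq> cfun_span {f}" by blast
  then show False using assms unfolding infinite_dim_def by blast
qed

lemma kirillov_inj:
  assumes V: "subrep X V PS" "irreducible_rep X V" "infinite_dim V"
    and f: "f \<in> V" and z: "\<And>a. a \<in> K \<Longrightarrow> a \<noteq> 0 \<Longrightarrow> Lam a f = 0"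
  shows "f = 0"
proof (rule ccontr)
  assume f0: "f \<noteq> 0"
  note VD = subrepD[OF V(1)]
  have fP: "f \<in> PS" using VD f by blast
  define \<kappa> where "\<kappa> = phi f 0"
  have const: "phi f x = \<kappa>" if "x \<in> K" for x
    using phi_const[OF V(1) f z that] by (simp add: \<kappa>_def)
  obtain R where R: "asymp f R" using ex_asymp[OF fP] by blast
  have xiR: "\<kappa> = xi x * f (mat 1)" if "x \<in> K" "x \<notin> P (- R)" for x
    using R const that by (simp add: asymp_def)
  have \<kappa>0: "\<kappa> \<noteq> 0"
  proof
    assume k0: "\<kappa> = 0"
    have "f (mat 1) = 0"
      using xiR[of "\<pi> powi (- R - 1)"] k0 by (simp add: P_iff)
    hence "f = 0" using const k0 by (intro PS_ext[OF fP PS_0]) auto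
    with f0 show False by blast
  qed
  \<comment> \<open>Far out the constant equals \<open>xi x * f (mat 1)\<close> both at x and at xy,
    so the factor \<open>xi y\<close> must be 1.\<close>
  have xi1: "xi y = 1" if y: "y \<in> K" "y \<noteq> 0" for y
  proof -
    define x where "x = \<pi> powi (- R - 1 - \<bar>v y\<bar>)"
    have x: "x \<in> K" "x \<noteq> 0" "v x = - R - 1 - \<bar>v y\<bar>" by (auto simp: x_def)
    have "x \<notin> P (- R)" "x * y \<notin> P (- R)" using x y by (auto simp: P_iff)
    hence "\<kappa> = xi x * f (mat 1)" "\<kappa> = xi (x * y) * f (mat 1)"
      using xiR[of x] xiR[of "x * y"] K_mult[OF x(1) y(1)] x(1) by blast+
    hence "xi x * f (mat 1) = xi (x * y) * f (mat 1)" by (rule trans[OF sym])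
    moreover have "f (mat 1) \<noteq> 0" using xiR[OF x(1) \<open>x \<notin> P (- R)\<close>] \<kappa>0 by auto
    ultimately have "xi x * xi y = xi x" using x y xi_mult[of x y] by simp
    then show ?thesis using xi_nz[OF x(2)] by simp
  qed
  have f1: "f (mat 1) = \<kappa>" using xiR[of "\<pi> powi (- R - 1)"] xi1[of "\<pi> powi (- R - 1)"] by (simp add: P_iff)
  \<comment> \<open>The bottom-row multiplier. It is trivial on F, and ratios of entries lie in F,
    so any nonzero entry of the bottom row may be used to compute f.\<close>
  define m where "m e = chi (inverse (\<sigma> e)) * Q powi v e" for e
  have m_mult: "m (x * y) = m x * m y" if "x \<noteq> 0" "y \<noteq> 0" for x y
    using that by (simp add: m_def chi_mult power_int_add)
  have mK: "m x = 1" if "x \<in> K" "x \<noteq> 0" for x using xi1[OF that] that by (simp add: m_def xi_def)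
  have val: "f g = \<kappa> * m e" if g: "g \<in> U11 X" and e: "e \<noteq> 0" "e = g $ 2 $ 1 \<or> e = g $ 2 $ 2" for g e
  proof -
    obtain a b c d where gg: "g = mat2 a b c d" by (rule mat2_cases)
    have g': "mat2 a b c d \<in> U11 X" and e': "e = c \<or> e = d" using g e gg by auto
    show ?thesis
    proof (cases "c = 0")
      case True
      have u: "mat2 a b 0 d \<in> U11 X" using g' True by simp
      have ed: "e = d" using True e e' by auto
      show ?thesis using PS_row0[OF fP u] f1 unfolding gg True ed by (simp add: m_def)
    next
      case False
      have dc: "d / c \<in> K" "e / c \<in> K" using U11_ratio[OF g'] e' by auto
      have "f g = m c * \<kappa>" using PS_row[OF fP g' False] const[OF dc(1)] by (simp add: gg m_def)
      moreover have "m e = m c" using m_mult[of c "e / c"] mK[OF dc(2)] False e(1) by simp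
      ultimately show ?thesis by simp
    qed
  qed
  \<comment> \<open>Up to the scalar \<tau>, g is a matrix over F, which the multiplier m does not
    see. So g acts on f through m \<tau>.\<close>
  have eig: "\<exists>k. rtrans g f = cscale k f" if g: "g \<in> U11 X" for g
  proof -
    obtain a b c d where gg: "g = mat2 a b c d" by (rule mat2_cases)
    have g': "mat2 a b c d \<in> U11 X" using g gg by simp
    have "a \<noteq> 0 \<or> c \<noteq> 0" using g' by (auto simp: U11_iff)
    then obtain \<tau> where t: "\<tau> \<noteq> 0" "\<tau> = a \<or> \<tau> = c" by blast
    have tK: "a / \<tau> \<in> K" "b / \<tau> \<in> K" "c / \<tau> \<in> K" "d / \<tau> \<in> K"
      using U11_ratio[OF g', of _ \<tau>] t by auto
    have "rtrans g f = cscale (m \<tau>) f"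
    proof
      fix h :: "'e^2^2"
      obtain x y z w where hh: "h = mat2 x y z w" by (rule mat2_cases)
      show "rtrans g f h = cscale (m \<tau>) f h"
      proof (cases "h \<in> U11 X")
        case True
        have h': "mat2 x y z w \<in> U11 X" using True hh by simp
        have hg: "h ** g \<in> U11 X" using U11_mult[OF True g] .
        have "z \<noteq> 0 \<or> w \<noteq> 0" using h' by (auto simp: U11_iff)
        then obtain e where e: "e \<noteq> 0" "e = z \<or> e = w" by blast
        have eK: "z / e \<in> K" "w / e \<in> K" using U11_ratio[OF h', of _ e] e by auto
        have hg': "h ** g = mat2 (x * a + y * c) (x * b + y * d) (z * a + w * c) (z * b + w * d)"
          by (simp add: hh gg)
        have "z * a + w * c \<noteq> 0 \<or> z * b + w * d \<noteq> 0"
          using hg unfolding hg' by (auto simp: U11_iff)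
        then obtain E where E: "E \<noteq> 0" "E = z * a + w * c \<or> E = z * b + w * d" by blast
        define k where "k = E / (e * \<tau>)"
        have "k = (z / e) * (a / \<tau>) + (w / e) * (c / \<tau>) \<or> k = (z / e) * (b / \<tau>) + (w / e) * (d / \<tau>)"
          using E(2) e t by (auto simp: k_def add_divide_distrib)
        moreover have "(z / e) * (a / \<tau>) + (w / e) * (c / \<tau>) \<in> K" "(z / e) * (b / \<tau>) + (w / e) * (d / \<tau>) \<in> K"
          by (rule K_add; rule K_mult; rule eK tK)+
        ultimately have "k \<in> K" by metis
        hence "m E = m e * m \<tau>" using mK[of k] m_mult[of "e * \<tau>" k] m_mult[of e \<tau>] E(1) e(1) t(1)
          by (simp add: k_def)
        moreover have "f (h ** g) = \<kappa> * m E" using val[OF hg E(1)] E(2) by (simp add: hg')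
        moreover have "f h = \<kappa> * m e" using val[OF True e(1)] e(2) by (simp add: hh)
        ultimately show ?thesis by (simp add: rtrans_def cscale_def)
      next
        case False
        then show ?thesis using PS_D(1)[OF fP] U11_mult_iff[OF g] by (simp add: rtrans_def cscale_def)
      qed
    qed
    then show ?thesis by blast
  qed
  define T where "T = {cscale c f | c. True}"
  have "subrep X T V" unfolding subrep_def
  proof (intro conjI ballI)
    show "T \<subseteq> V" using VD f by (auto simp: T_def)
    show "cfun_subspace T" unfolding cfun.subspace_def T_def
    proof (intro conjI ballI allI)
      show "0 \<in> {cscale c f |c. True}" by (auto intro!: exI[of _ 0] simp: cscale_def fun_eq_iff)
      fix x y assume "x \<in> {cscale c f |c. True}" "y \<in> {cscale c f |c. True}"
      then obtain c d where "x = cscale c f" "y = cscale d f" by blast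
      hence "x + y = cscale (c + d) f" by (simp add: cfun.scale_left_distrib)
      then show "x + y \<in> {cscale c f |c. True}" by blast
    next
      fix c x assume "x \<in> {cscale c f |c. True}"
      then obtain d where "x = cscale d f" by blast
      hence "cscale c x = cscale (c * d) f" by simp
      then show "cscale c x \<in> {cscale c f |c. True}" by blast
    qed
    fix g x assume g: "g \<in> U11 X" and "x \<in> T"
    then obtain c where "x = cscale c f" by (auto simp: T_def)
    moreover obtain k where "rtrans g f = cscale k f" using eig[OF g] by blast
    ultimately have "rtrans g x = cscale (c * k) f" by (simp add: rtrans_cscale)
    then show "rtrans g x \<in> T" by (auto simp: T_def)
  qed
  hence "T = {0} \<or> T = V" using V(2) by (simp add: irreducible_rep_def)
  moreover have "f \<in> T" unfolding T_def by (auto intro!: exI[of _ 1])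
  ultimately have "V = T" using f0 by auto
  then show False using inf_dim_not_span[OF V(3), of f] unfolding T_def by blast
qed

subsection \<open>Twisted averaging over the unipotent radical\<close>

text \<open>The sum runs over representatives of P^(-r) modulo a common period. On the ball a change
  of variable produces \<open>Lam a f\<close>; off the ball \<open>shell_vanish\<close> applies. The
  sum is kept in the statement, not just its effect, so that an arbitrary Whittaker functional can
  be evaluated on it term by term.\<close>

lemma twisted_average:
  assumes f: "f \<in> PS" and a: "a \<in> K" "a \<noteq> 0"
  obtains r0 where "\<And>r. r0 \<le> r \<Longrightarrow> \<exists>Y c. finite Y \<and> Y \<noteq> {} \<and> Y \<subseteq> K \<and> c \<noteq> 0 \<and>
    (\<Sum>y\<in>Y. cscale (\<psi> (- a * y)) (rtrans (unip y) f)) (mat 1) = 0 \<and>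
    (\<forall>x\<in>K. phi (\<Sum>y\<in>Y. cscale (\<psi> (- a * y)) (rtrans (unip y) f)) x =
      (if x \<in> P (- r) then c * \<psi> (a * x) * Lam a f else 0))"
proof -
  obtain R m where Rm: "asymp f R" "chi_trivK m" using ex_asymp[OF f] ex_chi_triv chi_triv_imp_chi_trivK by blast
  have m1: "1 \<le> m" using Rm(2) by (simp add: chi_trivK_def)
  define r0 where "r0 = max R (m + v a)"
  have "\<exists>Y c. finite Y \<and> Y \<noteq> {} \<and> Y \<subseteq> K \<and> c \<noteq> 0 \<and>
    (\<Sum>y\<in>Y. cscale (\<psi> (- a * y)) (rtrans (unip y) f)) (mat 1) = 0 \<and>
    (\<forall>x\<in>K. phi (\<Sum>y\<in>Y. cscale (\<psi> (- a * y)) (rtrans (unip y) f)) x =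
      (if x \<in> P (- r) then c * \<psi> (a * x) * Lam a f else 0))" if r: "r0 \<le> r" for r
  proof -
    have r': "R \<le> r" "m + v a \<le> r" using r by (auto simp: r0_def)
    have psiu: "ulc (\<lambda>x. \<psi> (- a * x))" using a by (intro ulc_psi) auto
    obtain n where n: "periodic n (phi f)" "periodic n (\<lambda>x. \<psi> (- a * x))" "- r \<le> n"
      using ulcE2[OF ulc_phi[OF f] psiu, of "- r"] by blast
    obtain Y where Y: "reps K (- r) n Y" using reps_ex_card[OF n(3)] by blast
    note Y' = repsD[OF Y]
    let ?e = "\<Sum>y\<in>Y. cscale (\<psi> (- a * y)) (rtrans (unip y) f)"
    have Qn: "Q powi n * Q powi (- n) = 1" by (simp add: power_int_minus)
    \<comment> \<open>Unipotent translation does not change the value at 1, which is thus multiplied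
      by a sum of a nontrivial character.\<close>
    have J1: "(\<Sum>y\<in>Y. \<psi> (- a * y)) = 0"
    proof -
      have "- a \<notin> P (- (- r))" using a r' m1 by (simp add: P_iff)
      hence "J (- r) (\<lambda>x. \<psi> (- a * x)) = 0" using J_psi[of "- a" "- r"] a by simp
      then show ?thesis using J_reps[OF Y n(2,3)] by simp
    qed
    have "?e (mat 1) = (\<Sum>y\<in>Y. \<psi> (- a * y)) * f (mat 1)"
    proof -
      have "?e (mat 1) = (\<Sum>y\<in>Y. \<psi> (- a * y) * rtrans (unip y) f (mat 1))"
        by (simp add: sum_fun_apply cscale_def)
      also have "\<dots> = (\<Sum>y\<in>Y. \<psi> (- a * y) * f (mat 1))"
        using rtrans_unip_1[OF f] Y'(2) by (intro sum.cong) auto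
      finally show ?thesis by (simp add: sum_distrib_right)
    qed
    moreover have "phi ?e x = (if x \<in> P (- r) then Q powi n * \<psi> (a * x) * Lam a f else 0)" if x: "x \<in> K" for x
    proof -
      have periodic: "periodic n (\<lambda>y. phi f (x + y) * \<psi> (- a * y))"
      proof (rule periodicI)
        fix y z assume "y \<in> K" "z \<in> K" "z \<in> P n"
        then show "phi f (x + (y + z)) * \<psi> (- a * (y + z)) = phi f (x + y) * \<psi> (- a * y)"
          using periodicD[OF n(1), of "x + y" z] periodicD[OF n(2), of y z] x by (simp add: add.assoc)
      qed
      have "phi ?e x = (\<Sum>y\<in>Y. phi f (x + y) * \<psi> (- a * y))"
        by (simp add: phi_sum mult.commute)
      also have "\<dots> = Q powi n * J (- r) (\<lambda>y. phi f (x + y) * \<psi> (- a * y))"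
        using J_reps[OF Y periodic n(3)] Qn by simp
      also have "J (- r) (\<lambda>y. phi f (x + y) * \<psi> (- a * y)) =
          (if x \<in> P (- r) then \<psi> (a * x) * Lam a f else 0)"
      proof (cases "x \<in> P (- r)")
        case True
        let ?h = "\<lambda>x. phi f x * \<psi> (- a * x)"
        have "J (- r) (\<lambda>y. phi f (x + y) * \<psi> (- a * y)) = J (- r) (\<lambda>y. \<psi> (a * x) * ?h (y + x))"
        proof (rule J_cong)
          fix y assume y: "y \<in> K"
          have "\<psi> (- a * y) = \<psi> (a * x) * \<psi> (- a * (y + x))"
            using psi_add[of "a * x" "- a * (y + x)"] a x y by (simp add: algebra_simps)
          then show "phi f (x + y) * \<psi> (- a * y) = \<psi> (a * x) * (phi f (y + x) * \<psi> (- a * (y + x)))"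
            by (simp add: add.commute)
        qed
        also have "\<dots> = \<psi> (a * x) * J (- r) ?h"
          using J_translate[OF ulc_phi_psi[OF f a(1)] x True] by (simp only: J_cmult)
        also have "J (- r) ?h = Lam a f" using Lam_eq[OF f Rm a r'] by (simp add: trunc_def)
        finally show ?thesis using True by simp
      next
        case False
        then show ?thesis using shell_vanish[OF f Rm a r' x False] by simp
      qed
      finally show ?thesis by simp
    qed
    moreover have "Y \<noteq> {}" using rep_of(1)[OF Y, of 0] by auto
    ultimately show ?thesis using J1 Y'(1,2) by (intro exI[of _ Y] exI[of _ "Q powi n"]) auto
  qed
  with that show ?thesis by blast
qed

lemma psi_bump_mem:
  assumes V: "subrep X V PS" and f: "f \<in> V" and a: "a \<in> K" "a \<noteq> 0" and nz: "Lam a f \<noteq> 0"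
  obtains r0 where "\<And>r. r0 \<le> r \<Longrightarrow> \<exists>g\<in>V. g (mat 1) = 0 \<and>
    (\<forall>x\<in>K. phi g x = (if x \<in> P (- r) then \<psi> (a * x) else 0))"
proof -
  note VD = subrepD[OF V]
  have fP: "f \<in> PS" using VD f by blast
  obtain r0 where r0: "\<And>r. r0 \<le> r \<Longrightarrow> \<exists>Y c. finite Y \<and> Y \<noteq> {} \<and> Y \<subseteq> K \<and> c \<noteq> 0 \<and>
    (\<Sum>y\<in>Y. cscale (\<psi> (- a * y)) (rtrans (unip y) f)) (mat 1) = 0 \<and>
    (\<forall>x\<in>K. phi (\<Sum>y\<in>Y. cscale (\<psi> (- a * y)) (rtrans (unip y) f)) x =
      (if x \<in> P (- r) then c * \<psi> (a * x) * Lam a f else 0))"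
    using twisted_average[OF fP a] by blast
  have "\<exists>g\<in>V. g (mat 1) = 0 \<and> (\<forall>x\<in>K. phi g x = (if x \<in> P (- r) then \<psi> (a * x) else 0))"
    if "r0 \<le> r" for r
  proof -
    from r0[OF that] obtain Y c where Y: "Y \<subseteq> K" "c \<noteq> 0" and
      e: "(\<Sum>y\<in>Y. cscale (\<psi> (- a * y)) (rtrans (unip y) f)) (mat 1) = 0"
        "\<forall>x\<in>K. phi (\<Sum>y\<in>Y. cscale (\<psi> (- a * y)) (rtrans (unip y) f)) x =
          (if x \<in> P (- r) then c * \<psi> (a * x) * Lam a f else 0)" by blast
    let ?e = "\<Sum>y\<in>Y. cscale (\<psi> (- a * y)) (rtrans (unip y) f)"
    have "?e \<in> V" using Y VD f by (intro VD(7)) auto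
    hence "cscale (inverse (c * Lam a f)) ?e \<in> V" by (rule VD(4))
    moreover have "cscale (inverse (c * Lam a f)) ?e (mat 1) = 0" unfolding cscale_def[of _ ?e] e(1) by simp
    moreover have "phi (cscale (inverse (c * Lam a f)) ?e) x = (if x \<in> P (- r) then \<psi> (a * x) else 0)"
      if "x \<in> K" for x using e(2) that nz Y(2) unfolding phi_cscale by (simp add: field_simps)
    ultimately show ?thesis by blast
  qed
  with that show ?thesis by blast
qed

text \<open>If \<open>Lam a f = 0\<close> the twisted sum is the zero function, while l takes the
  value l f on each of its terms. So a positive multiple of l f vanishes.\<close>

lemma whittaker_zero:
  assumes V: "subrep X V PS" and l: "whittaker_functional X V (\<lambda>x. \<psi> (a * x)) l"
    and f: "f \<in> V" and a: "a \<in> K" "a \<noteq> 0" and z: "Lam a f = 0"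
  shows "l f = 0"
proof -
  note VD = subrepD[OF V]
  have fP: "f \<in> PS" using VD f by blast
  obtain r0 where r0: "\<And>r. r0 \<le> r \<Longrightarrow> \<exists>Y c. finite Y \<and> Y \<noteq> {} \<and> Y \<subseteq> K \<and> c \<noteq> 0 \<and>
    (\<Sum>y\<in>Y. cscale (\<psi> (- a * y)) (rtrans (unip y) f)) (mat 1) = 0 \<and>
    (\<forall>x\<in>K. phi (\<Sum>y\<in>Y. cscale (\<psi> (- a * y)) (rtrans (unip y) f)) x =
      (if x \<in> P (- r) then c * \<psi> (a * x) * Lam a f else 0))"
    using twisted_average[OF fP a] by blast
  from r0[OF order_refl] obtain Y c where Y: "finite Y" "Y \<noteq> {}" "Y \<subseteq> K" and
      e1: "(\<Sum>y\<in>Y. cscale (\<psi> (- a * y)) (rtrans (unip y) f)) (mat 1) = 0" and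
      e2: "\<forall>x\<in>K. phi (\<Sum>y\<in>Y. cscale (\<psi> (- a * y)) (rtrans (unip y) f)) x =
        (if x \<in> P (- r0) then c * \<psi> (a * x) * Lam a f else 0)" by blast
  have e: "(\<Sum>y\<in>Y. cscale (\<psi> (- a * y)) (rtrans (unip y) f)) (mat 1) = 0"
        "\<And>x. x \<in> K \<Longrightarrow> phi (\<Sum>y\<in>Y. cscale (\<psi> (- a * y)) (rtrans (unip y) f)) x = 0"
    using e1 bspec[OF e2] z by simp_all
  let ?F = "\<lambda>y. cscale (\<psi> (- a * y)) (rtrans (unip y) f)"
  have FV: "?F y \<in> V" if "y \<in> Y" for y using that Y VD f by auto
  have ls: "l (\<Sum>y\<in>B. ?F y) = (\<Sum>y\<in>B. l (?F y))" if "B \<subseteq> Y" for B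
    using finite_subset[OF that Y(1)] that
  proof (induction B rule: finite_induct)
    case empty
    have "l (0 + 0) = l 0 + l 0" using l VD(2) unfolding whittaker_functional_def by blast
    hence "l 0 = 0" by simp
    then show ?case by (simp only: sum.empty)
  next
    case (insert y B)
    have "l (?F y + (\<Sum>y\<in>B. ?F y)) = l (?F y) + l (\<Sum>y\<in>B. ?F y)"
      using l FV insert VD(7)[of B ?F] unfolding whittaker_functional_def by blast
    moreover have "l (\<Sum>y\<in>B. ?F y) = (\<Sum>y\<in>B. l (?F y))"
      by (rule insert.IH) (use insert.prems in blast)
    ultimately show ?case by (simp only: sum.insert[OF insert(1,2)])
  qed
  have "(\<Sum>y\<in>Y. ?F y) \<in> PS" using VD(1) VD(7)[of Y ?F] FV by blast
  hence "(\<Sum>y\<in>Y. ?F y) = 0"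
    by (rule PS_ext[OF _ PS_0]) (simp_all only: e phi_0 zero_fun_apply)
  moreover have "l 0 = 0" using ls[of "{}"] by (simp only: sum.empty empty_subsetI)
  ultimately have "0 = (\<Sum>y\<in>Y. l (?F y))" using ls[of Y] by (simp only: subset_refl)
  also have "\<dots> = (\<Sum>y\<in>Y. l f)"
  proof (rule sum.cong[OF refl])
    fix y assume y: "y \<in> Y"
    hence yK: "y \<in> K" using Y by blast
    have "l (?F y) = \<psi> (- a * y) * l (rtrans (unip y) f)"
      using l VD(5)[OF f unip_U11[OF yK]] unfolding whittaker_functional_def by blast
    also have "l (rtrans (unip y) f) = \<psi> (a * y) * l f"
      using l f yK unfolding whittaker_functional_def by blast
    finally show "l (?F y) = l f" using psi_minus_mult[of "a * y"] a yK by simp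
  qed
  finally show ?thesis using Y by simp
qed

lemma Lam_whittaker:
  assumes V: "subrep X V PS" and a: "a \<in> K" "a \<noteq> 0"
  shows "whittaker_functional X V (\<lambda>x. \<psi> (a * x)) (Lam a)"
  unfolding whittaker_functional_def
  using subrepD[OF V] Lam_add Lam_cscale Lam_unip a by auto

lemma generic_iff:
  assumes V: "subrep X V PS" and a: "a \<in> K" "a \<noteq> 0"
  shows "generic X V (\<lambda>x. \<psi> (a * x)) \<longleftrightarrow> (\<exists>f\<in>V. Lam a f \<noteq> 0)"
  using whittaker_zero[OF V _ _ a] Lam_whittaker[OF V a] unfolding generic_def by blast

subsection \<open>Central characters\<close>

lemma E1_D: "z \<in> E1 X \<Longrightarrow> z \<noteq> 0 \<and> v z = 0 \<and> inverse (\<sigma> z) = z"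
proof -
  assume "z \<in> E1 X"
  hence e: "z * \<sigma> z = 1" by (simp add: E1_def)
  hence nz: "z \<noteq> 0" by auto
  then show ?thesis using e v_norm[OF nz] by (simp add: field_simps inverse_unique)
qed

lemma central_char_eq:
  assumes V: "subrep X V PS" "V \<noteq> {0}" and z: "z \<in> E1 X"
  shows "central_char X V z = chi z"
proof -
  note zz = E1_D[OF z]
  obtain f where f: "f \<in> V" "f \<noteq> 0" using subrepD(2)[OF V(1)] V(2) by blast
  have eq: "rtrans (mat z) f = cscale (chi z) f" if "f \<in> PS" for f
  proof
    fix h :: "'e^2^2"
    have mz: "mat z \<in> U11 X" using zz by (auto simp: mat_mat2 U11_iff field_simps)
    have "h ** mat z = mat2 z (z * 0) 0 (inverse (\<sigma> z)) ** h"
      using zz by (rule_tac mat2_cases[of h]) (simp add: mat_mat2 mult.commute)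
    then show "rtrans (mat z) f h = cscale (chi z) f h"
      using PS_D(3)[OF that, of z 0 h] PS_D(1)[OF that] zz U11_mult_iff[OF mz, of h]
      by (cases "h \<in> U11 X") (auto simp: rtrans_def cscale_def)
  qed
  show ?thesis unfolding central_char_def
  proof (rule the_equality)
    show "\<forall>f\<in>V. rtrans (mat z) f = cscale (chi z) f" using eq subrepD(1)[OF V(1)] by blast
    fix c assume "\<forall>f\<in>V. rtrans (mat z) f = cscale c f"
    hence "cscale c f = cscale (chi z) f" using eq[OF subrepD(1)[OF V(1) f(1)]] f(1) by simp
    then show "c = chi z" using f(2) by (simp add: cfun.scale_right_imp_eq)
  qed
qed

lemma OE_units_iff: "x \<in> OE_units X \<longleftrightarrow> x \<noteq> 0 \<and> v x = 0"
  by (simp add: int_units_def)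

lemma OF_units_iff: "x \<in> OF_units X \<longleftrightarrow> x \<in> K \<and> x \<noteq> 0 \<and> v x = 0"
  by (simp add: int_units_def)

text \<open>Supplies a concrete candidate in the minimum over all \<eta> that defines the
  conductor.\<close>

lemma compat_chi:
  assumes V: "subrep X V PS" "V \<noteq> {0}"
  shows "eta_compatible X V chi"
proof -
  have "continuous_map (subtopology (val_top UNIV v) (OE_units X)) euclidean chi"
    by (rule continuous_map_from_subtopology_mono[of _ "UNIV - {0}"])
      (use chi_char in \<open>auto simp: is_char_def OE_units_iff\<close>)
  then show ?thesis unfolding eta_compatible_def is_char_def
    using central_char_eq[OF V] by (auto simp: OE_units_iff chi_mult)
qed

lemma eta_char_1: "is_char X (OE_units X) \<eta> \<Longrightarrow> \<eta> 1 = 1"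
proof -
  assume a: "is_char X (OE_units X) \<eta>"
  have "1 \<in> OE_units X" by (simp add: OE_units_iff)
  hence "\<eta> (1 * 1) = \<eta> 1 * \<eta> 1" "\<eta> 1 \<noteq> 0" using a unfolding is_char_def by blast+
  then show ?thesis by simp
qed

subsection \<open>Vectors fixed by the maximal compact subgroups\<close>

text \<open>Triviality on the units of F only: chi may still be ramified on E, as it is in
  (i).\<close>

definition unram_chi :: bool where "unram_chi \<longleftrightarrow> (\<forall>u\<in>OF_units X. chi u = 1)"

text \<open>The multiplier of \<open>f\<close> when the bottom row of its argument is scaled by \<open>e\<close>.\<close>

definition rowfac :: "'e \<Rightarrow> complex" where "rowfac e = chi (inverse (\<sigma> e)) * Q powi v e"

lemma rowfac_mult: "x \<noteq> 0 \<Longrightarrow> y \<noteq> 0 \<Longrightarrow> rowfac (x * y) = rowfac x * rowfac y"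
  by (simp add: rowfac_def chi_mult power_int_add)

lemma rowfac_nz [simp]: "x \<noteq> 0 \<Longrightarrow> rowfac x \<noteq> 0"
  by (simp add: rowfac_def)

lemma rowfac_1 [simp]: "rowfac 1 = 1"
  by (simp add: rowfac_def)

lemma rowfac_K: "x \<in> K \<Longrightarrow> rowfac x = xi x"
  by (simp add: rowfac_def xi_def)

lemma rowfac_unit: "v x = 0 \<Longrightarrow> rowfac x = chi (inverse (\<sigma> x))"
  by (simp add: rowfac_def)

lemma unram_chi_unit: "unram_chi \<Longrightarrow> u \<in> K \<Longrightarrow> u \<noteq> 0 \<Longrightarrow> v u = 0 \<Longrightarrow> rowfac u = 1"
  unfolding unram_chi_def rowfac_def by (simp add: OF_units_iff chi_inverse)

text \<open>The norm of a unit is a unit of F, so chi is 1 on it.\<close>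

lemma unram_chi_chi: "unram_chi \<Longrightarrow> u \<noteq> 0 \<Longrightarrow> v u = 0 \<Longrightarrow> chi u = rowfac u"
proof -
  assume a: "unram_chi" "u \<noteq> 0" "v u = 0"
  have "chi (u * \<sigma> u) = 1" using a unfolding unram_chi_def by (auto simp: OF_units_iff simp del: gal_mult)
  hence "chi (\<sigma> u) * chi u = 1" using a by (simp add: chi_mult mult.commute)
  hence "inverse (chi (\<sigma> u)) = chi u" by (rule inverse_unique)
  then show ?thesis using a by (simp add: rowfac_def chi_inverse)
qed

lemma unram_chi_xi: "unram_chi \<Longrightarrow> x \<in> K \<Longrightarrow> x \<noteq> 0 \<Longrightarrow> xi x = (chi \<pi> / Q) powi (- v x)"
proof -
  assume a: "unram_chi" "x \<in> K" "x \<noteq> 0"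
  define u where "u = x / \<pi> powi v x"
  have u: "u \<in> K" "u \<noteq> 0" "v u = 0" using a by (auto simp: u_def)
  have x: "x = u * \<pi> powi v x" by (simp add: u_def)
  have "xi x = xi u * xi (\<pi> powi v x)" using xi_mult[of u "\<pi> powi v x"] u x by simp
  also have "xi u = 1" using unram_chi_unit[OF a(1) u] rowfac_K u by simp
  also have "xi (\<pi> powi v x) = inverse (chi \<pi> powi v x) * Q powi v x"
    by (simp add: xi_def chi_inverse chi_power_int)
  also have "\<dots> = (chi \<pi> / Q) powi (- v x)"
    by (simp add: power_int_divide_distrib power_int_minus) (simp add: divide_inverse mult.commute)
  finally show ?thesis by simp
qed

lemma unram_chi_trivK: "unram_chi \<Longrightarrow> chi_trivK 1"
  unfolding chi_trivK_def
proof (intro conjI ballI impI)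
  fix x assume "unram_chi" "x \<in> K" "x - 1 \<in> P 1"
  then show "chi x = 1" using one_unit_nz[of x 1] by (simp add: unram_chi_def OF_units_iff)
qed simp

text \<open>The spherical vector: the multiplier of a bottom-row entry of least valuation. When both
  entries qualify their ratio is a unit of F, and under \<open>unram_chi\<close> the choice does not
  matter.\<close>

definition F0 :: "'e^2^2 \<Rightarrow> complex" where
  "F0 g = (if g \<in> U11 X then
     rowfac (if g $ 2 $ 2 \<noteq> 0 \<and> (g $ 2 $ 1 = 0 \<or> v (g $ 2 $ 2) < v (g $ 2 $ 1)) then g $ 2 $ 2 else g $ 2 $ 1)
     else 0)"

text \<open>l is a greatest common divisor of the bottom row. With it \<open>F0\<close> is computed
  without asking which entry has least valuation.\<close>

definition prim :: "'e \<Rightarrow> 'e \<Rightarrow> 'e \<Rightarrow> bool" where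
  "prim l c d \<longleftrightarrow> l \<noteq> 0 \<and> c / l \<in> K \<and> d / l \<in> K \<and> c / l \<in> P 0 \<and> d / l \<in> P 0 \<and>
     \<not> (c / l \<in> P 1 \<and> d / l \<in> P 1)"

lemma F0_prim:
  assumes unram_chi and g: "mat2 a b c d \<in> U11 X" and l: "prim l c d"
  shows "F0 (mat2 a b c d) = rowfac l"
proof -
  define e where "e = (if d \<noteq> 0 \<and> (c = 0 \<or> v d < v c) then d else c)"
  have "v e = v l" "e \<noteq> 0" "e / l \<in> K"
    using l by (auto simp: prim_def e_def P_iff)
  moreover have "rowfac e = rowfac l * rowfac (e / l)" using rowfac_mult[of l "e / l"] calculation l by (auto simp: prim_def)
  ultimately have "rowfac e = rowfac l" using unram_chi_unit[OF assms(1), of "e / l"] l by (simp add: prim_def)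
  then show ?thesis using g by (simp only: F0_def e_def mat2_nth if_True)
qed

lemma ex_prim:
  assumes g: "mat2 a b c d \<in> U11 X"
  obtains l where "prim l c d"
proof -
  define e where "e = (if d \<noteq> 0 \<and> (c = 0 \<or> v d < v c) then d else c)"
  have "c \<noteq> 0 \<or> d \<noteq> 0" using g by (auto simp: U11_iff)
  hence "e \<noteq> 0" by (auto simp: e_def)
  moreover have "c / e \<in> K" "d / e \<in> K" using U11_ratio[OF g, of _ e] by (auto simp: e_def)
  moreover have "c / e \<in> P 0" "d / e \<in> P 0" "\<not> (c / e \<in> P 1 \<and> d / e \<in> P 1)"
    using \<open>e \<noteq> 0\<close> by (cases "c = 0"; cases "d = 0"; auto simp: e_def P_iff)+
  ultimately have "prim e c d" by (simp add: prim_def)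
  with that show ?thesis by blast
qed

lemma U11_int_det:
  assumes "mat2 x y z w \<in> U11 X"
  shows "v (x * w - y * z) = 0"
proof -
  let ?D = "x * w - y * z"
  have D: "?D \<noteq> 0" "?D * \<sigma> x = x" "?D * \<sigma> z = z" using U11_det[OF assms] by auto
  have "x \<noteq> 0 \<or> z \<noteq> 0" using assms by (auto simp: U11_iff)
  then show ?thesis using D v_mult[of ?D "\<sigma> x"] v_mult[of ?D "\<sigma> z"] by auto
qed

text \<open>Division by the unit entry \<tau> turns the matrix into one over O_F with unit
  determinant, and such a matrix preserves primitive rows.\<close>

lemma prim_mult:
  assumes l: "prim l c d" and k: "mat2 x y z w \<in> U11 X" "x \<in> P 0" "y \<in> P 0" "z \<in> P 0" "w \<in> P 0"
    and t: "\<tau> \<in> {x, y, z, w}" "\<tau> \<noteq> 0" "v \<tau> = 0"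
  shows "prim (l * \<tau>) (c * x + d * z) (c * y + d * w)"
proof -
  define C D where "C = c / l" and "D = d / l"
  define x' y' z' w' where "x' = x / \<tau>" and "y' = y / \<tau>" and "z' = z / \<tau>" and "w' = w / \<tau>"
  have l0: "l \<noteq> 0" and CD: "C \<in> K" "D \<in> K" "C \<in> P 0" "D \<in> P 0" "\<not> (C \<in> P 1 \<and> D \<in> P 1)"
    using l by (auto simp: prim_def C_def D_def)
  have kK: "x' \<in> K" "y' \<in> K" "z' \<in> K" "w' \<in> K"
    using U11_ratio[OF k(1) _ t(1)] by (auto simp: x'_def y'_def z'_def w'_def)
  have div: "u / \<tau> \<in> P 0" if "u \<in> P 0" for u using that t by (cases "u = 0") (auto simp: P_iff)
  have kP: "x' \<in> P 0" "y' \<in> P 0" "z' \<in> P 0" "w' \<in> P 0"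
    using div k by (auto simp: x'_def y'_def z'_def w'_def)
  have e1: "(c * x + d * z) / (l * \<tau>) = C * x' + D * z'" and e2: "(c * y + d * w) / (l * \<tau>) = C * y' + D * w'"
    using l0 t by (auto simp: C_def D_def x'_def y'_def z'_def w'_def add_divide_distrib)
  have P0: "C * x' + D * z' \<in> P 0" "C * y' + D * w' \<in> P 0"
    using CD kP P_mult'[of _ 0 _ 0 0] by auto
  have "\<not> (C * x' + D * z' \<in> P 1 \<and> C * y' + D * w' \<in> P 1)"
  proof
    assume a: "C * x' + D * z' \<in> P 1 \<and> C * y' + D * w' \<in> P 1"
    let ?\<Delta> = "x' * w' - y' * z'"
    have dD: "?\<Delta> = (x * w - y * z) / (\<tau> * \<tau>)" using t by (simp add: x'_def y'_def z'_def w'_def diff_divide_distrib)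
    have nz: "x * w - y * z \<noteq> 0" using U11_det(5)[OF k(1)] .
    have dnz: "?\<Delta> \<noteq> 0" "v ?\<Delta> = 0" unfolding dD using nz t U11_int_det[OF k(1)] by auto
    have "(C * x' + D * z') * w' - (C * y' + D * w') * z' \<in> P 1"
      using a kP P_mult'[of _ 1 _ 0 1] by (intro P_diff) auto
    hence 1: "C * ?\<Delta> \<in> P 1" by (simp add: algebra_simps)
    have "(C * y' + D * w') * x' - (C * x' + D * z') * y' \<in> P 1"
      using a kP P_mult'[of _ 1 _ 0 1] by (intro P_diff) auto
    hence 2: "D * ?\<Delta> \<in> P 1" by (simp add: algebra_simps)
    have "C \<in> P 1" using 1 dnz by (cases "C = 0") (auto simp: P_iff)
    moreover have "D \<in> P 1" using 2 dnz by (cases "D = 0") (auto simp: P_iff)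
    ultimately show False using CD(5) by blast
  qed
  then show ?thesis unfolding prim_def e1 e2 using l0 t(2) P0 CD(1,2) kK by simp
qed

lemma F0_rtrans:
  assumes unram_chi and k: "mat2 x y z w \<in> U11 X" "x \<in> P 0" "y \<in> P 0" "z \<in> P 0" "w \<in> P 0"
    and t: "\<tau> \<in> {x, y, z, w}" "\<tau> \<noteq> 0" "v \<tau> = 0"
  shows "rtrans (mat2 x y z w) F0 = cscale (rowfac \<tau>) F0"
proof
  fix g :: "'e^2^2"
  obtain a b c d where g: "g = mat2 a b c d" by (rule mat2_cases)
  show "rtrans (mat2 x y z w) F0 g = cscale (rowfac \<tau>) F0 g"
  proof (cases "g \<in> U11 X")
    case True
    then obtain l where l: "prim l c d" using ex_prim g by blast
    have "g ** mat2 x y z w \<in> U11 X" using U11_mult[OF True k(1)] .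
    hence "F0 (g ** mat2 x y z w) = rowfac (l * \<tau>)"
      using F0_prim[OF assms(1) _ prim_mult[OF l k t]] unfolding g mat2_mult by blast
    moreover have "F0 g = rowfac l" using F0_prim[OF assms(1) _ l] True unfolding g by blast
    moreover have "l \<noteq> 0" using l by (simp add: prim_def)
    ultimately show ?thesis using t by (simp add: rtrans_def cscale_def rowfac_mult mult.commute)
  next
    case False
    then show ?thesis using U11_mult_iff[OF k(1)] by (simp add: rtrans_def cscale_def F0_def)
  qed
qed

lemma F0_borel:
  assumes unram_chi "t \<noteq> 0" "x \<in> K" "g \<in> U11 X"
  shows "F0 (mat2 t (t * x) 0 (inverse (\<sigma> t)) ** g) = chi t * Q powi (- v t) * F0 g"
proof -
  obtain a b c d where g: "g = mat2 a b c d" by (rule mat2_cases)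
  obtain l where l: "prim l c d" using ex_prim assms(4) g by blast
  have "prim (inverse (\<sigma> t) * l) (inverse (\<sigma> t) * c) (inverse (\<sigma> t) * d)"
    using l assms(2) by (simp add: prim_def)
  moreover have "mat2 t (t * x) 0 (inverse (\<sigma> t)) \<in> U11 X" using assms by (simp add: U11_iff)
  hence "mat2 t (t * x) 0 (inverse (\<sigma> t)) ** g \<in> U11 X" using U11_mult assms(4) by blast
  ultimately have "F0 (mat2 t (t * x) 0 (inverse (\<sigma> t)) ** g) = rowfac (inverse (\<sigma> t) * l)"
    using F0_prim[OF assms(1)] unfolding g by simp
  also have "\<dots> = rowfac (inverse (\<sigma> t)) * rowfac l" using rowfac_mult l assms(2) by (simp add: prim_def)
  also have "rowfac l = F0 g" using F0_prim[OF assms(1) _ l] assms(4) g by simp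
  finally show ?thesis using assms(2) by (simp add: rowfac_def)
qed

lemma congr_rowfac: 
  assumes "chi_triv m" "m \<le> int n" "x - 1 \<in> P (int n)"
  shows "rowfac x = 1" "x \<noteq> 0" "v x = 0" "x \<in> P 0"
proof -
  have m1: "1 \<le> m" using assms(1) by (simp add: chi_triv_def)
  show x: "x \<noteq> 0" "v x = 0" using one_unit_nz[OF assms(3)] m1 assms(2) by auto
  then show "x \<in> P 0" by (simp add: P_iff)
  have "\<sigma> (x - 1) \<in> P (int n)" using gal_P_iff assms(3) by blast
  hence "\<sigma> x - 1 \<in> P m" using assms(2) P_mono by simp
  hence "chi (\<sigma> x) = 1" using assms(1) by (simp add: chi_triv_def)
  then show "rowfac x = 1" using x by (simp add: rowfac_unit chi_inverse)
qed

lemma ex_congr_level: obtains n :: nat and m where "chi_triv m" "m \<le> int n"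
  using ex_chi_triv by (metis nat_le_iff order_refl)

lemma F0_PS: assumes unram_chi shows "F0 \<in> PS"
  unfolding PS_iff
proof (intro conjI allI impI)
  obtain n :: nat and m where m: "chi_triv m" "m \<le> int n" by (rule ex_congr_level)
  have "rtrans k F0 = F0" if k: "k \<in> congruence_subgroup X n" for k
  proof -
    obtain x y z w where kk: "k = mat2 x y z w" by (rule mat2_cases)
    have e: "mat2 x y z w \<in> U11 X" "x - 1 \<in> P (int n)" "y \<in> P (int n)" "z \<in> P (int n)" "w - 1 \<in> P (int n)"
      using k unfolding kk congruence_mat2 by auto
    note X = congr_rowfac[OF m e(2)] congr_rowfac[OF m e(5)]
    have "y \<in> P 0" "z \<in> P 0" using e(3,4) P_mono[of _ "int n" 0] by auto
    then show ?thesis using F0_rtrans[OF assms e(1), of x] X unfolding kk by (simp add: cscale_def)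
  qed
  then show "\<exists>n. \<forall>k\<in>congruence_subgroup X n. rtrans k F0 = F0" by blast
  show "g \<notin> U11 X \<Longrightarrow> F0 g = 0" for g by (simp add: F0_def)
qed (rule F0_borel[OF assms])

lemma F0_1 [simp]: "F0 (mat 1) = 1"
  using mat1_U11 by (simp add: F0_def mat_mat2)

lemma F0_nz: "F0 \<noteq> 0"
  using F0_1 by (metis zero_fun_apply zero_neq_one)

lemma SL2OF_mat2: "mat2 x y z w \<in> SL2OF X \<longleftrightarrow>
    x \<in> K \<and> y \<in> K \<and> z \<in> K \<and> w \<in> K \<and> x \<in> P 0 \<and> y \<in> P 0 \<and> z \<in> P 0 \<and> w \<in> P 0 \<and> x * w - y * z = 1"
  by (auto simp: SL2OF_def forall_2 PF_iff)

lemma SL2OF_U11: "k \<in> SL2OF X \<Longrightarrow> k \<in> U11 X"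
  by (rule mat2_cases[of k]) (auto simp: SL2OF_mat2 U11_iff)

lemma F0_fixed:
  assumes unram_chi "k \<in> SL2OF X"
  shows "rtrans k F0 = F0"
proof -
  obtain x y z w where kk: "k = mat2 x y z w" by (rule mat2_cases)
  have k: "x \<in> K" "y \<in> K" "z \<in> K" "w \<in> K" "x \<in> P 0" "y \<in> P 0" "z \<in> P 0" "w \<in> P 0" "x * w - y * z = 1"
    using assms(2) unfolding kk SL2OF_mat2 by auto
  have "\<exists>\<tau>\<in>{x, y, z, w}. \<tau> \<notin> P 1"
  proof (rule ccontr)
    assume "\<not> ?thesis"
    hence "x * w - y * z \<in> P 1" using P_mult'[of x 1 w 1 1] P_mult'[of y 1 z 1 1] by (intro P_diff) auto
    then show False using k(9) by simp
  qed
  then obtain \<tau> where t: "\<tau> \<in> {x, y, z, w}" "\<tau> \<notin> P 1" by blast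
  have t': "\<tau> \<noteq> 0" "v \<tau> = 0" "\<tau> \<in> K" using t k by (auto simp: P_iff)
  have "rtrans (mat2 x y z w) F0 = cscale (rowfac \<tau>) F0"
    using F0_rtrans[OF assms(1) _ k(5-8) t(1) t'(1,2)] SL2OF_U11[OF assms(2)] unfolding kk by blast
  then show ?thesis using unram_chi_unit[OF assms(1) t'(3,1,2)] by (simp add: kk cscale_def)
qed

lemma F0_tdiag:
  assumes unram_chi "t \<in> OE_units X"
  shows "rtrans (tdiag X t) F0 = cscale (rowfac (inverse (\<sigma> t))) F0"
proof -
  have t: "t \<noteq> 0" "v t = 0" using assms(2) by (auto simp: OE_units_iff)
  have "mat2 t 0 0 (inverse (\<sigma> t)) \<in> U11 X" using t by (simp add: U11_iff)
  then show ?thesis using F0_rtrans[OF assms(1), of t 0 0 "inverse (\<sigma> t)" "inverse (\<sigma> t)"] t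
    by (simp add: tdiag_mat2 P_iff)
qed

lemma lower_decomp: "(x::'e) \<noteq> 0 \<Longrightarrow> mat2 0 (- 1) 1 x = mat2 (inverse x) (- 1) 0 x ** mat2 1 0 (inverse x) 1"
  by simp

lemma phi_lower:
  assumes f: "f \<in> PS" and x: "x \<in> K" "x \<noteq> 0"
  shows "phi f x = xi x * rtrans (mat2 1 0 (inverse x) 1) f (mat 1)"
proof -
  have "phi f x = f (mat2 (inverse x) (inverse x * (- x)) 0 (inverse (\<sigma> (inverse x))) ** mat2 1 0 (inverse x) 1)"
    unfolding phi_mat2 using lower_decomp[OF x(2)] x by simp
  also have "\<dots> = chi (inverse x) * Q powi v x * f (mat2 1 0 (inverse x) 1)"
    using x by (subst PS_D(3)[OF f]) simp_all
  finally show ?thesis by (simp add: xi_def rtrans_def)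
qed

text \<open>For integral x the matrix w n(x) lies in SL_2(O_F); otherwise the lower unipotent matrix
  with entry 1/x does.\<close>

lemma fixed_phi:
  assumes f: "f \<in> PS" and fx: "\<And>k. k \<in> SL2OF X \<Longrightarrow> rtrans k f = f" and x: "x \<in> K"
  shows "phi f x = (if x \<in> P 0 then f (mat 1) else xi x * f (mat 1))"
proof (cases "x \<in> P 0")
  case True
  have "mat2 0 (- 1) 1 x \<in> SL2OF X" using True x by (simp add: SL2OF_mat2)
  from fun_cong[OF fx[OF this], of "mat 1"] show ?thesis using True by (simp add: rtrans_def phi_mat2)
next
  case False
  hence x0: "x \<noteq> 0" "inverse x \<in> P 0" by (auto simp: P_iff)
  hence "mat2 1 0 (inverse x) 1 \<in> SL2OF X" using x by (simp add: SL2OF_mat2)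
  from fx[OF this] show ?thesis using False phi_lower[OF f x x0(1)] by simp
qed

lemma fixed_eq_F0:
  assumes unram_chi and f: "f \<in> PS" and fx: "\<And>k. k \<in> SL2OF X \<Longrightarrow> rtrans k f = f"
  shows "f = cscale (f (mat 1)) F0"
proof (rule PS_ext[OF f PS_cscale[OF F0_PS[OF assms(1)]]])
  show "f (mat 1) = cscale (f (mat 1)) F0 (mat 1)" by (simp add: cscale_def)
  fix x assume "x \<in> K"
  then show "phi f x = phi (cscale (f (mat 1)) F0) x"
    using fixed_phi[OF f fx] fixed_phi[OF F0_PS[OF assms(1)] F0_fixed[OF assms(1)]] by simp
qed

text \<open>Stage 1 is already exact. On the shell \<open>v x = - 1\<close> the function
  \<open>xi\<close> is the constant \<open>chi \<pi> / Q\<close>, and \<psi> integrates to 0 over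
  P^(-1), so the shell contributes the negative of the contribution that the same constant would
  make on O_F.\<close>

lemma Lam_1_shape:
  assumes unram_chi and f: "f \<in> PS" and phi: "\<And>x. x \<in> K \<Longrightarrow> phi f x = (if x \<in> P 0 then \<beta> else xi x * f (mat 1))"
  shows "Lam 1 f = \<beta> - chi \<pi> / Q * f (mat 1)"
proof -
  have as: "asymp f 0" unfolding asymp_def using phi by auto
  have "Lam 1 f = trunc 1 1 f"
    by (rule Lam_eq[OF f as unram_chi_trivK[OF assms(1)]]) auto
  also have "\<dots> = J (- 1) (\<lambda>x. chi \<pi> / Q * f (mat 1) * \<psi> (- 1 * x) + (if x \<in> P 0 then (\<beta> - chi \<pi> / Q * f (mat 1)) * \<psi> (- 1 * x) else 0))"
    unfolding trunc_def
  proof (rule J_cong)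
    fix x assume x: "x \<in> K" "x \<in> P (- 1)"
    show "phi f x * \<psi> (- 1 * x) = chi \<pi> / Q * f (mat 1) * \<psi> (- 1 * x) +
        (if x \<in> P 0 then (\<beta> - chi \<pi> / Q * f (mat 1)) * \<psi> (- 1 * x) else 0)"
    proof (cases "x \<in> P 0")
      case False
      hence "x \<noteq> 0" "v x = - 1" using x by (auto simp: P_iff)
      then show ?thesis using phi[OF x(1)] False unram_chi_xi[OF assms(1) x(1)] by simp
    qed (use phi x in \<open>simp add: algebra_simps\<close>)
  qed
  also have "\<dots> = J (- 1) (\<lambda>x. chi \<pi> / Q * f (mat 1) * \<psi> (- 1 * x)) +
      J (- 1) (\<lambda>x. if x \<in> P 0 then (\<beta> - chi \<pi> / Q * f (mat 1)) * \<psi> (- 1 * x) else 0)"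
    by (intro J_add ulc_if_P ulc_mult ulc_psi ulc_const) auto
  also have "J (- 1) (\<lambda>x. chi \<pi> / Q * f (mat 1) * \<psi> (- 1 * x)) = 0"
    by (subst J_cmult, subst J_psi) (auto simp: P_iff)
  also have "J (- 1) (\<lambda>x. if x \<in> P 0 then (\<beta> - chi \<pi> / Q * f (mat 1)) * \<psi> (- 1 * x) else 0) =
      \<beta> - chi \<pi> / Q * f (mat 1)"
    by (subst J_restrict, simp, subst J_cmult, subst J_psi) (auto simp: P_iff)
  finally show ?thesis by simp
qed

lemma Lam_F0: "unram_chi \<Longrightarrow> Lam 1 F0 = 1 - chi \<pi> / Q"
  using Lam_1_shape[OF _ F0_PS, of 1] fixed_phi[OF F0_PS F0_fixed] by simp

section \<open>The level-zero spaces and their spherical generators\<close>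

definition eta0 :: "('e \<Rightarrow> complex) \<Rightarrow> ('e^2^2 \<Rightarrow> complex) \<Rightarrow> bool" where
  "eta0 \<eta> f \<longleftrightarrow> (\<forall>k\<in>SL2OF X. \<forall>t\<in>OE_units X. rtrans (k ** tdiag X t) f = cscale (\<eta> (inverse (\<sigma> t))) f)"

text \<open>Under \<open>unram_chi\<close> this condition singles out the one \<eta> on the units
  for which a nonzero level-zero vector can exist, as \<open>eta0_imp\<close> shows.\<close>

definition eta_rowfac :: "('e \<Rightarrow> complex) \<Rightarrow> bool" where
  "eta_rowfac \<eta> \<longleftrightarrow> (\<forall>u\<in>OE_units X. \<eta> u = rowfac u)"

lemma eta_space_0: "eta_space X V \<eta> 0 = (if \<forall>u\<in>OF_units X. \<eta> u = 1 then {f \<in> V. eta0 \<eta> f} else {0})"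
  by (simp add: eta_space_def eta0_def)

lemma eta_space'_0: "eta_space' X V \<eta> 0 = (if \<forall>u\<in>OF_units X. \<eta> u = 1 then {f \<in> V. eta0 \<eta> (conj_fun \<pi> f)} else {0})"
proof -
  have "rtrans (dconj \<pi> h) f = cscale c f \<longleftrightarrow> rtrans h (conj_fun \<pi> f) = cscale c (conj_fun \<pi> f)" for h c f
  proof -
    have "rtrans h (conj_fun \<pi> f) = cscale c (conj_fun \<pi> f) \<longleftrightarrow> conj_fun \<pi> (rtrans (dconj \<pi> h) f) = conj_fun \<pi> (cscale c f)"
      by (simp add: rtrans_conj_fun conj_fun_cscale)
    also have "\<dots> \<longleftrightarrow> rtrans (dconj \<pi> h) f = cscale c f" by (metis conj_fun_conj_fun(2) unif_nz)
    finally show ?thesis by simp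
  qed
  then show ?thesis by (simp add: eta_space'_def eta0_def alpha_conj)
qed

lemma eta0_F0: "unram_chi \<Longrightarrow> eta_rowfac \<eta> \<Longrightarrow> eta0 \<eta> F0"
  unfolding eta0_def
proof (intro ballI)
  fix k t assume a: "unram_chi" "eta_rowfac \<eta>" "k \<in> SL2OF X" "t \<in> OE_units X"
  have "inverse (\<sigma> t) \<in> OE_units X" using a(4) by (simp add: OE_units_iff)
  hence "\<eta> (inverse (\<sigma> t)) = rowfac (inverse (\<sigma> t))" using a(2) by (simp add: eta_rowfac_def)
  then show "rtrans (k ** tdiag X t) F0 = cscale (\<eta> (inverse (\<sigma> t))) F0"
    by (simp add: rtrans_rtrans[symmetric] F0_tdiag[OF a(1,4)] rtrans_cscale F0_fixed[OF a(1,3)])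
qed

lemma mat1_SL2OF: "mat 1 \<in> SL2OF X"
  by (simp add: mat_mat2 SL2OF_mat2)

lemma eta0_imp:
  assumes unram_chi and f: "f \<in> PS" "eta0 \<eta> f" and \<eta>1: "\<eta> 1 = 1"
  shows "f = cscale (f (mat 1)) F0" "f \<noteq> 0 \<Longrightarrow> eta_rowfac \<eta>"
proof -
  have "rtrans k f = f" if "k \<in> SL2OF X" for k
  proof -
    have "1 \<in> OE_units X" by (simp add: OE_units_iff)
    moreover have "tdiag X 1 = mat 1" by (simp add: tdiag_mat2 mat_mat2)
    ultimately show ?thesis using f(2) that \<eta>1 unfolding eta0_def by fastforce
  qed
  then show e: "f = cscale (f (mat 1)) F0" using fixed_eq_F0[OF assms(1) f(1)] by blast
  assume "f \<noteq> 0"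
  hence nz: "f (mat 1) \<noteq> 0" using e by (metis cfun.scale_zero_left)
  show "eta_rowfac \<eta>" unfolding eta_rowfac_def
  proof
    fix u assume u: "u \<in> OE_units X"
    define t where "t = inverse (\<sigma> u)"
    have t: "t \<in> OE_units X" "t \<noteq> 0" "v t = 0" using u by (auto simp: OE_units_iff t_def)
    have ut: "inverse (\<sigma> t) = u" by (simp add: t_def)
    have "rtrans (mat 1 ** tdiag X t) f = cscale (\<eta> u) f"
      using f(2) mat1_SL2OF t(1) unfolding eta0_def ut[symmetric] by blast
    hence "rtrans (tdiag X t) f (mat 1) = \<eta> u * f (mat 1)" by (simp add: cscale_def)
    hence "chi t = \<eta> u" using rtrans_tdiag_1[OF f(1) t(2)] t nz by simp
    then show "\<eta> u = rowfac u" using u by (simp add: t_def rowfac_unit OE_units_iff)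
  qed
qed

lemma eta_rowfac_OF: "unram_chi \<Longrightarrow> eta_rowfac \<eta> \<Longrightarrow> u \<in> OF_units X \<Longrightarrow> \<eta> u = 1"
  unfolding eta_rowfac_def using unram_chi_unit by (auto simp: OF_units_iff OE_units_iff)

lemma eta_rowfac_chi: "unram_chi \<Longrightarrow> eta_rowfac chi"
  unfolding eta_rowfac_def using unram_chi_chi by (auto simp: OE_units_iff)

lemma eta0_cscale: "eta0 \<eta> f \<Longrightarrow> eta0 \<eta> (cscale c f)"
  unfolding eta0_def by (auto simp: rtrans_cscale mult.commute)

lemma line_member: "cscale c f \<in> V \<Longrightarrow> c \<noteq> 0 \<Longrightarrow> subrep X V PS \<Longrightarrow> f \<in> V"
  using subrepD(4)[of V "cscale c f" "inverse c"] by simp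

lemma eta_space_0_eq:
  assumes unram_chi "subrep X V PS" "F0 \<in> V" "eta_rowfac \<eta>" "\<eta> 1 = 1"
  shows "eta_space X V \<eta> 0 = {cscale c F0 | c. True}"
proof -
  have "eta_space X V \<eta> 0 = {f \<in> V. eta0 \<eta> f}" using eta_rowfac_OF assms by (simp add: eta_space_0)
  also have "\<dots> = {cscale c F0 | c. True}"
  proof (intro set_eqI iffI)
    fix f assume "f \<in> {f \<in> V. eta0 \<eta> f}"
    hence "f = cscale (f (mat 1)) F0" using eta0_imp(1)[OF assms(1)] subrepD(1) assms by blast
    then show "f \<in> {cscale c F0 | c. True}" by blast
  next
    fix f assume "f \<in> {cscale c F0 | c. True}"
    then show "f \<in> {f \<in> V. eta0 \<eta> f}"
      using eta0_cscale[OF eta0_F0] subrepD(4)[OF assms(2,3)] assms by auto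
  qed
  finally show ?thesis .
qed

definition F0' :: "'e^2^2 \<Rightarrow> complex" where "F0' = conj_fun (inverse \<pi>) F0"

lemma conj_fun_F0': "conj_fun \<pi> F0' = F0"
  by (simp add: F0'_def conj_fun_conj_fun)

lemma F0'_PS: "unram_chi \<Longrightarrow> F0' \<in> PS"
  unfolding F0'_def by (intro conj_fun_PS F0_PS) auto

lemma F0'_nz: "F0' \<noteq> 0"
  using conj_fun_F0' F0_nz conj_fun_0 by metis

lemma eta0_conj_fun_imp:
  assumes unram_chi and f: "f \<in> PS" "eta0 \<eta> (conj_fun \<pi> f)" and \<eta>1: "\<eta> 1 = 1"
  shows "f = cscale (f (mat 1)) F0'" "f \<noteq> 0 \<Longrightarrow> eta_rowfac \<eta>"
proof -
  have g: "conj_fun \<pi> f \<in> PS" using f by (intro conj_fun_PS) auto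
  note e = eta0_imp[OF assms(1) g f(2) \<eta>1]
  show "f = cscale (f (mat 1)) F0'"
    using arg_cong[OF e(1), of "conj_fun (inverse \<pi>)"] by (simp add: conj_fun_conj_fun conj_fun_cscale F0'_def conj_fun_1)
  show "f \<noteq> 0 \<Longrightarrow> eta_rowfac \<eta>" using e(2) conj_fun_conj_fun(2)[of \<pi> f] conj_fun_0 by (metis unif_nz)
qed

lemma eta_space'_0_eq:
  assumes unram_chi "subrep X V PS" "F0' \<in> V" "eta_rowfac \<eta>" "\<eta> 1 = 1"
  shows "eta_space' X V \<eta> 0 = {cscale c F0' | c. True}"
proof -
  have "eta_space' X V \<eta> 0 = {f \<in> V. eta0 \<eta> (conj_fun \<pi> f)}" using eta_rowfac_OF assms by (simp add: eta_space'_0)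
  also have "\<dots> = {cscale c F0' | c. True}"
  proof (intro set_eqI iffI)
    fix f assume "f \<in> {f \<in> V. eta0 \<eta> (conj_fun \<pi> f)}"
    hence "f = cscale (f (mat 1)) F0'" using eta0_conj_fun_imp(1)[OF assms(1)] subrepD(1) assms by blast
    then show "f \<in> {cscale c F0' | c. True}" by blast
  next
    fix f assume "f \<in> {cscale c F0' | c. True}"
    then show "f \<in> {f \<in> V. eta0 \<eta> (conj_fun \<pi> f)}"
      using eta0_cscale[OF eta0_F0] subrepD(4)[OF assms(2,3)] assms by (auto simp: conj_fun_cscale conj_fun_F0')
  qed
  finally show ?thesis .
qed

lemma line_ne_0: "f \<noteq> 0 \<Longrightarrow> {cscale c f | c. True} \<noteq> {0}"
proof
  assume "f \<noteq> 0" and e: "{cscale c f | c. True} = {0}"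
  moreover have "cscale 1 f \<in> {cscale c f | c. True}" by blast
  ultimately show False unfolding e by simp
qed

lemma dim_line: "f \<noteq> 0 \<Longrightarrow> cfun_dim {cscale c f | c. True} = 1"
proof (rule cfun.dim_unique[of "{f}"])
  assume "f \<noteq> 0"
  have "cscale 1 f \<in> {cscale c f |c. True}" by blast
  then show "{f} \<subseteq> {cscale c f |c. True}" by simp
  have "cscale c f \<in> cfun_span {f}" for c by (intro cfun.span_scale cfun.span_base) simp
  then show "{cscale c f |c. True} \<subseteq> cfun_span {f}" by blast
  show "cfun.independent {f}" using \<open>f \<noteq> 0\<close> by simp
qed simp

text \<open>With \<eta> = chi the level 0 is attained, so the conductor is 0. The given \<eta> then
  also has a nonzero vector at level 0, and evaluating the torus action at 1 determines
  \<eta>.\<close>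

lemma spherical_conductor:
  assumes unram_chi and V: "subrep X V PS" and F: "F0 \<in> V \<or> F0' \<in> V"
    and \<eta>: "eta_compatible X V \<eta>" "cond_eta X V \<eta> = conductor X V"
  shows "cond_eta X V \<eta> = 0" "conductor X V = 0" "eta_rowfac \<eta>" "\<eta> 1 = 1"
proof -
  have V0: "V \<noteq> {0}" using F F0_nz F0'_nz by blast
  show \<eta>1: "\<eta> 1 = 1" using \<eta>(1) eta_char_1 by (simp add: eta_compatible_def)
  have "cond_eta X V chi = 0" unfolding cond_eta_0
    using F eta_space_0_eq[OF assms(1) V _ eta_rowfac_chi[OF assms(1)] chi_1] line_ne_0[OF F0_nz]
      eta_space'_0_eq[OF assms(1) V _ eta_rowfac_chi[OF assms(1)] chi_1] line_ne_0[OF F0'_nz] by metis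
  then show c: "conductor X V = 0" using conductor_0[OF compat_chi[OF V V0]] by blast
  then show "cond_eta X V \<eta> = 0" using \<eta>(2) by simp
  hence "eta_space X V \<eta> 0 \<noteq> {0} \<or> eta_space' X V \<eta> 0 \<noteq> {0}" by (simp add: cond_eta_0)
  then show "eta_rowfac \<eta>"
  proof
    assume a: "eta_space X V \<eta> 0 \<noteq> {0}"
    hence e: "eta_space X V \<eta> 0 = {f \<in> V. eta0 \<eta> f}" unfolding eta_space_0 by metis
    have "cscale 0 F0 = 0" "0 \<in> V" using subrepD(2)[OF V] by auto
    hence "0 \<in> {f \<in> V. eta0 \<eta> f}" by (auto simp: eta0_def rtrans_def cscale_def fun_eq_iff)
    then obtain f where f: "f \<in> V" "eta0 \<eta> f" "f \<noteq> 0" using a e by blast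
    show ?thesis using eta0_imp(2)[OF assms(1) _ f(2) \<eta>1 f(3)] subrepD(1)[OF V f(1)] by blast
  next
    assume a: "eta_space' X V \<eta> 0 \<noteq> {0}"
    hence e: "eta_space' X V \<eta> 0 = {f \<in> V. eta0 \<eta> (conj_fun \<pi> f)}" unfolding eta_space'_0 by metis
    have "0 \<in> V" using subrepD(2)[OF V] by auto
    hence "0 \<in> {f \<in> V. eta0 \<eta> (conj_fun \<pi> f)}" by (auto simp: conj_fun_0 eta0_def rtrans_def cscale_def fun_eq_iff)
    then obtain f where f: "f \<in> V" "eta0 \<eta> (conj_fun \<pi> f)" "f \<noteq> 0" using a e by blast
    show ?thesis using eta0_conj_fun_imp(2)[OF assms(1) _ f(2) \<eta>1 f(3)] subrepD(1)[OF V f(1)] by blast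
  qed
qed

lemma omega_unram_chi:
  assumes "\<forall>x\<in>K - {0}. chi x = omegaEF X x"
  shows unram_chi "chi \<pi> = - 1"
  using assms omegaEF_eq by (auto simp: unram_chi_def OF_units_iff)

subsection \<open>The vectors fixed by the Iwahori subgroup\<close>

lemma Kbar_mat2: "mat2 x y z w \<in> Kbar X m \<longleftrightarrow>
    mat2 x y z w \<in> U11 X \<and> x \<in> P 0 \<and> y \<in> P 0 \<and> z \<in> P (int m) \<and> w \<in> P 0"
  using U11_int_det[of x y z w] U11_det(5)[of x y z w] P_mono[of z "int m" 0]
  by (auto simp: Kbar_def GL2OE_def forall_2 OE_units_iff)

lemma Iwahori_units:
  assumes "mat2 x y z w \<in> U11 X" "x \<in> P 0" "y \<in> P 0" "z \<in> P 1" "w \<in> P 0"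
  shows "x \<noteq> 0" "v x = 0" "w \<noteq> 0" "v w = 0"
proof -
  have "x * \<sigma> w - y * \<sigma> z = 1" using U11_det(6)[OF assms(1)] .
  hence "x * \<sigma> w - 1 = y * \<sigma> z" by (simp add: algebra_simps)
  moreover have "y * \<sigma> z \<in> P 1" using assms P_mult'[of y 0 "\<sigma> z" 1 1] by simp
  ultimately have "x * \<sigma> w \<noteq> 0 \<and> v (x * \<sigma> w) = 0" using one_unit_nz[of "x * \<sigma> w" 1] by simp
  then show "x \<noteq> 0" "v x = 0" "w \<noteq> 0" "v w = 0" using assms by (auto simp: P_iff)
qed

text \<open>The Iwahori eigenvector supported on the small cell, where c/d lies in P. Its function
  \<open>phi F1\<close> vanishes on O_F.\<close>

definition F1 :: "'e^2^2 \<Rightarrow> complex" where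
  "F1 g = (if g \<in> U11 X \<and> g $ 2 $ 2 \<noteq> 0 \<and> g $ 2 $ 1 / g $ 2 $ 2 \<in> P 1 then rowfac (g $ 2 $ 2) else 0)"

lemma F1_step:
  assumes unram_chi and k: "mat2 x y z w \<in> U11 X" "x \<in> P 0" "y \<in> P 0" "z \<in> P 1" "w \<in> P 0"
    and g: "mat2 a b c d \<in> U11 X" "d \<noteq> 0" "c / d \<in> P 1"
  shows "c * y + d * w \<noteq> 0" "(c * x + d * z) / (c * y + d * w) \<in> P 1"
    "rowfac (c * y + d * w) = rowfac d * rowfac w"
proof -
  note u = Iwahori_units[OF k]
  define t where "t = (c / d) * (y / w)"
  have yw: "y / w \<in> P 0" using k(3) u by (cases "y = 0") (auto simp: P_iff)
  have "c / d \<in> K" "y / w \<in> K" using U11_ratio[OF g(1)] U11_ratio[OF k(1)] by auto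
  hence tK: "1 + t \<in> K" unfolding t_def by (intro K_add K_mult K_1)
  have "t \<in> P 1" unfolding t_def using P_mult'[OF g(3) yw] by simp
  hence t1: "1 + t \<noteq> 0" "v (1 + t) = 0" using one_unit_nz[of "1 + t" 1] by auto
  have e: "c * y + d * w = d * w * (1 + t)" using g u by (simp add: t_def field_simps)
  show nz: "c * y + d * w \<noteq> 0" unfolding e using g u t1 by simp
  show "rowfac (c * y + d * w) = rowfac d * rowfac w"
    unfolding e using rowfac_mult g u t1 unram_chi_unit[OF assms(1) tK t1] by simp
  have e2: "(c * x + d * z) / (c * y + d * w) = ((c / d) * x + z) / (w * (1 + t))"
    unfolding e using g u t1 by (simp add: field_simps)
  have "(c / d) * x + z \<in> P 1" using P_mult'[OF g(3) k(2), of 1] k(4) by (intro P_add) auto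
  then show "(c * x + d * z) / (c * y + d * w) \<in> P 1"
    unfolding e2 using u t1 by (cases "(c / d) * x + z = 0") (auto simp: P_iff)
qed

lemma F1_rtrans:
  assumes unram_chi and k: "mat2 x y z w \<in> U11 X" "x \<in> P 0" "y \<in> P 0" "z \<in> P 1" "w \<in> P 0"
  shows "rtrans (mat2 x y z w) F1 = cscale (rowfac w) F1"
proof
  fix g :: "'e^2^2"
  obtain a b c d where g: "g = mat2 a b c d" by (rule mat2_cases)
  let ?k = "mat2 x y z w"
  have ik: "inv2 ?k = mat2 (\<sigma> w) (- \<sigma> y) (- \<sigma> z) (\<sigma> x)" by (simp add: inv2_def)
  have ki: "mat2 (\<sigma> w) (- \<sigma> y) (- \<sigma> z) (\<sigma> x) \<in> U11 X" "?k ** mat2 (\<sigma> w) (- \<sigma> y) (- \<sigma> z) (\<sigma> x) = mat 1"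
    using inv2(1,2)[OF k(1)] unfolding ik by auto
  show "rtrans ?k F1 g = cscale (rowfac w) F1 g"
  proof (cases "g \<in> U11 X")
    case True
    have gU: "mat2 a b c d \<in> U11 X" using True g by simp
    have gk: "g ** ?k \<in> U11 X" using U11_mult[OF True k(1)] .
    have gk': "g ** ?k = mat2 (a * x + b * z) (a * y + b * w) (c * x + d * z) (c * y + d * w)" by (simp add: g)
    show ?thesis
    proof (cases "d \<noteq> 0 \<and> c / d \<in> P 1")
      case True
      note st = F1_step[OF assms(1) k gU conjunct1[OF True] conjunct2[OF True]]
      show ?thesis using gk gU st True unfolding rtrans_def cscale_def gk' g F1_def by simp
    next
      case False
      \<comment> \<open>If the product were in the cell, \<open>F1_step\<close> for the inverse
        matrix would bring g back into it.\<close>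
      have "\<not> (c * y + d * w \<noteq> 0 \<and> (c * x + d * z) / (c * y + d * w) \<in> P 1)"
      proof
        assume a: "c * y + d * w \<noteq> 0 \<and> (c * x + d * z) / (c * y + d * w) \<in> P 1"
        have "\<sigma> w \<in> P 0" "- \<sigma> y \<in> P 0" "- \<sigma> z \<in> P 1" "\<sigma> x \<in> P 0" using k by auto
        note st = F1_step[OF assms(1) ki(1) this gk[unfolded gk'] conjunct1[OF a] conjunct2[OF a]]
        have "(g ** ?k) ** mat2 (\<sigma> w) (- \<sigma> y) (- \<sigma> z) (\<sigma> x) = g"
          using ki(2) by (simp only: matrix_mul_assoc[symmetric] matrix_mul_rid)
        hence e: "(c * x + d * z) * - \<sigma> y + (c * y + d * w) * \<sigma> x = d"
          "(c * x + d * z) * \<sigma> w + (c * y + d * w) * - \<sigma> z = c"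
          unfolding gk' g mat2_mult mat2_eq_iff by blast+
        show False using st(1,2) False unfolding e by blast
      qed
      hence "F1 (g ** ?k) = 0" unfolding gk' F1_def mat2_nth by (intro if_not_P) blast
      moreover have "F1 g = 0" unfolding g F1_def mat2_nth using False by (intro if_not_P) blast
      ultimately show ?thesis by (simp only: rtrans_def cscale_def mult_zero_right)
    qed
  next
    case False
    then show ?thesis using U11_mult_iff[OF k(1)] by (simp add: rtrans_def cscale_def F1_def)
  qed
qed

lemma F1_PS: assumes unram_chi shows "F1 \<in> PS"
  unfolding PS_iff
proof (intro conjI allI impI)
  obtain n :: nat and m where m: "chi_triv m" "m \<le> int n" by (rule ex_congr_level)
  have "rtrans k F1 = F1" if k: "k \<in> congruence_subgroup X n" for k
  proof -
    obtain x y z w where kk: "k = mat2 x y z w" by (rule mat2_cases)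
    have e: "mat2 x y z w \<in> U11 X" "x - 1 \<in> P (int n)" "y \<in> P (int n)" "z \<in> P (int n)" "w - 1 \<in> P (int n)"
      using k unfolding kk congruence_mat2 by auto
    note X = congr_rowfac[OF m e(2)] congr_rowfac[OF m e(5)]
    have "1 \<le> int n" using m by (simp add: chi_triv_def)
    hence "y \<in> P 0" "z \<in> P 1" using e(3,4) P_mono[of _ "int n" 0] P_mono[of _ "int n" 1] by auto
    then show ?thesis using F1_rtrans[OF assms e(1)] X unfolding kk by (simp add: cscale_def)
  qed
  then show "\<exists>n. \<forall>k\<in>congruence_subgroup X n. rtrans k F1 = F1" by blast
  show "g \<notin> U11 X \<Longrightarrow> F1 g = 0" for g by (simp add: F1_def)
  fix t x :: 'e and g assume a: "t \<noteq> 0" "x \<in> K" "g \<in> U11 X"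
  obtain p b c d where g: "g = mat2 p b c d" by (rule mat2_cases)
  have bU: "mat2 t (t * x) 0 (inverse (\<sigma> t)) \<in> U11 X" using a by (simp add: U11_iff)
  have bg: "mat2 t (t * x) 0 (inverse (\<sigma> t)) ** g \<in> U11 X" using U11_mult[OF bU a(3)] .
  have "rowfac (inverse (\<sigma> t) * d) = chi t * Q powi (- v t) * rowfac d" if "d \<noteq> 0"
    using that a(1) rowfac_mult[of "inverse (\<sigma> t)" d] by (simp add: rowfac_def)
  then show "F1 (mat2 t (t * x) 0 (inverse (\<sigma> t)) ** g) = chi t * Q powi (- v t) * F1 g"
    using bg a unfolding g by (simp add: F1_def)
qed

lemma F1_1: "F1 (mat 1) = 1"
  using mat1_U11 by (simp add: F1_def mat_mat2)

lemma phi_F1: "x \<in> K \<Longrightarrow> phi F1 x = (if x \<in> P 0 then 0 else xi x)"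
proof -
  assume x: "x \<in> K"
  have "mat2 0 (- 1) 1 x \<in> U11 X" using x by (simp add: U11_iff)
  moreover have "(x \<noteq> 0 \<and> 1 / x \<in> P 1) \<longleftrightarrow> x \<notin> P 0" by (auto simp: P_iff)
  ultimately show ?thesis using x by (auto simp: phi_mat2 F1_def rowfac_K)
qed

lemma phi_F0: "unram_chi \<Longrightarrow> x \<in> K \<Longrightarrow> phi F0 x = (if x \<in> P 0 then 1 else xi x)"
  using fixed_phi[OF F0_PS F0_fixed] by simp

lemma eta_space_pos: "0 < m \<Longrightarrow> f \<in> eta_space X V \<eta> m \<longleftrightarrow>
    f \<in> V \<and> (\<forall>g\<in>Kbar X m. rtrans g f = cscale (\<eta> (g $ 2 $ 2)) f)"
  by (simp add: eta_space_def)

lemma iwahori_mem: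
  assumes unram_chi "eta_rowfac \<eta>" "f = F0 \<or> f = F1" "g \<in> Kbar X 1"
  shows "rtrans g f = cscale (\<eta> (g $ 2 $ 2)) f"
proof -
  obtain x y z w where g: "g = mat2 x y z w" by (rule mat2_cases)
  have k: "mat2 x y z w \<in> U11 X" "x \<in> P 0" "y \<in> P 0" "z \<in> P 1" "w \<in> P 0"
    using assms(4) unfolding g Kbar_mat2 by auto
  note u = Iwahori_units[OF k]
  have "\<eta> w = rowfac w" using assms(2) u by (simp add: eta_rowfac_def OE_units_iff)
  moreover have "z \<in> P 0" using k(4) P_mono[of z 1 0] by simp
  ultimately show ?thesis
    using assms(3) F1_rtrans[OF assms(1) k] F0_rtrans[OF assms(1) k(1-3) _ k(5), of w] u g by auto
qed

lemma F0_F1_PS: "unram_chi \<Longrightarrow> F0 - F1 \<in> PS"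
proof -
  assume s: unram_chi
  have "F0 - F1 = F0 + cscale (- 1) F1" by (auto simp: cscale_def)
  also have "\<dots> \<in> PS" by (intro PS_add PS_cscale F0_PS F1_PS s)
  finally show ?thesis .
qed

text \<open>The Borel and Iwahori subgroups have two double cosets, represented by 1 and w; the
  coefficients are the values of f there.\<close>

lemma iwahori_span:
  assumes unram_chi "eta_rowfac \<eta>" "\<eta> 1 = 1" and f: "f \<in> eta_space X PS \<eta> 1"
  shows "f = cscale (f (mat 1)) F1 + cscale (phi f 0) (F0 - F1)"
proof (rule PS_ext)
  have fP: "f \<in> PS" and fe: "\<And>g. g \<in> Kbar X 1 \<Longrightarrow> rtrans g f = cscale (\<eta> (g $ 2 $ 2)) f"
    using f by (auto simp: eta_space_pos)
  show "f \<in> PS" by fact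
  show "cscale (f (mat 1)) F1 + cscale (phi f 0) (F0 - F1) \<in> PS"
    by (intro PS_add PS_cscale F1_PS F0_F1_PS assms(1))
  show "f (mat 1) = (cscale (f (mat 1)) F1 + cscale (phi f 0) (F0 - F1)) (mat 1)"
    by (simp add: cscale_def F1_1)
  fix x assume x: "x \<in> K"
  have "phi f x = (if x \<in> P 0 then phi f 0 else xi x * f (mat 1))"
  proof (cases "x \<in> P 0")
    case True
    have "unip x \<in> Kbar X 1" using True x unip_U11[OF x] unfolding unip_def Kbar_mat2 by simp
    from fe[OF this] have "rtrans (unip x) f = f" by (simp add: unip_def assms(3))
    then show ?thesis using phi_rtrans_unip[of x f 0] True by simp
  next
    case False
    hence x0: "x \<noteq> 0" "inverse x \<in> P 1" by (auto simp: P_iff)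
    have "mat2 1 0 (inverse x) 1 \<in> Kbar X 1" using x0 x unfolding Kbar_mat2 by simp
    from fe[OF this] have "rtrans (mat2 1 0 (inverse x) 1) f = f" by (simp add: assms(3))
    then show ?thesis using phi_lower[OF fP x x0(1)] False by simp
  qed
  then show "phi f x = phi (cscale (f (mat 1)) F1 + cscale (phi f 0) (F0 - F1)) x"
    using phi_F0[OF assms(1) x] phi_F1[OF x] by simp
qed

text \<open>The difference \<open>F0 - F1\<close> vanishes at 1, and its \<open>phi\<close> is the
  indicator function of O_F.\<close>

lemma Lam_F0_F1:
  assumes unram_chi
  shows "F0 - F1 \<in> PS" "Lam 1 (F0 - F1) = 1" "Lam 1 F1 = - chi \<pi> / Q"
proof -
  show P: "F0 - F1 \<in> PS" by (rule F0_F1_PS[OF assms])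
  show "Lam 1 (F0 - F1) = 1"
    using Lam_1_shape[OF assms P, of 1] phi_F0[OF assms] phi_F1 by (simp add: F1_1)
  show "Lam 1 F1 = - chi \<pi> / Q"
    using Lam_1_shape[OF assms F1_PS[OF assms], of 0] phi_F1 by (simp add: F1_1)
qed

lemma Lambda_psi: "Lambda X \<mu> \<psi> f = Lam 1 f"
  by (simp add: Lam_def)

lemma generic_psi: "subrep X V PS \<Longrightarrow> generic X V \<psi> \<longleftrightarrow> (\<exists>f\<in>V. Lam 1 f \<noteq> 0)"
  using generic_iff[of V 1] by simp

text \<open>\<open>Lam 1\<close> is a nonzero functional on the plane of
  \<open>iwahori_span\<close>. The constant c1 is chosen so that h lies in its kernel, since
  \<open>F0 - F1\<close> has value 1 and F1 has value -c1.\<close>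

lemma dim_iwahori_kernel:
  assumes unram_chi "eta_rowfac \<eta>" "\<eta> 1 = 1"
  shows "cfun_dim {f \<in> eta_space X PS \<eta> 1. Lam 1 f = 0} = 1"
proof -
  define c1 where "c1 = chi \<pi> / Q"
  define h where "h = F1 + cscale c1 (F0 - F1)"
  have FP: "F0 \<in> PS" "F1 \<in> PS" using F0_PS F1_PS assms by auto
  have dP: "F0 - F1 \<in> PS" "Lam 1 (F0 - F1) = 1" "Lam 1 F1 = - c1"
    using Lam_F0_F1[OF assms(1)] by (auto simp: c1_def)
  have hP: "h \<in> PS" unfolding h_def using FP dP by (simp add: PS_add PS_cscale)
  have Lh: "Lam 1 h = 0" unfolding h_def using dP FP by (simp add: Lam_add Lam_cscale PS_cscale)
  have h1: "h (mat 1) = 1" by (simp add: h_def cscale_def F1_1)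
  have he: "rtrans g h = cscale (\<eta> (g $ 2 $ 2)) h" if g: "g \<in> Kbar X 1" for g
  proof -
    have 1: "rtrans g F0 = cscale (\<eta> (g $ 2 $ 2)) F0" "rtrans g F1 = cscale (\<eta> (g $ 2 $ 2)) F1"
      using iwahori_mem[OF assms(1,2) _ g] by blast+
    have "h = cscale (1 - c1) F1 + cscale c1 F0"
      by (auto simp: h_def cscale_def fun_eq_iff algebra_simps)
    then show ?thesis using 1 by (simp add: rtrans_add rtrans_cscale cfun.scale_right_distrib mult.commute)
  qed
  have "{f \<in> eta_space X PS \<eta> 1. Lam 1 f = 0} = {cscale c h | c. True}"
  proof (intro set_eqI iffI)
    fix f assume a: "f \<in> {f \<in> eta_space X PS \<eta> 1. Lam 1 f = 0}"
    have e: "f = cscale (f (mat 1)) F1 + cscale (phi f 0) (F0 - F1)"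
      using iwahori_span[OF assms] a by blast
    have "0 = Lam 1 (cscale (f (mat 1)) F1 + cscale (phi f 0) (F0 - F1))" using a e by simp
    also have "\<dots> = - f (mat 1) * c1 + phi f 0" using FP dP by (simp add: Lam_add Lam_cscale PS_cscale)
    finally have "phi f 0 = f (mat 1) * c1" by simp
    hence "f = cscale (f (mat 1)) h" using e by (simp add: h_def cfun.scale_right_distrib)
    then show "f \<in> {cscale c h | c. True}" by blast
  next
    fix f assume "f \<in> {cscale c h | c. True}"
    then obtain c where c: "f = cscale c h" by blast
    have "f \<in> eta_space X PS \<eta> 1" unfolding c eta_space_pos[OF zero_less_one]
      using hP he by (simp add: PS_cscale rtrans_cscale mult.commute)
    then show "f \<in> {f \<in> eta_space X PS \<eta> 1. Lam 1 f = 0}" using Lam_cscale[OF hP, of 1 c] Lh c by simp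
  qed
  moreover have "h \<noteq> 0" using h1 by auto
  ultimately show ?thesis using dim_line by simp
qed

text \<open>The hypothesis says that chi is trivial on norms of units, and these are all the units
  of F.\<close>

lemma norm_trivial_unram_chi:
  assumes "\<forall>x\<in>OE_units X. chi x = inverse (chi (\<sigma> x))"
  shows unram_chi
  unfolding unram_chi_def
proof
  fix u assume "u \<in> OF_units X"
  then obtain y where y: "y \<noteq> 0" "v y = 0" "y * \<sigma> y = u"
    using norm_surj_units[of u] by (auto simp: OF_units_iff)
  have "chi u = chi y * chi (\<sigma> y)" using y chi_mult by (metis gal_eq_0_iff)
  moreover have "chi y = inverse (chi (\<sigma> y))" using assms y OE_units_iff by blast
  moreover have "chi (\<sigma> y) \<noteq> 0" using y(1) by simp
  ultimately show "chi u = 1" by simp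
qed

subsection \<open>Pairs of complementary subrepresentations\<close>

text \<open>Two subrepresentations on which \<open>Lam a\<close> is nonzero both contain the bump
  equal to \<psi>(ax) on one and the same large ball, so they meet nontrivially.\<close>

lemma disjoint_generic:
  assumes V: "subrep X V PS" and V': "subrep X V' PS" and disj: "V \<inter> V' \<subseteq> {0}"
    and a: "a \<in> K" "a \<noteq> 0" and f: "f \<in> V" "Lam a f \<noteq> 0" and g: "g \<in> V'"
  shows "Lam a g = 0"
proof (rule ccontr)
  assume nz: "Lam a g \<noteq> 0"
  obtain r1 where r1: "\<And>r. r1 \<le> r \<Longrightarrow> \<exists>g\<in>V. g (mat 1) = 0 \<and>
    (\<forall>x\<in>K. phi g x = (if x \<in> P (- r) then \<psi> (a * x) else 0))" using psi_bump_mem[OF V f(1) a f(2)] by blast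
  obtain r2 where r2: "\<And>r. r2 \<le> r \<Longrightarrow> \<exists>g\<in>V'. g (mat 1) = 0 \<and>
    (\<forall>x\<in>K. phi g x = (if x \<in> P (- r) then \<psi> (a * x) else 0))" using psi_bump_mem[OF V' g a nz] by blast
  define r where "r = max r1 r2"
  obtain h where h: "h \<in> V" "h (mat 1) = 0" "\<And>x. x \<in> K \<Longrightarrow> phi h x = (if x \<in> P (- r) then \<psi> (a * x) else 0)"
    using r1[of r] by (auto simp: r_def)
  obtain h' where h': "h' \<in> V'" "h' (mat 1) = 0" "\<And>x. x \<in> K \<Longrightarrow> phi h' x = (if x \<in> P (- r) then \<psi> (a * x) else 0)"
    using r2[of r] by (auto simp: r_def)
  have "h = h'" using h h' subrepD(1)[OF V] subrepD(1)[OF V'] by (intro PS_ext) auto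
  hence "h = 0" using h(1) h'(1) disj by blast
  then show False using h(3)[of 0] by simp
qed

text \<open>b/a has even valuation, hence is the norm of some t, and the torus element of t carries
  index a to index b.\<close>

lemma Lam_parity:
  assumes V: "subrep X V PS" and z: "\<And>f. f \<in> V \<Longrightarrow> Lam a f = 0" and a: "a \<in> K" "a \<noteq> 0"
    and b: "b \<in> K" "b \<noteq> 0" and par: "even (v a - v b)" and f: "f \<in> V"
  shows "Lam b f = 0"
proof -
  have "even (v (b / a))" using a b par by (simp add: even_diff_iff)
  then obtain t where t: "t \<noteq> 0" "t * \<sigma> t = b / a" using norm_surj[of "b / a"] a b by auto
  have g: "rtrans (tdiag X t) f \<in> V" using subrepD(5)[OF V f] t by simp
  have "0 = Lam a (rtrans (tdiag X t) f)" using z[OF g] by simp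
  also have "\<dots> = chi (inverse (\<sigma> t)) * Q powi v t * Q powi (- v (t * \<sigma> t)) * Lam (a * (t * \<sigma> t)) f"
    using Lam_tdiag[OF _ _ t(1) a] subrepD(1)[OF V] f g by blast
  finally show ?thesis using t a by simp
qed

text \<open>By uniqueness of the decomposition both components inherit invariance under the
  conjugated SL_2(O_F). The invariants form a line, so each component is a multiple of the whole
  vector, and not both multiples vanish.\<close>

lemma fixed_split:
  assumes unram_chi and V: "subrep X V PS" and V': "subrep X V' PS" and disj: "V \<inter> V' \<subseteq> {0}"
    and c: "c \<in> K" "c \<noteq> 0" and fg: "f \<in> V" "g \<in> V'" "conj_fun c F0 = f + g"
  shows "conj_fun c F0 \<in> V \<or> conj_fun c F0 \<in> V'"
proof -
  note VD = subrepD[OF V] and WD = subrepD[OF V']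
  have ic: "inverse c \<in> K" "inverse c \<noteq> 0" using c by auto
  have fix': "rtrans (dconj (inverse c) k) f = f \<and> rtrans (dconj (inverse c) k) g = g"
    if k: "k \<in> SL2OF X" for k
  proof -
    let ?k = "dconj (inverse c) k"
    have kU: "?k \<in> U11 X" using dconj_U11[OF ic] SL2OF_U11[OF k] by blast
    have "rtrans ?k (conj_fun c F0) = conj_fun c F0"
      using c F0_fixed[OF assms(1) k] by (simp add: rtrans_conj_fun dconj_dconj)
    hence "rtrans ?k f + rtrans ?k g = f + g" using fg(3) by (simp add: rtrans_add)
    hence e: "rtrans ?k f - f = g - rtrans ?k g" by (simp add: algebra_simps)
    have "rtrans ?k f - f \<in> V" using VD(5)[OF fg(1) kU] VD(6) fg(1) by blast
    moreover have "rtrans ?k f - f \<in> V'" unfolding e using WD(5)[OF fg(2) kU] WD(6) fg(2) by blast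
    ultimately have "rtrans ?k f - f = 0" using disj by blast
    then show ?thesis using e by simp
  qed
  have line: "h = cscale (h (mat 1)) (conj_fun c F0)"
    if h: "h \<in> PS" "\<And>k. k \<in> SL2OF X \<Longrightarrow> rtrans (dconj (inverse c) k) h = h" for h
  proof -
    have "rtrans k (conj_fun (inverse c) h) = conj_fun (inverse c) h" if "k \<in> SL2OF X" for k
      using h(2)[OF that] c by (simp add: rtrans_conj_fun)
    from fixed_eq_F0[OF assms(1) conj_fun_PS[OF h(1) ic] this]
    have "conj_fun (inverse c) h = cscale (h (mat 1)) F0" by (simp add: conj_fun_1)
    from arg_cong[OF this, of "conj_fun c"] show ?thesis using c by (simp add: conj_fun_conj_fun conj_fun_cscale)
  qed
  have lf: "f = cscale (f (mat 1)) (conj_fun c F0)" using line[of f] VD(1)[OF fg(1)] fix' by blast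
  have lg: "g = cscale (g (mat 1)) (conj_fun c F0)" using line[of g] WD(1)[OF fg(2)] fix' by blast
  have "f (mat 1) + g (mat 1) = 1" using fun_cong[OF fg(3), of "mat 1"] by (simp add: conj_fun_1)
  hence "f (mat 1) \<noteq> 0 \<or> g (mat 1) \<noteq> 0" by auto
  then show ?thesis using line_member[OF _ _ V] line_member[OF _ _ V'] lf lg fg by metis
qed

lemma pi1_F0:
  assumes "is_pi1 X chi V"
  shows unram_chi "chi \<pi> = - 1" "F0 \<in> V" "Lam 1 F0 \<noteq> 0"
proof -
  have V: "subrep X V PS" and om: "\<forall>x\<in>K - {0}. chi x = omegaEF X x"
    using assms by (auto simp: is_pi1_def)
  show s: unram_chi and z: "chi \<pi> = - 1" using omega_unram_chi[OF om] by auto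
  obtain f where f: "f \<in> V" "f \<noteq> 0" "\<forall>k\<in>SL2OF X. rtrans k f = f" using assms by (auto simp: is_pi1_def)
  have "f = cscale (f (mat 1)) F0" using fixed_eq_F0[OF s] subrepD(1)[OF V] f by blast
  moreover from this have "f (mat 1) \<noteq> 0" using f(2) by (metis cfun.scale_zero_left)
  ultimately show "F0 \<in> V" using line_member[OF _ _ V] f(1) by metis
  \<comment> \<open>With \<open>chi \<pi> = - 1\<close> this is the value of
    \<open>Lam 1 F0\<close>.\<close>
  have "1 + 1 / Q = complex_of_real (1 + 1 / q)" by simp
  moreover have "1 + 1 / q \<noteq> 0" using q_gt0 by (metis add_pos_pos less_irrefl zero_less_divide_1_iff zero_less_one)
  ultimately have "1 + 1 / Q \<noteq> 0" using of_real_eq_0_iff by metis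
  then show "Lam 1 F0 \<noteq> 0" using Lam_F0[OF s] z by simp
qed

lemma newform_line:
  assumes "cond_eta X V \<eta> = 0" "conductor X V = 0" "V' = eta_space X V \<eta> 0 \<or> V' = eta_space' X V \<eta> 0" "V' \<noteq> {0}"
  shows "newform_space X V \<eta> V'"
  unfolding newform_space_def using assms by (intro conjI exI[of _ 0]) (simp_all only: zero_enat_def not_False_eq_True)

text \<open>F0 makes the complement V' generic at even indices, so V is killed there. If F0' were in
  V' as well, V' would be generic at odd indices too, and V would be killed by every
  \<open>Lam a\<close>.\<close>

lemma pi2_spherical:
  assumes V: "is_pi2 X chi V" "infinite_dim V"
  shows unram_chi "F0' \<in> V" "\<And>f. f \<in> V \<Longrightarrow> Lam 1 f = 0" "Lam \<pi> F0' \<noteq> 0"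
proof -
  obtain V' where V': "is_pi1 X chi V'" "V \<inter> V' = {0}" "PS = {f + g | f g. f \<in> V \<and> g \<in> V'}"
    and Vs: "subrep X V PS" and Vi: "irreducible_rep X V"
    using V(1) unfolding is_pi2_def by (elim conjE exE) rule
  have Ws: "subrep X V' PS" using V'(1) by (simp add: is_pi1_def)
  note p = pi1_F0[OF V'(1)]
  show s: unram_chi by (rule p(1))
  show z: "Lam 1 f = 0" if "f \<in> V" for f
    using disjoint_generic[OF Ws Vs _ _ _ p(3,4) that] V'(2) by auto
  have "Lam \<pi> F0' = xi (inverse \<pi>) * Q powi (- v (inverse \<pi>)) * Lam (\<pi> * inverse \<pi>) F0"
    unfolding F0'_def by (intro Lam_conj_fun F0_PS s) auto
  then show nz: "Lam \<pi> F0' \<noteq> 0" using p(4) by simp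
  obtain f g where fg: "f \<in> V" "g \<in> V'" "conj_fun (inverse \<pi>) F0 = f + g"
    using F0'_PS[OF s] unfolding V'(3) F0'_def by (elim CollectE exE conjE) rule
  have "F0' \<in> V \<or> F0' \<in> V'"
    unfolding F0'_def by (rule fixed_split[OF s Vs Ws _ _ _ fg]) (use V'(2) in auto)
  then show "F0' \<in> V"
  proof
    assume F: "F0' \<in> V'"
    have z\<pi>: "Lam \<pi> f = 0" if "f \<in> V" for f
      using disjoint_generic[OF Ws Vs _ _ _ F nz that] V'(2) by auto
    have "f = 0" if f: "f \<in> V" for f
    proof (rule kirillov_inj[OF Vs Vi V(2) f])
      fix a assume a: "a \<in> K" "a \<noteq> 0"
      show "Lam a f = 0"
      proof (cases "even (v a)")
        case True
        then show ?thesis using Lam_parity[OF Vs z _ _ a _ f] by simp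
      next
        case False
        then show ?thesis using Lam_parity[OF Vs z\<pi> _ _ a _ f] by simp
      qed
    qed
    hence "V = {0}" using subrepD(2)[OF Vs] by blast
    then show ?thesis using Vi by (simp add: irreducible_rep_def)
  qed
qed

subsection \<open>Newforms annihilated by the Whittaker functional\<close>

definition weyl_of :: "'e \<Rightarrow> 'e^2^2" where "weyl_of u = mat2 0 u (- inverse u) 0"

text \<open>For \<open>v u = - 1\<close> the outer factors lie in n(P^(-1)) and the middle one in
  the Iwahori subgroup, so a vector fixed by these unipotent factors is fixed by the Weyl element
  too.\<close>

lemma weyl_of_eq: "u \<noteq> 0 \<Longrightarrow> weyl_of u = unip u ** (mat2 1 0 (- inverse u) 1 ** unip u)"
  by (simp add: weyl_of_def unip_def)

lemma rtrans_fixes_mult: "rtrans g f = f \<Longrightarrow> rtrans h f = f \<Longrightarrow> rtrans (g ** h) f = f"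
  by (simp add: rtrans_rtrans[symmetric])

lemma Lam_zero_of_fixed:
  assumes f: "f \<in> PS" and a: "a \<in> K" "a \<noteq> 0"
    and y: "y \<in> K" "rtrans (unip y) f = f" "\<psi> (a * y) \<noteq> 1"
  shows "Lam a f = 0"
  using Lam_unip[OF f _ y(1) a] y f by simp

lemma killed_imp_fixed:
  assumes V: "subrep X V PS" "irreducible_rep X V" "infinite_dim V" and f: "f \<in> V"
    and un: "\<And>x. x \<in> K \<Longrightarrow> x \<in> P 0 \<Longrightarrow> rtrans (unip x) f = f"
    and td: "\<And>t. t \<noteq> 0 \<Longrightarrow> v t = 0 \<Longrightarrow> \<exists>k. rtrans (tdiag X t) f = cscale k f"
    and z: "Lam 1 f = 0" and y: "y \<in> K" "y \<in> P (- 1)"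
  shows "rtrans (unip y) f = f"
proof -
  note VD = subrepD[OF V(1)]
  have fP: "f \<in> PS" using VD f by blast
  have gV: "rtrans (unip y) f \<in> V" using VD(5)[OF f] y by simp
  \<comment> \<open>Valuation 0 is reached from index 1 by the torus. For negative valuation the
    character is nontrivial on O_F, while f is fixed by n(O_F).\<close>
  have le0: "Lam a f = 0" if a: "a \<in> K" "a \<noteq> 0" "v a \<le> 0" for a
  proof (cases "v a = 0")
    case True
    obtain t where t: "t \<noteq> 0" "v t = 0" "t * \<sigma> t = a" using norm_surj_units[OF a(1,2) True] by blast
    obtain k where k: "rtrans (tdiag X t) f = cscale k f" using td t by blast
    have "Lam 1 (rtrans (tdiag X t) f) = 0" unfolding k using Lam_cscale[OF fP, of 1 k] z by simp
    moreover have "Lam 1 (rtrans (tdiag X t) f) =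
        chi (inverse (\<sigma> t)) * Q powi v t * Q powi (- v (t * \<sigma> t)) * Lam (1 * (t * \<sigma> t)) f"
      by (rule Lam_tdiag[OF fP _ t(1)]) (use VD(1) VD(5)[OF f] t in auto)
    ultimately show ?thesis unfolding t(3) using t by simp
  next
    case False
    hence "a \<notin> P (- 0)" using a by (simp add: P_iff)
    then obtain u where "u \<in> K" "u \<in> P 0" "\<psi> (a * u) \<noteq> 1" using psi_nontriv_at[of a 0] a by auto
    then show ?thesis using Lam_zero_of_fixed[OF fP a(1,2)] un by blast
  qed
  have "rtrans (unip y) f - f = 0"
  proof (rule kirillov_inj[OF V])
    show dV: "rtrans (unip y) f - f \<in> V" using VD(6) gV f by blast
    fix a assume a: "a \<in> K" "a \<noteq> 0"
    have "rtrans (unip y) f = (rtrans (unip y) f - f) + f" by simp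
    hence "\<psi> (a * y) * Lam a f = Lam a (rtrans (unip y) f - f) + Lam a f"
      using Lam_add[OF VD(1)[OF dV] fP a] Lam_unip[OF fP VD(1)[OF gV] y(1) a] by simp
    \<comment> \<open>For positive valuation of a the character is trivial on P^(-1); in the
      remaining cases \<open>Lam a f\<close> is 0.\<close>
    moreover have "\<psi> (a * y) * Lam a f = Lam a f"
    proof (cases "v a \<le> 0")
      case False
      hence "a * y \<in> P 0" using y by (intro P_mult'[of a 1 y "- 1"]) (auto simp: P_iff)
      then show ?thesis using psi_eq_1[of "a * y"] a y by simp
    qed (use le0 a in simp)
    ultimately show "Lam a (rtrans (unip y) f - f) = 0" by simp
  qed
  then show ?thesis by simp
qed

lemma tdiag_Kbar: "t \<noteq> 0 \<Longrightarrow> v t = 0 \<Longrightarrow> tdiag X t \<in> Kbar X m"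
  unfolding tdiag_mat2 Kbar_mat2 by (simp add: U11_iff P_iff)

lemma unip_Kbar: "x \<in> K \<Longrightarrow> x \<in> P 0 \<Longrightarrow> unip x \<in> Kbar X m"
  using unip_U11[of x] unfolding unip_def Kbar_mat2 by simp

text \<open>From level 2 on, the conjugated group of level m - 1 still has a unit w in the lower
  right corner. Splitting off n(t) with t = y/(w\<pi>) in P^(-1) leaves a lower triangular element
  of \<open>Kbar X m\<close> with the same w.\<close>

lemma level_drop:
  assumes V: "subrep X V PS" and m: "2 \<le> m" and \<eta>1: "\<eta> 1 = 1" and f: "f \<in> eta_space X V \<eta> m"
    and fx: "\<And>y. y \<in> K \<Longrightarrow> y \<in> P (- 1) \<Longrightarrow> rtrans (unip y) f = f"
  shows "f \<in> eta_space' X V \<eta> (m - 1)"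
proof -
  have fV: "f \<in> V" and fe: "\<And>g. g \<in> Kbar X m \<Longrightarrow> rtrans g f = cscale (\<eta> (g $ 2 $ 2)) f"
    using f m by (auto simp: eta_space_pos)
  have "rtrans g f = cscale (\<eta> (g $ 2 $ 2)) f" if g: "g \<in> Kbar' X (m - 1)" for g
  proof -
    obtain k where k: "k \<in> Kbar X (m - 1)" "g = dconj \<pi> k" using g by (auto simp: Kbar'_def alpha_conj)
    obtain x y z w where kk: "k = mat2 x y z w" by (rule mat2_cases)
    have e: "mat2 x y z w \<in> U11 X" "x \<in> P 0" "y \<in> P 0" "z \<in> P (int (m - 1))" "w \<in> P 0"
      using k(1) unfolding kk Kbar_mat2 by auto
    have z1: "z \<in> P 1" using e(4) m P_mono[of z "int (m - 1)" 1] by simp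
    note u = Iwahori_units[OF e(1-3) z1 e(5)]
    define t where "t = y / w / \<pi>"
    have "y / w \<in> K" using U11_ratio[OF e(1)] by auto
    hence tK: "t \<in> K" unfolding t_def by (rule K_divide) simp
    have ywP: "y / w \<in> P 0" using e(3) u by (cases "y = 0") (auto simp: P_iff)
    hence tP: "t \<in> P (- 1)" using P_div_unif[of "y / w" 0 1] by (simp add: t_def)
    have gU: "mat2 x (y / \<pi>) (z * \<pi>) w \<in> U11 X" using dconj_U11[of \<pi> "mat2 x y z w"] e(1) by simp
    let ?h = "mat2 (x - y / w * z) 0 (z * \<pi>) w"
    have gh: "mat2 x (y / \<pi>) (z * \<pi>) w = unip t ** ?h"
      using u by (simp add: unip_def t_def)
    have "?h = unip (- t) ** mat2 x (y / \<pi>) (z * \<pi>) w"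
      using u by (simp add: unip_def t_def)
    hence "?h \<in> U11 X" using U11_mult[OF unip_U11 gU, of "- t"] tK by simp
    moreover have "x - y / w * z \<in> P 0"
      using e(2) P_mult'[OF ywP z1, of 0] by (intro P_diff) auto
    moreover have "z * \<pi> \<in> P (int m)"
      using m P_mult'[OF e(4), of \<pi> 1 "int m"] by (simp add: P_iff)
    ultimately have "?h \<in> Kbar X m" using e(5) by (simp add: Kbar_mat2)
    hence "rtrans ?h f = cscale (\<eta> w) f" using fe by fastforce
    hence "rtrans (unip t ** ?h) f = cscale (\<eta> w) f"
      using fx[OF tK tP] by (simp add: rtrans_rtrans[symmetric] rtrans_cscale)
    then show ?thesis unfolding k(2) kk dconj_mat2 gh by (simp add: unip_def)
  qed
  then show ?thesis using fV m by (simp add: eta_space'_def)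
qed

text \<open>At the last step w need not be a unit, so the splitting of \<open>level_drop\<close>
  covers only part of the group; a Weyl element fixing f brings in the rest. Level 0 also requires
  \<eta> to be trivial on the units of F.\<close>

lemma level_drop_1:
  assumes V: "subrep X V PS" and \<eta>1: "\<eta> 1 = 1" and f: "f \<in> eta_space X V \<eta> 1" "f \<noteq> 0"
    and fx: "\<And>y. y \<in> K \<Longrightarrow> y \<in> P (- 1) \<Longrightarrow> rtrans (unip y) f = f"
  shows "f \<in> eta_space' X V \<eta> 0"
proof -
  have fV: "f \<in> V" and fe: "\<And>g. g \<in> Kbar X 1 \<Longrightarrow> rtrans g f = cscale (\<eta> (g $ 2 $ 2)) f"
    using f by (auto simp: eta_space_pos)
  have low: "rtrans (mat2 1 0 z 1) f = f" if "z \<in> K" "z \<in> P 1" for z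
    using fe[of "mat2 1 0 z 1"] that \<eta>1 by (simp add: Kbar_mat2)
  have fweyl_of: "rtrans (weyl_of u) f = f" if u: "u \<in> K" "u \<noteq> 0" "v u = - 1" for u
    unfolding weyl_of_eq[OF u(2)] using u
    by (intro rtrans_fixes_mult fx low) (auto simp: P_iff)
  \<comment> \<open>The diagonal matrix of 1/u and u is a product of two Weyl elements that fix f,
    and f is nonzero.\<close>
  have \<eta>u: "\<eta> u = 1" if u: "u \<in> K" "u \<noteq> 0" "v u = 0" for u
  proof -
    have e: "weyl_of (inverse u / \<pi>) ** weyl_of (- inverse \<pi>) = mat2 (inverse u) 0 0 u"
      using u by (simp add: weyl_of_def divide_inverse)
    have "rtrans (weyl_of (inverse u / \<pi>) ** weyl_of (- inverse \<pi>)) f = f"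
      using u by (intro rtrans_fixes_mult fweyl_of) auto
    moreover have "mat2 (inverse u) 0 0 u \<in> Kbar X 1"
      using u by (simp add: Kbar_mat2 U11_iff P_iff)
    ultimately have "cscale (\<eta> u) f = f" using fe[of "mat2 (inverse u) 0 0 u"] unfolding e by simp
    hence "cscale (\<eta> u) f = cscale 1 f" by simp
    then show ?thesis using f(2) cfun.scale_right_imp_eq by blast
  qed
  have unit_case: "rtrans (dconj \<pi> k) f = f" if k: "k = mat2 x y z w" "k \<in> SL2OF X" "w \<noteq> 0" "v w = 0" for k x y z w
  proof -
    have e: "x \<in> K" "y \<in> K" "z \<in> K" "w \<in> K" "y \<in> P 0" "z \<in> P 0" "x * w - y * z = 1"
      using k(2) unfolding k(1) SL2OF_mat2 by auto
    define t where "t = y / w / \<pi>"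
    have tK: "t \<in> K" using e by (simp add: t_def)
    have "y / w \<in> P 0" using e k by (cases "y = 0") (auto simp: P_iff)
    hence tP: "t \<in> P (- 1)" using P_div_unif[of "y / w" 0 1] by (simp add: t_def)
    have xe: "x = (1 + y * z) / w" using e(7) k(3) by (simp add: field_simps)
    have d: "dconj \<pi> k = unip t ** mat2 (inverse w) 0 (z * \<pi>) w"
      using k(3) by (simp add: k(1) unip_def t_def xe field_simps)
    have "z * \<pi> \<in> P 1" using P_mult'[OF e(6), of \<pi> 1 1] by (simp add: P_iff)
    hence "mat2 (inverse w) 0 (z * \<pi>) w \<in> Kbar X 1"
      using e k by (simp add: Kbar_mat2 U11_iff P_iff)
    hence "rtrans (mat2 (inverse w) 0 (z * \<pi>) w) f = f" using fe \<eta>u[OF e(4) k(3,4)] by fastforce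
    then show ?thesis unfolding d using fx[OF tK tP] by (intro rtrans_fixes_mult)
  qed
  have sl: "rtrans (dconj \<pi> k) f = f" if k: "k \<in> SL2OF X" for k
  proof -
    obtain x y z w where kk: "k = mat2 x y z w" by (rule mat2_cases)
    have e: "x \<in> K" "y \<in> K" "z \<in> K" "w \<in> K" "x \<in> P 0" "y \<in> P 0" "z \<in> P 0" "w \<in> P 0" "x * w - y * z = 1"
      using k unfolding kk SL2OF_mat2 by auto
    show ?thesis
    proof (cases "w \<in> P 1")
      case False
      then show ?thesis using unit_case[OF kk k] e by (auto simp: P_iff)
    next
      case True
      \<comment> \<open>Determinant 1 makes z a unit when w is not. Exchanging the columns by a Weyl
        element reduces to the unit case.\<close>
      have "z \<notin> P 1"
      proof
        assume "z \<in> P 1"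
        hence "x * w - y * z \<in> P 1" using True e P_mult'[of x 0 w 1 1] P_mult'[of y 0 z 1 1] by (intro P_diff) auto
        then show False using e(9) by simp
      qed
      hence zz: "z \<noteq> 0" "v z = 0" using e(7) by (auto simp: P_iff)
      let ?k = "mat2 (- y) x (- w) z"
      have "?k \<in> SL2OF X" using e by (simp add: SL2OF_mat2 algebra_simps)
      hence 1: "rtrans (dconj \<pi> ?k) f = f" using unit_case[OF refl _ zz] by blast
      have "dconj \<pi> ?k = dconj \<pi> k ** weyl_of (inverse \<pi>)"
        by (simp add: kk weyl_of_def field_simps)
      hence "rtrans (dconj \<pi> k) (rtrans (weyl_of (inverse \<pi>)) f) = f" using 1 by (simp add: rtrans_rtrans)
      then show ?thesis using fweyl_of[of "inverse \<pi>"] by simp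
    qed
  qed
  have "eta0 \<eta> (conj_fun \<pi> f)" unfolding eta0_def
  proof (intro ballI)
    fix k t assume k: "k \<in> SL2OF X" and t: "t \<in> OE_units X"
    have t': "t \<noteq> 0" "v t = 0" using t by (auto simp: OE_units_iff)
    have "dconj \<pi> (tdiag X t) = tdiag X t" by (simp add: tdiag_mat2)
    moreover have "rtrans (tdiag X t) f = cscale (\<eta> (inverse (\<sigma> t))) f"
      using fe[OF tdiag_Kbar[OF t']] by (simp add: tdiag_mat2)
    ultimately show "rtrans (k ** tdiag X t) (conj_fun \<pi> f) = cscale (\<eta> (inverse (\<sigma> t))) (conj_fun \<pi> f)"
      using sl[OF k] by (simp add: rtrans_conj_fun dconj_mult rtrans_rtrans[symmetric] rtrans_cscale conj_fun_cscale)
  qed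
  moreover have "\<forall>u\<in>OF_units X. \<eta> u = 1" using \<eta>u by (simp add: OF_units_iff)
  ultimately show ?thesis using fV by (simp add: eta_space'_0)
qed

text \<open>Invariance under n(P^(-1)) gives \<open>xi y = 1\<close> for valuation -1, and a torus
  element fixing f gives \<open>xi \<pi> = 1\<close>. So \<open>phi f\<close> is constant, f is
  fixed by all of N, and every \<open>Lam a\<close> kills it.\<close>

lemma level_0_absurd:
  assumes V: "subrep X V PS" "irreducible_rep X V" "infinite_dim V" and f: "f \<in> V" "f \<noteq> 0"
    and sl: "\<And>k. k \<in> SL2OF X \<Longrightarrow> rtrans k f = f"
    and fx: "\<And>y. y \<in> K \<Longrightarrow> y \<in> P (- 1) \<Longrightarrow> rtrans (unip y) f = f"
  shows False
proof -
  have fP: "f \<in> PS" using subrepD(1)[OF V(1) f(1)] .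
  have phi: "phi f x = (if x \<in> P 0 then f (mat 1) else xi x * f (mat 1))" if "x \<in> K" for x
    by (rule fixed_phi[OF fP _ that]) (rule sl)
  have f1: "f (mat 1) \<noteq> 0"
  proof
    assume "f (mat 1) = 0"
    hence "f = 0" using phi by (intro PS_ext[OF fP PS_0]) auto
    then show False using f(2) by blast
  qed
  have xi1: "xi y = 1" if y: "y \<in> K" "y \<noteq> 0" "v y = - 1" for y
  proof -
    have "phi f (0 + y) = phi f 0"
      using phi_rtrans_unip[of y f 0] fx[OF y(1)] y by (simp add: P_iff)
    then show ?thesis using phi[OF y(1)] phi[of 0] f1 y by (simp add: P_iff)
  qed
  \<comment> \<open>This torus element is a product of two Weyl elements, one fixing f by
    \<open>weyl_of_eq\<close> and the other lying in SL_2(O_F).\<close>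
  have "weyl_of (inverse \<pi>) ** mat2 0 (- 1) 1 0 = tdiag X (inverse \<pi>)"
    by (simp add: weyl_of_def tdiag_mat2)
  moreover have "rtrans (weyl_of (inverse \<pi>) ** mat2 0 (- 1) 1 0) f = f"
    unfolding weyl_of_eq[of "inverse \<pi>", simplified]
    by (intro rtrans_fixes_mult fx sl) (auto simp: P_iff SL2OF_mat2)
  ultimately have "rtrans (tdiag X (inverse \<pi>)) f (mat 1) = f (mat 1)" by simp
  hence "chi (inverse \<pi>) * Q = 1" using rtrans_tdiag_1[OF fP, of "inverse \<pi>"] f1 by simp
  hence xip: "xi \<pi> = 1" by (simp add: xi_def)
  have xipow: "xi (\<pi> ^ n) = 1" for n
  proof (induction n)
    case (Suc n) then show ?case using xi_mult[of \<pi> "\<pi> ^ n"] xip by simp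
  qed (simp add: xi_def)
  have xiall: "xi x = 1" if x: "x \<in> K" "x \<notin> P 0" for x
  proof -
    have x0: "x \<noteq> 0" "v x < 0" using x by (auto simp: P_iff)
    define n where "n = nat (- 1 - v x)"
    have "v (x * \<pi> ^ n) = - 1" using x0 by (simp add: n_def)
    hence "xi (x * \<pi> ^ n) = 1" using xi1[of "x * \<pi> ^ n"] x x0 by simp
    then show ?thesis using xi_mult[of x "\<pi> ^ n"] x0 xipow by simp
  qed
  have const: "phi f x = f (mat 1)" if "x \<in> K" for x using phi[OF that] xiall[OF that] by simp
  have "f = 0"
  proof (rule kirillov_inj[OF V f(1)])
    fix a assume a: "a \<in> K" "a \<noteq> 0"
    have "a \<notin> P (- (- v a - 1))" using a by (simp add: P_iff)
    then obtain y where y: "y \<in> K" "\<psi> (a * y) \<noteq> 1" using psi_nontriv_at[OF a(1)] by blast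
    have "rtrans (unip y) f \<in> PS" using subrepD(1,5)[OF V(1)] f(1) y by simp
    hence "rtrans (unip y) f = f" using const rtrans_unip_1[OF fP y(1)] y by (intro PS_ext[OF _ fP]) auto
    then show "Lam a f = 0" using Lam_zero_of_fixed[OF fP a y(1)] y by blast
  qed
  then show False using f(2) by blast
qed

lemma newform_Lam_nz:
  assumes V: "subrep X V PS" "irreducible_rep X V" "infinite_dim V"
    and \<eta>: "eta_compatible X V \<eta>" "cond_eta X V \<eta> = enat c"
    and f: "f \<in> eta_space X V \<eta> c" "f \<noteq> 0"
  shows "Lam 1 f \<noteq> 0"
proof
  assume z: "Lam 1 f = 0"
  have \<eta>1: "\<eta> 1 = 1" using \<eta>(1) eta_char_1 by (simp add: eta_compatible_def)
  \<comment> \<open>The minimum ranges over both families of groups, so the primed spaces below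
    level c vanish too.\<close>
  have not_less: "eta_space' X V \<eta> m = {0}" if "m < c" for m
    using cond_eta_le[of V \<eta> m] \<eta>(2) that by (metis enat_ord_simps(1) linorder_not_le)
  show False
  proof (cases "c = 0")
    case True
    have e: "f \<in> V" "eta0 \<eta> f" using f True by (auto simp: eta_space_0 split: if_splits)
    have t1: "tdiag X 1 = mat 1" "1 \<in> OE_units X" by (auto simp: tdiag_mat2 mat_mat2 OE_units_iff)
    have sl: "rtrans k f = f" if "k \<in> SL2OF X" for k
    proof -
      have "rtrans (k ** tdiag X 1) f = cscale (\<eta> (inverse (\<sigma> 1))) f"
        using e(2) that t1(2) unfolding eta0_def by blast
      then show ?thesis using t1(1) \<eta>1 by simp
    qed
    have td: "\<exists>k. rtrans (tdiag X t) f = cscale k f" if "t \<noteq> 0" "v t = 0" for t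
    proof -
      have "t \<in> OE_units X" using that by (simp add: OE_units_iff)
      hence "rtrans (mat 1 ** tdiag X t) f = cscale (\<eta> (inverse (\<sigma> t))) f"
        using e(2) mat1_SL2OF unfolding eta0_def by blast
      then show ?thesis by auto
    qed
    have un: "rtrans (unip x) f = f" if "x \<in> K" "x \<in> P 0" for x
      using that by (intro sl) (simp add: unip_def SL2OF_mat2)
    show False
      by (rule level_0_absurd[OF V e(1) f(2) sl killed_imp_fixed[OF V e(1) un td z]])
  next
    case False
    have e: "f \<in> V" "\<And>g. g \<in> Kbar X c \<Longrightarrow> rtrans g f = cscale (\<eta> (g $ 2 $ 2)) f"
      using f False by (auto simp: eta_space_pos)
    have td: "\<exists>k. rtrans (tdiag X t) f = cscale k f" if "t \<noteq> 0" "v t = 0" for t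
      using e(2)[OF tdiag_Kbar[OF that]] by blast
    have un: "rtrans (unip x) f = f" if "x \<in> K" "x \<in> P 0" for x
      using e(2)[OF unip_Kbar[OF that]] \<eta>1 by (simp add: unip_def)
    have fx: "rtrans (unip y) f = f" if "y \<in> K" "y \<in> P (- 1)" for y
      by (rule killed_imp_fixed[OF V e(1) _ _ z that]) (fact un, fact td)
    show False
    proof (cases "c = 1")
      case True
      have "f \<in> eta_space' X V \<eta> 0"
        by (rule level_drop_1[where \<eta> = \<eta>, OF V(1) \<eta>1 f(1)[unfolded True] f(2)]) (rule fx)
      then show False using not_less[of 0] True f(2) by simp
    next
      case c1: False
      have "f \<in> eta_space' X V \<eta> (c - 1)"
        by (rule level_drop[where \<eta> = \<eta>, OF V(1) _ \<eta>1 f(1)]) (use False c1 fx in simp_all)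
      then show False using not_less[of "c - 1"] False f(2) by simp
    qed
  qed
qed

subsection \<open>Representations without a Whittaker functional\<close>

text \<open>The Fourier transform of this function is supported on the single shell \<open>v a = - j\<close>.\<close>

definition ball_diff :: "int \<Rightarrow> 'e \<Rightarrow> complex" where
  "ball_diff j x = (if x \<in> P j then 1 else 0) - (if x \<in> P (j - 1) then 1 / Q else 0)"

text \<open>A Ramanujan sum: the units are O_F minus P, and a character integrates to a volume or to
  zero over each.\<close>

lemma sum_units:
  assumes Y: "reps K 0 M Y" and M: "1 \<le> M" and b: "b \<in> K" "b \<in> P (- M)"
  shows "(\<Sum>u\<in>{u \<in> Y. u \<notin> P 1}. \<psi> (b * u)) =
    Q powi M * ((if b \<in> P 0 then 1 else 0) - (if b \<in> P (- 1) then 1 / Q else 0))"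
proof -
  let ?h = "\<lambda>u. if u \<in> P 1 then 0 else \<psi> (b * u)"
  let ?h1 = "\<lambda>u. if u \<in> P 1 then \<psi> (b * u) else 0"
  have p: "periodic M (\<lambda>u. \<psi> (b * u))" using b by (intro periodic_psi)
  have ph: "periodic M ?h"
  proof (rule periodicI)
    fix x y assume xy: "x \<in> K" "y \<in> K" "y \<in> P M"
    hence "x + y \<in> P 1 \<longleftrightarrow> x \<in> P 1" using P_mono[OF _ M] by (intro P_add_iff) blast
    then show "?h (x + y) = ?h x" using periodicD[OF p xy] by simp
  qed
  have "(\<Sum>u\<in>{u \<in> Y. u \<notin> P 1}. \<psi> (b * u)) = (\<Sum>u\<in>Y. if u \<notin> P 1 then \<psi> (b * u) else 0)"
    by (rule sum.inter_filter[OF repsD(1)[OF Y]])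
  also have "\<dots> = sum ?h Y" by (intro sum.cong) auto
  also have "\<dots> = Q powi M * J 0 ?h"
    using J_reps[OF Y ph] M by (simp add: power_int_minus)
  also have "J 0 ?h = J 0 (\<lambda>u. \<psi> (b * u) - ?h1 u)" by (intro J_cong) auto
  also have "\<dots> = J 0 (\<lambda>u. \<psi> (b * u)) - J 0 ?h1"
    using b by (intro J_diff ulc_if_P ulc_psi ulc_const)
  also have "\<dots> = (if b \<in> P 0 then 1 else 0) - (if b \<in> P (- 1) then 1 / Q else 0)"
    using b J_psi[of b 0] J_psi[of b 1] J_restrict[of 0 1 "\<lambda>u. \<psi> (b * u)"]
    by (simp add: power_int_minus divide_inverse)
  finally show ?thesis .
qed

text \<open>Summing the bump \<open>\<psi>\<^sub>a 1\<close> on a large ball over its translates by units removes the dependence on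
  everything but the valuation of \<open>a\<close>.\<close>

lemma ball_diff_mem:
  assumes V: "subrep X V PS" and f: "f \<in> V" and a: "a \<in> K" "a \<noteq> 0" and nz: "Lam a f \<noteq> 0"
  shows "\<exists>g\<in>V. g (mat 1) = 0 \<and> (\<forall>x\<in>K. phi g x = ball_diff (- v a) x)"
proof -
  note VD = subrepD[OF V]
  obtain r0 where r0: "\<And>r. r0 \<le> r \<Longrightarrow> \<exists>g\<in>V. g (mat 1) = 0 \<and>
    (\<forall>x\<in>K. phi g x = (if x \<in> P (- r) then \<psi> (a * x) else 0))" using psi_bump_mem[OF V f a nz] by blast
  \<comment> \<open>The ball P^(-r) must contain P^(-v a - 1), and M is the precision to which u
    matters in \<psi>(aux) for x in P^(-r).\<close>
  define r where "r = max r0 (v a + 1)"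
  define M where "M = r - v a"
  have M1: "1 \<le> M" by (simp add: M_def r_def)
  obtain g where g: "g \<in> V" "g (mat 1) = 0" "\<And>x. x \<in> K \<Longrightarrow> phi g x = (if x \<in> P (- r) then \<psi> (a * x) else 0)"
    using r0[of r] by (auto simp: r_def)
  have gP: "g \<in> PS" using VD(1)[OF g(1)] .
  obtain Y where Y: "reps K 0 M Y" using reps_ex_card[of 0 M] M1 by auto
  define Yu where "Yu = {u \<in> Y. u \<notin> P 1}"
  have Yu: "u \<in> K" "u \<noteq> 0" "v u = 0" if "u \<in> Yu" for u
    using that repsD(2,3)[OF Y] by (auto simp: Yu_def P_iff)
  have "\<exists>h\<in>V. h (mat 1) = 0 \<and> (\<forall>x\<in>K. phi h x = phi g (u * x))" if u: "u \<in> Yu" for u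
  proof -
    \<comment> \<open>A torus element of norm 1/u replaces x by ux, up to a scalar that is divided
      out.\<close>
    obtain t where t: "t \<noteq> 0" "v t = 0" "t * \<sigma> t = inverse u"
      using norm_surj_units[of "inverse u"] Yu[OF u] by auto
    define k where "k = chi (inverse (\<sigma> t)) * Q powi v t"
    have k: "k \<noteq> 0" using t by (simp add: k_def)
    have hV: "rtrans (tdiag X t) g \<in> V" using VD(5)[OF g(1)] t by simp
    have "phi (cscale (inverse k) (rtrans (tdiag X t) g)) x = phi g (u * x)" if x: "x \<in> K" for x
    proof -
      have "phi (rtrans (tdiag X t) g) x = k * phi g (x / inverse u)"
        using phi_rtrans_tdiag[OF gP t(1) x] unfolding t(3) k_def .
      moreover have "x / inverse u = u * x" by (simp add: divide_inverse mult.commute)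
      ultimately show ?thesis using k by (simp add: field_simps)
    qed
    moreover have "cscale (inverse k) (rtrans (tdiag X t) g) (mat 1) = 0"
      using rtrans_tdiag_1[OF gP t(1)] g(2) by (simp add: cscale_def)
    ultimately show ?thesis using VD(4)[OF hV] by blast
  qed
  then obtain H where H: "\<And>u. u \<in> Yu \<Longrightarrow> H u \<in> V" "\<And>u. u \<in> Yu \<Longrightarrow> H u (mat 1) = 0"
    "\<And>u x. u \<in> Yu \<Longrightarrow> x \<in> K \<Longrightarrow> phi (H u) x = phi g (u * x)" by metis
  define S where "S = cscale (Q powi (- M)) (\<Sum>u\<in>Yu. H u)"
  have "S \<in> V" unfolding S_def by (intro VD(4) VD(7) H(1))
  moreover have "S (mat 1) = 0" using H(2) by (simp add: S_def cscale_def sum_fun_apply)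
  moreover have "phi S x = ball_diff (- v a) x" if x: "x \<in> K" for x
  proof -
    have "phi S x = Q powi (- M) * (\<Sum>u\<in>Yu. phi g (u * x))"
      using H(3) x by (simp add: S_def phi_sum)
    also have "(\<Sum>u\<in>Yu. phi g (u * x)) = (\<Sum>u\<in>Yu. if x \<in> P (- r) then \<psi> ((a * x) * u) else 0)"
    proof (rule sum.cong[OF refl])
      fix u assume u: "u \<in> Yu"
      have "u * x \<in> P (- r) \<longleftrightarrow> x \<in> P (- r)" using Yu[OF u] by (cases "x = 0") (auto simp: P_iff)
      then show "phi g (u * x) = (if x \<in> P (- r) then \<psi> ((a * x) * u) else 0)"
        using g(3)[of "u * x"] Yu[OF u] x by (simp add: mult_ac)
    qed
    also have "Q powi (- M) * \<dots> = ball_diff (- v a) x"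
    proof (cases "x \<in> P (- r)")
      case True
      have "a * x \<in> P (- M)" using True a by (cases "x = 0") (auto simp: P_iff M_def)
      hence "(\<Sum>u\<in>Yu. \<psi> ((a * x) * u)) = Q powi M *
          ((if a * x \<in> P 0 then 1 else 0) - (if a * x \<in> P (- 1) then 1 / Q else 0))"
        unfolding Yu_def using sum_units[OF Y M1, of "a * x"] a x by simp
      moreover have "a * x \<in> P 0 \<longleftrightarrow> x \<in> P (- v a)" "a * x \<in> P (- 1) \<longleftrightarrow> x \<in> P (- v a - 1)"
        using a by (cases "x = 0"; auto simp: P_iff)+
      ultimately show ?thesis using True by (simp add: ball_diff_def power_int_minus)
    next
      case False
      moreover have "- r \<le> - v a - 1" "- r \<le> - v a" by (auto simp: r_def)
      ultimately have "x \<notin> P (- v a - 1)" "x \<notin> P (- v a)" using P_mono by blast+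
      then show ?thesis using False by (simp add: ball_diff_def)
    qed
    finally show ?thesis .
  qed
  ultimately show ?thesis by blast
qed

text \<open>The Weyl element inverts x and so turns balls into complements of balls. The value at 1
  is now nonzero, and the result behaves like \<open>xi\<close> near infinity: its Fourier
  coefficients test chi.\<close>

lemma weyl_ball_diff:
  assumes V: "subrep X V PS" and g: "g \<in> V" "g (mat 1) = 0" "\<forall>x\<in>K. phi g x = ball_diff j x"
  shows "rtrans weyl g \<in> V" "rtrans weyl g (mat 1) = 1 - 1 / Q"
    "\<And>x. x \<in> K \<Longrightarrow> phi (rtrans weyl g) x =
      xi x * ((if x \<in> P (1 - j) then 0 else 1) - (if x \<in> P (2 - j) then 0 else 1 / Q))"
proof -
  have gP: "g \<in> PS" using subrepD(1)[OF V g(1)] .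
  show "rtrans weyl g \<in> V" using subrepD(5)[OF V g(1)] by simp
  show "rtrans weyl g (mat 1) = 1 - 1 / Q" using bspec[OF g(3) K_0] by (simp add: rtrans_weyl_1 ball_diff_def)
  fix x assume x: "x \<in> K"
  show "phi (rtrans weyl g) x =
      xi x * ((if x \<in> P (1 - j) then 0 else 1) - (if x \<in> P (2 - j) then 0 else 1 / Q))"
  proof (cases "x = 0")
    case True
    then show ?thesis using phi_rtrans_weyl(2)[OF gP x] g(2) by simp
  next
    case False
    have "- inverse x \<in> P j \<longleftrightarrow> x \<notin> P (1 - j)" "- inverse x \<in> P (j - 1) \<longleftrightarrow> x \<notin> P (2 - j)"
      using False by (auto simp: P_iff)
    then show ?thesis using phi_rtrans_weyl(1)[OF gP x False] bspec[OF g(3), of "- inverse x"] x by (simp add: ball_diff_def)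
  qed
qed

lemma unit_one_P: "u \<noteq> 0 \<Longrightarrow> v u = 0 \<Longrightarrow> u * x \<in> P n \<longleftrightarrow> x \<in> P n"
  by (cases "x = 0") (auto simp: P_iff)

lemma Q_fact: "1 - 1 / Q \<noteq> 0" "1 + 1 / Q \<noteq> 0" "1 - 1 / (Q * Q) \<noteq> 0"
proof -
  have "1 < q * q" using less_1_mult[OF q_gt1 q_gt1] .
  hence "q \<noteq> 1" "q \<noteq> - 1" "q * q \<noteq> 1" using q_gt1 by linarith+
  hence "1 - 1 / q \<noteq> 0" "1 + 1 / q \<noteq> 0" "1 - 1 / (q * q) \<noteq> 0"
    by (auto simp: field_simps)
  moreover have "1 - 1 / Q = complex_of_real (1 - 1 / q)" "1 + 1 / Q = complex_of_real (1 + 1 / q)"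
    "1 - 1 / (Q * Q) = complex_of_real (1 - 1 / (q * q))" by simp_all
  ultimately show "1 - 1 / Q \<noteq> 0" "1 + 1 / Q \<noteq> 0" "1 - 1 / (Q * Q) \<noteq> 0"
    by (simp_all only: of_real_eq_0_iff not_False_eq_True)
qed

text \<open>The index b has valuation j - 1, of the wrong parity, so its coefficient vanishes. At
  stage j only the shells of valuation -j and 1 - j contribute, and up to nonzero factors the sum is
  (1 - 1/Q)(1/Q + \<zeta>) with \<zeta> = chi \<pi> / Q.\<close>

lemma nongeneric_unram_chi_value:
  assumes V: "subrep X V PS" and s: unram_chi and f: "f \<in> V" and a: "a \<in> K" "a \<noteq> 0" and nz: "Lam a f \<noteq> 0"
    and z: "\<And>b f. b \<in> K \<Longrightarrow> b \<noteq> 0 \<Longrightarrow> odd (v b - v a) \<Longrightarrow> f \<in> V \<Longrightarrow> Lam b f = 0"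
  shows "chi \<pi> = - 1"
proof -
  define j where "j = - v a"
  obtain g where g: "g \<in> V" "g (mat 1) = 0" "\<forall>x\<in>K. phi g x = ball_diff j x"
    using ball_diff_mem[OF V f a nz] by (auto simp: j_def)
  note h = weyl_ball_diff[OF V g]
  let ?f = "rtrans weyl g"
  have fP: "?f \<in> PS" using subrepD(1)[OF V h(1)] .
  define b where "b = \<pi> powi (j - 1)"
  have b: "b \<in> K" "b \<noteq> 0" "v b = j - 1" by (auto simp: b_def)
  have as: "asymp ?f (j - 1)" unfolding asymp_def
  proof (intro ballI impI)
    fix x assume x: "x \<in> K" "x \<notin> P (- (j - 1))"
    hence "x \<notin> P (1 - j)" "x \<notin> P (2 - j)" using P_mono[of x "2 - j" "1 - j"] by auto
    then show "phi ?f x = xi x * ?f (mat 1)" using h(2,3) x by simp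
  qed
  define \<zeta> where "\<zeta> = chi \<pi> / Q"
  define c0 where "c0 = \<zeta> powi j * (1 - 1 / Q)"
  define c1 where "c1 = - (\<zeta> powi (j - 1) / Q)"
  have \<zeta>0: "\<zeta> \<noteq> 0" by (simp add: \<zeta>_def)
  have "odd (v b - v a)" using b by (simp add: j_def)
  hence "0 = Lam b ?f" using z b h(1) by simp
  also have "\<dots> = trunc j b ?f"
    by (rule Lam_eq[OF fP as unram_chi_trivK[OF s] b(1,2)]) (use b in auto)
  also have "\<dots> = J (- j) (\<lambda>x. c0 * \<psi> (- b * x) + ((if x \<in> P (1 - j) then (c1 - c0) * \<psi> (- b * x) else 0) +
      (if x \<in> P (2 - j) then - c1 * \<psi> (- b * x) else 0)))"
    unfolding trunc_def
  proof (rule J_cong)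
    fix x assume x: "x \<in> K" "x \<in> P (- j)"
    consider "x \<in> P (2 - j)" | "x \<notin> P (2 - j)" "x \<in> P (1 - j)" | "x \<notin> P (1 - j)" by blast
    then show "phi ?f x * \<psi> (- b * x) = c0 * \<psi> (- b * x) + ((if x \<in> P (1 - j) then (c1 - c0) * \<psi> (- b * x) else 0) +
      (if x \<in> P (2 - j) then - c1 * \<psi> (- b * x) else 0))"
    proof cases
      case 1
      then show ?thesis using h(3)[OF x(1)] P_mono[OF 1, of "1 - j"] by (simp add: algebra_simps)
    next
      case 2
      hence "x \<noteq> 0" "- v x = j - 1" by (auto simp: P_iff)
      hence "xi x = \<zeta> powi (j - 1)" using unram_chi_xi[OF s x(1)] by (simp only: \<zeta>_def not_False_eq_True)
      then show ?thesis using h(3)[OF x(1)] 2 by (simp add: c1_def algebra_simps)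
    next
      case 3
      hence "x \<notin> P (2 - j)" using P_mono[of x "2 - j" "1 - j"] by auto
      moreover have "x \<noteq> 0" "v x = - j" using 3 x by (auto simp: P_iff)
      ultimately show ?thesis using h(3)[OF x(1)] 3 unram_chi_xi[OF s x(1)] by (simp add: c0_def \<zeta>_def)
    qed
  qed
  also have "\<dots> = J (- j) (\<lambda>x. c0 * \<psi> (- b * x)) + (J (- j) (\<lambda>x. if x \<in> P (1 - j) then (c1 - c0) * \<psi> (- b * x) else 0) +
      J (- j) (\<lambda>x. if x \<in> P (2 - j) then - c1 * \<psi> (- b * x) else 0))"
    using b by (subst J_add J_add, (intro ulc_add ulc_if_P ulc_mult ulc_psi ulc_const; simp)+)+ simp
  also have "J (- j) (\<lambda>x. c0 * \<psi> (- b * x)) = 0"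
    using b by (subst J_cmult, subst J_psi) (auto simp: P_iff)
  also have "J (- j) (\<lambda>x. if x \<in> P (1 - j) then (c1 - c0) * \<psi> (- b * x) else 0) = (c1 - c0) * Q powi (j - 1)"
    using b by (subst J_restrict, simp, subst J_cmult, subst J_psi) (auto simp: P_iff)
  also have "J (- j) (\<lambda>x. if x \<in> P (2 - j) then - c1 * \<psi> (- b * x) else 0) = - c1 * Q powi (j - 2)"
    using b by (subst J_restrict, simp, subst J_cmult, subst J_psi) (auto simp: P_iff)
  finally have e: "(c1 - c0) * Q powi (j - 1) - c1 * Q powi (j - 2) = 0" by simp
  have q2: "Q powi (j - 2) = Q powi (j - 1) / Q"
    using power_int_diff[of Q "j - 1" 1] by (simp add: algebra_simps)
  have z1: "\<zeta> powi j = \<zeta> powi (j - 1) * \<zeta>"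
    using power_int_add_1[of \<zeta> "j - 1"] \<zeta>0 by simp
  have "(\<zeta> powi (j - 1) * Q powi (j - 1)) * ((1 - 1 / Q) * (1 / Q + \<zeta>)) = 0"
    using e unfolding c0_def c1_def q2 z1 by (simp add: algebra_simps)
  hence "1 / Q + \<zeta> = 0" using \<zeta>0 Q_fact(1) by simp
  hence "Q * (1 / Q + chi \<pi> / Q) = 0" unfolding \<zeta>_def by simp
  hence "1 + chi \<pi> = 0" by (simp add: distrib_left)
  then show ?thesis by (simp add: add_eq_0_iff)
qed

text \<open>n is the least level of chi on F and u shows that n - 1 is not a level. For n = 1 the
  condition on u is membership in P^0, and u may be any unit on which chi is nontrivial.\<close>

lemma ex_conductor:
  assumes "\<not> unram_chi"
  obtains n u where "chi_trivK n" "u \<in> K" "u \<noteq> 0" "v u = 0" "u - 1 \<in> P (n - 1)" "chi u \<noteq> 1"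
proof -
  obtain m0 where "chi_trivK m0" using ex_chi_triv chi_triv_imp_chi_trivK by blast
  hence ex: "\<exists>m::nat. chi_trivK (int m)" by (intro exI[of _ "nat m0"]) (simp add: chi_trivK_def)
  define m where "m = (LEAST m::nat. chi_trivK (int m))"
  have m: "chi_trivK (int m)" unfolding m_def by (rule LeastI_ex[OF ex])
  have m1: "1 \<le> int m" using m by (simp add: chi_trivK_def)
  show ?thesis
  proof (cases "m = 1")
    case True
    obtain u where u: "u \<in> K" "u \<noteq> 0" "v u = 0" "chi u \<noteq> 1"
      using assms by (auto simp: unram_chi_def OF_units_iff)
    have "u - 1 \<in> P (int m - 1)" using u True by (intro P_diff) (auto simp: P_iff)
    then show ?thesis using that[OF m u(1-3) _ u(4)] by blast
  next
    case False
    have "m - 1 < m" using m1 by simp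
    hence "\<not> chi_trivK (int (m - 1))" unfolding m_def by (rule not_less_Least)
    moreover have "int (m - 1) = int m - 1" "1 \<le> int m - 1" using m1 False by auto
    ultimately obtain u where u: "u \<in> K" "u - 1 \<in> P (int m - 1)" "chi u \<noteq> 1" by (auto simp: chi_trivK_def)
    have "u \<noteq> 0" "v u = 0" using one_unit_nz[OF u(2)] \<open>1 \<le> int m - 1\<close> by auto
    then show ?thesis using that[OF m u(1) _ _ u(2,3)] by blast
  qed
qed

text \<open>The Gauss sum attached to a ramified \<open>\<chi>\<close> does not vanish, because by Fourier inversion the
  function \<open>\<chi>\<^sup>-\<^sup>1\<close> on a single shell would otherwise be zero.\<close>

lemma nongeneric_unram_chi:
  assumes V: "subrep X V PS" and f: "f \<in> V" and a: "a \<in> K" "a \<noteq> 0" and nz: "Lam a f \<noteq> 0"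
    and z: "\<And>b f. b \<in> K \<Longrightarrow> b \<noteq> 0 \<Longrightarrow> odd (v b - v a) \<Longrightarrow> f \<in> V \<Longrightarrow> Lam b f = 0"
  shows unram_chi
proof (rule ccontr)
  assume "\<not> unram_chi"
  then obtain n u where n: "chi_trivK n" and u: "u \<in> K" "u \<noteq> 0" "v u = 0" "u - 1 \<in> P (n - 1)" "chi u \<noteq> 1"
    by (rule ex_conductor)
  have n1: "1 \<le> n" using n by (simp add: chi_trivK_def)
  define j where "j = - v a"
  \<comment> \<open>The critical index for the shell of valuation -k has valuation k - n = j + 1, of
    the wrong parity; and the shell lies where the Weyl translate is a constant times
    \<open>xi\<close>.\<close>
  define k where "k = j + n + 1"
  obtain g where g: "g \<in> V" "g (mat 1) = 0" "\<forall>x\<in>K. phi g x = ball_diff j x"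
    using ball_diff_mem[OF V f a nz] by (auto simp: j_def)
  note w = weyl_ball_diff[OF V g]
  let ?f = "rtrans weyl g"
  have fP: "?f \<in> PS" using subrepD(1)[OF V w(1)] .
  have as: "asymp ?f (j - 1)" unfolding asymp_def
  proof (intro ballI impI)
    fix x assume x: "x \<in> K" "x \<notin> P (- (j - 1))"
    hence "x \<notin> P (1 - j)" "x \<notin> P (2 - j)" using P_mono[of x "2 - j" "1 - j"] by auto
    then show "phi ?f x = xi x * ?f (mat 1)" using w(2,3) x by simp
  qed
  have xiu: "xi u \<noteq> 1" using u by (simp add: xi_def chi_inverse)
  have phiu: "phi ?f (u * x) = xi u * phi ?f x" if x: "x \<in> K" for x
    using w(3)[OF x] w(3)[of "u * x"] xi_mult[of u x] x u unit_one_P[OF u(2,3), of x]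
    by (cases "x = 0") auto
  have psiu: "\<psi> (- b * (u * x)) = \<psi> (- b * x)" if "b \<in> K" "x \<in> K" "b * x \<in> P (1 - n)" for b x
  proof -
    have "(b * x) * (u - 1) \<in> P 0" using P_mult'[OF that(3) u(4)] by simp
    hence "\<psi> (- (b * x * (u - 1))) = 1" using that u by (intro psi_eq_1) auto
    moreover have "- b * (u * x) = - b * x + (- (b * x * (u - 1)))" by (simp add: algebra_simps)
    ultimately show ?thesis using psi_add[of "- b * x" "- (b * x * (u - 1))"] that u by simp
  qed
  define h where "h x = (if x \<in> P (- k) \<and> x \<notin> P (1 - k) then xi x else 0)" for x
  have hper: "periodic (n - k) h"
  proof (rule periodicI)
    fix x y assume xy: "x \<in> K" "y \<in> K" "y \<in> P (n - k)"
    have "x + y \<in> P (- k) \<longleftrightarrow> x \<in> P (- k)" "x + y \<in> P (1 - k) \<longleftrightarrow> x \<in> P (1 - k)"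
      using P_mono[OF xy(3), of "- k"] P_mono[OF xy(3), of "1 - k"] n1 by (auto simp: P_add_iff)
    moreover have "xi (x + y) = xi x" if "x \<in> P (- k)" "x \<notin> P (1 - k)"
    proof -
      have "x \<noteq> 0" "v x = - k" using that by (auto simp: P_iff)
      then show ?thesis using xi_add[OF n, of x y] xy by simp
    qed
    ultimately show "h (x + y) = h x" by (auto simp: h_def)
  qed
  have uh: "ulc h" using hper by (rule ulcI)
  have hu: "h (u * x) = xi u * h x" if "x \<in> K" for x
    using xi_mult[of u x] u unit_one_P[OF u(2,3), of x] by (cases "x = 0") (auto simp: h_def)
  have upsi: "ulc (\<lambda>x. h x * \<psi> (- b * x))" if "b \<in> K" for b
    using that uh by (intro ulc_mult ulc_psi) auto
  have main: "J (- k) (\<lambda>x. h x * \<psi> (- b * x)) = 0" if b: "b \<in> K" "b \<noteq> 0" "v b = k - n" for b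
  proof -
    have "odd (v b - v a)" using b by (simp add: k_def j_def)
    hence "0 = Lam b ?f" using z b w(1) by simp
    also have "\<dots> = trunc k b ?f"
      by (rule Lam_eq[OF fP as n b(1,2)]) (use b n1 in \<open>auto simp: k_def\<close>)
    also have "\<dots> = J (- k) (\<lambda>x. (1 - 1 / Q) * (h x * \<psi> (- b * x)) +
        (if x \<in> P (1 - k) then phi ?f x * \<psi> (- b * x) else 0))" unfolding trunc_def
    proof (rule J_cong)
      fix x assume x: "x \<in> K" "x \<in> P (- k)"
      show "phi ?f x * \<psi> (- b * x) = (1 - 1 / Q) * (h x * \<psi> (- b * x)) +
        (if x \<in> P (1 - k) then phi ?f x * \<psi> (- b * x) else 0)"
      proof (cases "x \<in> P (1 - k)")
        case True then show ?thesis by (simp add: h_def)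
      next
        case False
        moreover have "1 - k \<le> 1 - j" "1 - k \<le> 2 - j" using n1 by (auto simp: k_def)
        ultimately have "x \<notin> P (1 - j)" "x \<notin> P (2 - j)" using P_mono by blast+
        then show ?thesis using w(3)[OF x(1)] False x(2) by (simp add: h_def)
      qed
    qed
    also have "\<dots> = J (- k) (\<lambda>x. (1 - 1 / Q) * (h x * \<psi> (- b * x))) +
        J (- k) (\<lambda>x. if x \<in> P (1 - k) then phi ?f x * \<psi> (- b * x) else 0)"
    proof (rule J_add)
      show "ulc (\<lambda>x. (1 - 1 / Q) * (h x * \<psi> (- b * x)))" by (rule ulc_mult[OF ulc_const upsi[OF b(1)]])
      show "ulc (\<lambda>x. if x \<in> P (1 - k) then phi ?f x * \<psi> (- b * x) else 0)"
        by (rule ulc_if_P[OF ulc_phi_psi[OF fP b(1)] ulc_const])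
    qed
    also have "J (- k) (\<lambda>x. if x \<in> P (1 - k) then phi ?f x * \<psi> (- b * x) else 0) =
        J (1 - k) (\<lambda>x. phi ?f x * \<psi> (- b * x))" by (rule J_restrict) simp
    also have "\<dots> = 0"
    \<comment> \<open>On the smaller ball bx lies in P^(1 - n), so replacing x by ux leaves the
      additive character alone and multiplies \<open>phi ?f\<close> by \<open>xi u\<close>.\<close>
    proof (rule J_zero_unit[OF ulc_phi_psi[OF fP b(1)] u(1-3) xiu])
      fix x assume x: "x \<in> K" "x \<in> P (1 - k)"
      have "b * x \<in> P (1 - n)" using x b by (intro P_mult'[of b "k - n" x "1 - k"]) (auto simp: P_iff)
      then show "phi ?f (u * x) * \<psi> (- b * (u * x)) = xi u * (phi ?f x * \<psi> (- b * x))"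
        using phiu[OF x(1)] psiu[OF b(1) x(1)] by simp
    qed
    finally have "(1 - 1 / Q) * J (- k) (\<lambda>x. h x * \<psi> (- b * x)) = 0" by (simp add: J_cmult)
    then show ?thesis using Q_fact(1) by simp
  qed
  \<comment> \<open>Below the critical valuation h is periodic where the character oscillates; above
    it the character ignores u while h does not. Only the critical index needs V.\<close>
  have zero: "J (- k) (\<lambda>x. h x * \<psi> (- b * x)) = 0" if b: "b \<in> K" "b \<noteq> 0" for b
  proof -
    consider "v b = k - n" | "k - n < v b" | "v b < k - n" by linarith
    then show ?thesis
    proof cases
      case 1 then show ?thesis using main b by blast
    next
      case 2
      show ?thesis
      proof (rule J_zero_unit[OF upsi[OF b(1)] u(1-3) xiu])
        fix x assume x: "x \<in> K" "x \<in> P (- k)"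
        have "b * x \<in> P (1 - n)" using x b 2 by (intro P_mult'[of b "k - n + 1" x "- k"]) (auto simp: P_iff)
        then show "h (u * x) * \<psi> (- b * (u * x)) = xi u * (h x * \<psi> (- b * x))"
          using hu[OF x(1)] psiu[OF b(1) x(1)] by simp
      qed
    next
      case 3
      have "- b \<notin> P (- (n - k))" using b 3 by (simp add: P_iff)
      then obtain y where y: "y \<in> K" "y \<in> P (n - k)" "\<psi> (- b * y) \<noteq> 1"
        using psi_nontriv_at[of "- b" "n - k"] b by auto
      show ?thesis
      proof (rule J_zero_translate[OF upsi[OF b(1)] y(1) _ y(3)])
        show "y \<in> P (- k)" using P_mono[OF y(2), of "- k"] n1 by simp
        fix x assume x: "x \<in> K" "x \<in> P (- k)"
        have "\<psi> (- b * (x + y)) = \<psi> (- b * y) * \<psi> (- b * x)"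
          using psi_add[of "- b * x" "- b * y"] b x y by (simp add: distrib_left mult.commute)
        then show "h (x + y) * \<psi> (- b * (x + y)) = \<psi> (- b * y) * (h x * \<psi> (- b * x))"
          using periodicD[OF hper x(1) y(1,2)] by simp
      qed
    qed
  qed
  have "h (\<pi> powi (- k)) = 0"
    by (rule fourier_inj[OF uh _ zero]) (auto simp: h_def)
  then show False by (simp add: h_def P_iff)
qed

section \<open>The conjugate of V by alpha, and sums of subrepresentations\<close>

lemma subrep_conj_fun:
  assumes V: "subrep X V PS"
  shows "subrep X (conj_fun \<pi> ` V) PS"
  unfolding subrep_def
proof (intro conjI ballI)
  note VD = subrepD[OF V]
  show "conj_fun \<pi> ` V \<subseteq> PS" using VD(1) conj_fun_PS by auto
  show "cfun_subspace (conj_fun \<pi> ` V)" unfolding cfun.subspace_def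
  proof (intro conjI ballI allI)
    show "0 \<in> conj_fun \<pi> ` V" using VD(2) by (intro image_eqI[of _ _ 0]) (simp_all only: conj_fun_0)
    fix x y assume "x \<in> conj_fun \<pi> ` V" "y \<in> conj_fun \<pi> ` V"
    then obtain f g where "f \<in> V" "g \<in> V" "x = conj_fun \<pi> f" "y = conj_fun \<pi> g" by blast
    then show "x + y \<in> conj_fun \<pi> ` V" using VD(3) by (intro image_eqI[of _ _ "f + g"]) (simp_all only: conj_fun_add)
  next
    fix c x assume "x \<in> conj_fun \<pi> ` V"
    then obtain f where "f \<in> V" "x = conj_fun \<pi> f" by blast
    then show "cscale c x \<in> conj_fun \<pi> ` V" using VD(4) by (intro image_eqI[of _ _ "cscale c f"]) (simp_all only: conj_fun_cscale)
  qed
  fix g x assume g: "g \<in> U11 X" and "x \<in> conj_fun \<pi> ` V"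
  then obtain f where f: "f \<in> V" "x = conj_fun \<pi> f" by blast
  have "rtrans (dconj \<pi> g) f \<in> V" using VD(5)[OF f(1)] g by simp
  then show "rtrans g x \<in> conj_fun \<pi> ` V" using f(2) by (simp add: rtrans_conj_fun)
qed

lemma irreducible_conj_fun:
  assumes V: "subrep X V PS" "irreducible_rep X V"
  shows "irreducible_rep X (conj_fun \<pi> ` V)"
  unfolding irreducible_rep_def
proof (intro conjI allI impI)
  note VD = subrepD[OF V(1)]
  have inj: "conj_fun \<pi> f = conj_fun \<pi> g \<longleftrightarrow> f = g" for f g by (metis conj_fun_conj_fun(2) unif_nz)
  show "conj_fun \<pi> ` V \<noteq> {0}"
  proof
    assume a: "conj_fun \<pi> ` V = {0}"
    have "f = 0" if "f \<in> V" for f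
    proof -
      have "conj_fun \<pi> f = conj_fun \<pi> 0" using a that by (simp only: conj_fun_0) blast
      then show ?thesis by (simp only: inj)
    qed
    hence "V = {0}" using VD(2) by blast
    then show False using V(2) by (simp add: irreducible_rep_def)
  qed
  fix U assume U: "subrep X U (conj_fun \<pi> ` V)"
  define T where "T = {f \<in> V. conj_fun \<pi> f \<in> U}"
  have sU: "cfun_subspace U" and UV: "U \<subseteq> conj_fun \<pi> ` V" and Ur: "\<And>g f. g \<in> U11 X \<Longrightarrow> f \<in> U \<Longrightarrow> rtrans g f \<in> U"
    using U by (auto simp: subrep_def)
  have "subrep X T V" unfolding subrep_def
  proof (intro conjI ballI)
    show "T \<subseteq> V" by (auto simp: T_def)
    show "cfun_subspace T" unfolding cfun.subspace_def
    proof (intro conjI ballI allI)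
      show "0 \<in> T" unfolding T_def using VD(2) cfun.subspace_0[OF sU] by (simp only: mem_Collect_eq conj_fun_0)
      show "x + y \<in> T" if "x \<in> T" "y \<in> T" for x y
        using that VD(3) cfun.subspace_add[OF sU] unfolding T_def by (simp only: mem_Collect_eq conj_fun_add)
      show "cscale c x \<in> T" if "x \<in> T" for c x
        using that VD(4) cfun.subspace_scale[OF sU] unfolding T_def by (simp only: mem_Collect_eq conj_fun_cscale)
    qed
    fix g f assume g: "g \<in> U11 X" and f: "f \<in> T"
    have "conj_fun \<pi> (rtrans g f) = rtrans (dconj (inverse \<pi>) g) (conj_fun \<pi> f)" by (simp add: rtrans_conj_fun dconj_dconj)
    also have "\<dots> \<in> U" using Ur[of "dconj (inverse \<pi>) g" "conj_fun \<pi> f"] g f by (simp add: T_def)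
    finally show "rtrans g f \<in> T" using VD(5) g f by (simp add: T_def)
  qed
  hence "T = {0} \<or> T = V" using V(2) by (simp add: irreducible_rep_def)
  moreover have "U = conj_fun \<pi> ` T" using UV by (auto simp: T_def)
  ultimately show "U = {0} \<or> U = conj_fun \<pi> ` V" by (metis conj_fun_0 image_empty image_insert)
qed

lemma subrep_sum:
  assumes V: "subrep X V PS" and V': "subrep X V' PS"
  shows "subrep X {f + g | f g. f \<in> V \<and> g \<in> V'} PS" (is "subrep X ?U PS")
  unfolding subrep_def
proof (intro conjI ballI)
  note VD = subrepD[OF V] and VD' = subrepD[OF V']
  have I: "f \<in> V \<Longrightarrow> g \<in> V' \<Longrightarrow> f + g \<in> ?U" for f g by blast
  have E: "\<exists>f g. f \<in> V \<and> g \<in> V' \<and> x = f + g" if "x \<in> ?U" for x using that by (elim CollectE exE conjE) (intro exI conjI)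
  show "?U \<subseteq> PS"
  proof
    fix x assume "x \<in> ?U"
    from E[OF this] obtain f g where "f \<in> V" "g \<in> V'" "x = f + g" by (elim exE conjE)
    then show "x \<in> PS" using PS_add VD(1) VD'(1) by (simp only:)
  qed
  show "cfun_subspace ?U" unfolding cfun.subspace_def
  proof (intro conjI ballI allI)
    show "0 \<in> ?U" using I[OF VD(2) VD'(2)] by (simp only: add_0_left)
    fix x y assume xy: "x \<in> ?U" "y \<in> ?U"
    from E[OF xy(1)] obtain f g where 1: "f \<in> V" "g \<in> V'" "x = f + g" by (elim exE conjE)
    from E[OF xy(2)] obtain f' g' where 2: "f' \<in> V" "g' \<in> V'" "y = f' + g'" by (elim exE conjE)
    note a = 1 2
    have "x + y = (f + f') + (g + g')" using a by (simp only: add_ac)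
    then show "x + y \<in> ?U" using I[OF VD(3)[OF a(1,4)] VD'(3)[OF a(2,5)]] by (simp only:)
  next
    fix c x assume "x \<in> ?U"
    from E[OF this] obtain f g where a: "f \<in> V" "g \<in> V'" "x = f + g" by (elim exE conjE)
    have "cscale c x = cscale c f + cscale c g" unfolding a(3) by (rule cfun.scale_right_distrib)
    then show "cscale c x \<in> ?U" using I[OF VD(4)[OF a(1)] VD'(4)[OF a(2)]] by (simp only:)
  qed
  fix g x assume g: "g \<in> U11 X" and "x \<in> ?U"
  from E[OF \<open>x \<in> ?U\<close>] obtain f f' where a: "f \<in> V" "f' \<in> V'" "x = f + f'" by (elim exE conjE)
  have "rtrans g x = rtrans g f + rtrans g f'" unfolding a(3) by (rule rtrans_add)
  then show "rtrans g x \<in> ?U" using I[OF VD(5)[OF a(1) g] VD'(5)[OF a(2) g]] by (simp only:)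
qed

text \<open>Subtracting a multiple of f makes g vanish at 1. Its \<open>phi\<close> then has compact
  support and is a finite combination of translates of one indicator function.\<close>

lemma PS_from_bumps:
  assumes U: "subrep X U PS" and f: "f \<in> U" "f (mat 1) \<noteq> 0"
    and b: "\<And>i. \<exists>g\<in>U. g (mat 1) = 0 \<and> (\<forall>x\<in>K. phi g x = (if x \<in> P i then 1 else 0))"
    and g: "g \<in> PS"
  shows "g \<in> U"
proof -
  note UD = subrepD[OF U]
  define c where "c = g (mat 1) / f (mat 1)"
  define k where "k = g + cscale (- c) f"
  have kP: "k \<in> PS" unfolding k_def by (intro PS_add PS_cscale g UD(1) f)
  have k1: "k (mat 1) = 0" using f(2) by (simp add: k_def c_def cscale_def)
  obtain r where r: "asymp k r" using ex_asymp[OF kP] by blast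
  have supp: "phi k x = 0" if "x \<in> K" "x \<notin> P (- r)" for x using r that k1 by (simp add: asymp_def)
  obtain n Y where n: "- r \<le> n" "periodic n (phi k)" "reps K (- r) n Y"
    using ulc_reps[OF ulc_phi[OF kP], of "- r"] by blast
  note Y' = repsD[OF n(3)]
  obtain B where B: "B \<in> U" "B (mat 1) = 0" "\<And>x. x \<in> K \<Longrightarrow> phi B x = (if x \<in> P n then 1 else 0)"
    using b[of n] by blast
  define S where "S = (\<Sum>y\<in>Y. cscale (phi k y) (rtrans (unip (- y)) B))"
  have YK: "y \<in> K" "y \<in> P (- r)" if "y \<in> Y" for y using that Y' by blast+
  have SU: "S \<in> U" unfolding S_def using YK by (intro UD(7) UD(4) UD(5) B(1)) auto
  have S1: "S (mat 1) = 0"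
    unfolding S_def sum_fun_apply
    using rtrans_unip_1[OF UD(1)[OF B(1)]] B(2) YK by (intro sum.neutral) (auto simp: cscale_def)
  have "k = S"
  proof (rule PS_ext[OF kP UD(1)[OF SU]])
    show "k (mat 1) = S (mat 1)" using k1 S1 by simp
    fix x assume x: "x \<in> K"
    have ph: "phi S x = (\<Sum>y\<in>Y. if x - y \<in> P n then phi k y else 0)"
      unfolding S_def phi_sum using B(3) x YK by (intro sum.cong) auto
    show "phi k x = phi S x"
    proof (cases "x \<in> P (- r)")
      case True
      let ?y = "rep_of n Y x"
      have y: "?y \<in> Y" "x - ?y \<in> P n" using rep_of[OF n(3) x True] by auto
      have "phi S x = (\<Sum>y\<in>Y. if y = ?y then phi k y else 0)" unfolding ph
      proof (rule sum.cong[OF refl])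
        fix z assume "z \<in> Y"
        hence "x - z \<in> P n \<longleftrightarrow> z = ?y" using Y'(4)[OF x True] y by blast
        then show "(if x - z \<in> P n then phi k z else 0) = (if z = ?y then phi k z else 0)" by simp
      qed
      also have "\<dots> = phi k ?y" using y Y'(1) by simp
      also have "\<dots> = phi k x" using periodicD[OF n(2), of ?y "x - ?y"] y YK x by simp
      finally show ?thesis by simp
    next
      case False
      have "x - y \<notin> P n" if "y \<in> Y" for y
        using P_add[of "x - y" "- r" y] P_mono[OF _ n(1)] YK[OF that] False by auto
      then show ?thesis unfolding ph using supp[OF x False] by simp
    qed
  qed
  hence "k \<in> U" using SU by (simp only:)
  hence "k + cscale c f \<in> U" using UD(3) UD(4) f(1) by blast
  moreover have "k + cscale c f = g" by (simp add: k_def)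
  ultimately show ?thesis by (simp only:)
qed

text \<open>The indicator of P^i is \<open>ball_diff i\<close> plus 1/Q times that of P^(i - 1), so
  one indicator yields all others in both directions.\<close>

lemma all_bumps:
  assumes U: "subrep X U PS" and b0: "\<exists>g\<in>U. g (mat 1) = 0 \<and> (\<forall>x\<in>K. phi g x = (if x \<in> P i0 then 1 else 0))"
    and D: "\<And>i. \<exists>g\<in>U. g (mat 1) = 0 \<and> (\<forall>x\<in>K. phi g x = ball_diff i x)"
  shows "\<exists>g\<in>U. g (mat 1) = 0 \<and> (\<forall>x\<in>K. phi g x = (if x \<in> P i then 1 else 0))" (is "?B i")
proof -
  note UD = subrepD[OF U]
  have up: "?B (i + 1)" if "?B i" for i
  proof -
    from that obtain g where g: "g \<in> U" "g (mat 1) = 0" "\<forall>x\<in>K. phi g x = (if x \<in> P i then 1 else 0)" by blast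
    obtain d where d: "d \<in> U" "d (mat 1) = 0" "\<forall>x\<in>K. phi d x = ball_diff (i + 1) x" using D by blast
    have "d + cscale (1 / Q) g \<in> U" using UD(3)[OF d(1) UD(4)[OF g(1)]] .
    moreover have "(d + cscale (1 / Q) g) (mat 1) = 0" using g(2) d(2) by (simp add: cscale_def)
    moreover have "\<forall>x\<in>K. phi (d + cscale (1 / Q) g) x = (if x \<in> P (i + 1) then 1 else 0)"
      using g(3) d(3) by (simp add: ball_diff_def)
    ultimately show ?thesis by blast
  qed
  have down: "?B (i - 1)" if "?B i" for i
  proof -
    from that obtain g where g: "g \<in> U" "g (mat 1) = 0" "\<forall>x\<in>K. phi g x = (if x \<in> P i then 1 else 0)" by blast
    obtain d where d: "d \<in> U" "d (mat 1) = 0" "\<forall>x\<in>K. phi d x = ball_diff i x" using D by blast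
    have "cscale Q g + cscale (- Q) d \<in> U" using UD(3)[OF UD(4)[OF g(1)] UD(4)[OF d(1)]] .
    moreover have "(cscale Q g + cscale (- Q) d) (mat 1) = 0" using g(2) d(2) by (simp add: cscale_def)
    moreover have "phi (cscale Q g + cscale (- Q) d) x = (if x \<in> P (i - 1) then 1 else 0)" if "x \<in> K" for x
      using bspec[OF g(3) that] bspec[OF d(3) that] by (simp add: ball_diff_def right_diff_distrib)
    ultimately show ?thesis by blast
  qed
  show ?thesis
    by (rule int_induct[of ?B i0]) (fact b0, use up in blast, use down in blast)
qed

text \<open>V lives on odd indices and its conjugate V' on even ones, so they meet trivially and
  together contain every \<open>ball_diff\<close>. Such functions all have integral zero, and a
  genuine bump has to come from elsewhere, namely from two Weyl translates.\<close>

lemma nongeneric_is_pi2: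
  assumes V: "subrep X V PS" "irreducible_rep X V" "infinite_dim V"
    and z: "\<And>f. f \<in> V \<Longrightarrow> Lam 1 f = 0"
  shows "is_pi2 X chi V"
proof -
  note VD = subrepD[OF V(1)]
  have ev: "Lam b f = 0" if "b \<in> K" "b \<noteq> 0" "even (v b)" "f \<in> V" for b f
    using Lam_parity[OF V(1) z _ _ that(1,2) _ that(4)] that(3) by simp
  obtain f0 where f0: "f0 \<in> V" "f0 \<noteq> 0" using V(2) VD(2) by (auto simp: irreducible_rep_def)
  then obtain a where a: "a \<in> K" "a \<noteq> 0" "Lam a f0 \<noteq> 0" using kirillov_inj[OF V f0(1)] by blast
  have oa: "odd (v a)" using ev[OF a(1,2) _ f0(1)] a(3) by blast
  have zz: "Lam b f = 0" if "b \<in> K" "b \<noteq> 0" "odd (v b - v a)" "f \<in> V" for b f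
    using ev that oa by simp
  have s: unram_chi by (rule nongeneric_unram_chi[OF V(1) f0(1) a]) (rule zz)
  have chip: "chi \<pi> = - 1" by (rule nongeneric_unram_chi_value[OF V(1) s f0(1) a]) (rule zz)
  have om: "\<forall>x\<in>K - {0}. chi x = omegaEF X x"
  proof
    fix x assume x: "x \<in> K - {0}"
    define u where "u = x / \<pi> powi v x"
    have u: "u \<in> K" "u \<noteq> 0" "v u = 0" using x by (auto simp: u_def)
    have "chi x = chi u * chi (\<pi> powi v x)"
      using chi_mult[of u "\<pi> powi v x"] u by (simp add: u_def)
    also have "chi u = 1" using s u by (simp add: unram_chi_def OF_units_iff)
    finally show "chi x = omegaEF X x" using omegaEF_eq x chip by (simp add: chi_power_int)
  qed
  define V' where "V' = conj_fun \<pi> ` V"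
  have V': "subrep X V' PS" "irreducible_rep X V'"
    unfolding V'_def using subrep_conj_fun[OF V(1)] irreducible_conj_fun[OF V(1,2)] by auto
  note VD' = subrepD[OF V'(1)]
  have z': "Lam b f = 0" if b: "b \<in> K" "b \<noteq> 0" "odd (v b)" and f: "f \<in> V'" for b f
  proof -
    obtain h where h: "h \<in> V" "f = conj_fun \<pi> h" using f by (auto simp: V'_def)
    show ?thesis unfolding h(2) using Lam_conj_fun[OF VD(1)[OF h(1)] _ _ b(1,2), of \<pi>] ev[of "b * \<pi>" h] b h(1) by simp
  qed
  have disj: "V \<inter> V' = {0}"
  proof -
    have "f = 0" if f: "f \<in> V" "f \<in> V'" for f
    proof (rule kirillov_inj[OF V f(1)])
      fix b assume "b \<in> K" "b \<noteq> 0"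
      then show "Lam b f = 0" using ev[of b f] z'[of b f] f by blast
    qed
    then show ?thesis using VD(2) VD'(2) by blast
  qed
  let ?U = "{f + g | f g. f \<in> V \<and> g \<in> V'}"
  have U: "subrep X ?U PS" by (rule subrep_sum[OF V(1) V'(1)])
  note UD = subrepD[OF U]
  have VU: "f \<in> ?U" if "f \<in> V" for f using VD'(2) that by (intro CollectI exI[of _ f] exI[of _ 0]) simp
  have VU': "f \<in> ?U" if "f \<in> V'" for f using VD(2) that by (intro CollectI exI[of _ 0] exI[of _ f]) simp
  have gen: "\<exists>g\<in>V. g (mat 1) = 0 \<and> (\<forall>x\<in>K. phi g x = ball_diff i x)" if oi: "odd i" for i
  proof -
    define b where "b = \<pi> powi (- i)"
    have b: "b \<in> K" "b \<noteq> 0" "v b = - i" by (auto simp: b_def)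
    obtain f where f: "f \<in> V" "Lam b f \<noteq> 0"
    proof -
      have "even (v b - v a)" using oi oa b(3) by simp
      then show ?thesis using Lam_parity[OF V(1) _ b(1,2) a(1,2) _ f0(1)] a(3) that by blast
    qed
    show ?thesis using ball_diff_mem[OF V(1) f(1) b(1,2) f(2)] b(3) by simp
  qed
  have gen': "\<exists>g\<in>V'. g (mat 1) = 0 \<and> (\<forall>x\<in>K. phi g x = ball_diff i x)" if ei: "even i" for i
  proof -
    define b where "b = \<pi> powi (- i)"
    have b: "b \<in> K" "b \<noteq> 0" "v b = - i" by (auto simp: b_def)
    define a' where "a' = a / \<pi>"
    have a': "a' \<in> K" "a' \<noteq> 0" "v a' = v a - 1" "a' * \<pi> = a" using a by (auto simp: a'_def)
    have "Lam a' (conj_fun \<pi> f0) \<noteq> 0" using Lam_conj_fun[OF VD(1)[OF f0(1)] _ _ a'(1,2), of \<pi>] a(3) a'(4) by simp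
    moreover have "conj_fun \<pi> f0 \<in> V'" using f0(1) by (simp add: V'_def)
    moreover have "even (v b - v a')" using ei oa b(3) a'(3) by simp
    ultimately obtain f where f: "f \<in> V'" "Lam b f \<noteq> 0"
      using Lam_parity[OF V'(1) _ b(1,2) a'(1,2)] by blast
    show ?thesis using ball_diff_mem[OF V'(1) f(1) b(1,2) f(2)] b(3) by simp
  qed
  have D: "\<exists>g\<in>?U. g (mat 1) = 0 \<and> (\<forall>x\<in>K. phi g x = ball_diff i x)" for i
    using gen[of i] gen'[of i] VU VU' by (cases "even i") blast+
  obtain g where g: "g \<in> V" "g (mat 1) = 0" "\<forall>x\<in>K. phi g x = ball_diff 1 x" using gen[of 1] by auto
  obtain g' where g': "g' \<in> V'" "g' (mat 1) = 0" "\<forall>x\<in>K. phi g' x = ball_diff 2 x" using gen'[of 2] by auto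
  note w = weyl_ball_diff[OF V(1) g] and w' = weyl_ball_diff[OF V'(1) g']
  define \<zeta> where "\<zeta> = chi \<pi> / Q"
  have \<zeta>: "\<zeta> = - 1 / Q" using chip by (simp add: \<zeta>_def)
  \<comment> \<open>Both translates have value 1 - 1/Q at 1. Their difference vanishes there, so its
    \<open>phi\<close> has compact support.\<close>
  define h where "h = rtrans weyl g - rtrans weyl g'"
  have hU: "h \<in> ?U" unfolding h_def by (rule UD(6)[OF VU[OF w(1)] VU'[OF w'(1)]])
  have h1: "h (mat 1) = 0" using w(2) w'(2) by (simp add: h_def)
  have hphi: "phi h x = \<zeta> * ((if x \<in> P (- 1) then 1 else 0) - (if x \<in> P 1 then 1 else 0))" if x: "x \<in> K" for x
  proof -
    consider "x \<in> P 1" | "x \<notin> P 1" "x \<in> P 0" | "x \<notin> P 0" "x \<in> P (- 1)" | "x \<notin> P (- 1)" by blast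
    then show ?thesis
    proof cases
      case 1
      then show ?thesis using w(3)[OF x] w'(3)[OF x] P_mono[OF 1, of 0] P_mono[OF 1, of "- 1"] by (simp add: h_def)
    next
      case 2
      hence "x \<noteq> 0" "v x = 0" by (auto simp: P_iff)
      then show ?thesis using w(3)[OF x] w'(3)[OF x] 2 P_mono[OF 2(2), of "- 1"] unram_chi_xi[OF s x] \<zeta> by (simp add: h_def)
    next
      case 3
      hence x0: "x \<noteq> 0" "v x = - 1" by (auto simp: P_iff)
      have "x \<notin> P 1" using 3 P_mono[of x 1 0] by auto
      then show ?thesis using w(3)[OF x] w'(3)[OF x] 3 unram_chi_xi[OF s x x0(1)] x0(2)
        by (simp add: h_def \<zeta>_def[symmetric] algebra_simps)
    next
      case 4
      hence "x \<notin> P 1" "x \<notin> P 0" using P_mono[of x 1 "- 1"] P_mono[of x 0 "- 1"] by auto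
      then show ?thesis using w(3)[OF x] w'(3)[OF x] 4 by (simp add: h_def)
    qed
  qed
  obtain d1 where d1: "d1 \<in> ?U" "d1 (mat 1) = 0" "\<And>x. x \<in> K \<Longrightarrow> phi d1 x = ball_diff 1 x" using D[of 1] by auto
  obtain d0 where d0: "d0 \<in> ?U" "d0 (mat 1) = 0" "\<And>x. x \<in> K \<Longrightarrow> phi d0 x = ball_diff 0 x" using D[of 0] by auto
  \<comment> \<open>Since \<zeta> = -1/Q, -Q h has \<open>phi\<close> equal to the indicator of
    P^(-1) minus that of P^1. The combination of d1 and d0 telescopes to the indicator of P^1 minus
    Q^(-2) times that of P^(-1). The sum is 1 - Q^(-2) times the indicator of P^(-1).\<close>
  define \<beta> where "\<beta> = cscale (inverse (1 - 1 / (Q * Q)))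
    (cscale (- Q) h + (d1 + cscale (1 / Q) d0))"
  have "\<exists>g\<in>?U. g (mat 1) = 0 \<and> (\<forall>x\<in>K. phi g x = (if x \<in> P (- 1) then 1 else 0))"
  proof (intro bexI[of _ \<beta>] conjI ballI)
    show "\<beta> \<in> ?U" unfolding \<beta>_def by (intro UD(4) UD(3) hU d1(1) d0(1))
    show "\<beta> (mat 1) = 0" using h1 d1(2) d0(2) by (simp add: \<beta>_def cscale_def)
    fix x assume x: "x \<in> K"
    have "phi (cscale (- Q) h + (d1 + cscale (1 / Q) d0)) x =
      (1 - 1 / (Q * Q)) * (if x \<in> P (- 1) then 1 else 0)"
      using hphi[OF x] d1(3)[OF x] d0(3)[OF x] \<zeta> by (simp add: ball_diff_def diff_divide_distrib)
    then show "phi \<beta> x = (if x \<in> P (- 1) then 1 else 0)"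
      unfolding \<beta>_def phi_cscale[of "inverse (1 - 1 / (Q * Q))"] using Q_fact(3) by simp
  qed
  note bumps = all_bumps[OF U this D]
  \<comment> \<open>All bumps vanish at 1; this vector of V supplies the missing direction.\<close>
  have "rtrans weyl g (mat 1) \<noteq> 0" using w(2) Q_fact(1) by simp
  hence "k \<in> ?U" if "k \<in> PS" for k using PS_from_bumps[OF U VU[OF w(1)] _ bumps that] by blast
  hence PSU: "PS = ?U" using UD(1) by blast
  have c1: "conj_fun 1 F0 = F0" using conj_fun_conj_fun(1)[of 1 "conj_fun 1 F0"] by (simp add: conj_fun_def dconj_def mat2_eta)
  obtain f1 f2 where f12: "f1 \<in> V" "f2 \<in> V'" "F0 = f1 + f2"
    using F0_PS[OF s] unfolding PSU by (elim CollectE exE conjE) rule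
  have "conj_fun 1 F0 \<in> V \<or> conj_fun 1 F0 \<in> V'"
    by (rule fixed_split[OF s V(1) V'(1) _ _ _ f12(1,2)]) (use disj f12(3) c1 in auto)
  \<comment> \<open>\<open>Lam 1\<close> kills V, but its value at F0 is 1 + 1/Q.\<close>
  moreover have "F0 \<notin> V"
    using z[of F0] Lam_F0[OF s] chip Q_fact(2) by auto
  ultimately have F0V': "F0 \<in> V'" using c1 by simp
  have pi1: "is_pi1 X chi V'" unfolding is_pi1_def
    by (intro conjI om V' bexI[of _ F0] F0V' F0_nz ballI F0_fixed[OF s])
  show ?thesis unfolding is_pi2_def
    by (intro conjI exI[of _ V'] om V(1,2) pi1 disj PSU)
qed

end

theorem proposition4p2p2:
  fixes X :: "'e::field quad_ext"
    and \<mu> :: "'e measure"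
    and chi \<eta> \<psi> :: "'e \<Rightarrow> complex"
    and V :: "('e^2^2 \<Rightarrow> complex) set"
  assumes ext: "unramified_quadratic X"
    and odd_char: "odd (residue_char (Fld X) (val X))"
    and haar: "is_haar_measure X \<mu>"
    and chi_char: "is_char X (UNIV - {0}) chi"
    and V: "subrep X V (principal_series X chi)" "irreducible_rep X V" "infinite_dim V"
    and eta: "eta_compatible X V \<eta>"
    and eta_min: "cond_eta X V \<eta> = conductor X V"
    and psi: "is_additive_char X \<psi>" "\<forall>x\<in>OF X. \<psi> x = 1" "\<exists>x\<in>PF X (- 1). \<psi> x \<noteq> 1"
  shows "(V = principal_series X chi \<and> ramified X chi \<and>
          (\<forall>x\<in>OE_units X. chi x = inverse (chi (gal X x))) \<longrightarrow>
            generic X V \<psi> \<and>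
            cfun_dim {f \<in> eta_space X V \<eta> 1. Lambda X \<mu> \<psi> f = 0} = 1)
       \<and> (is_pi1 X chi V \<longrightarrow>
            generic X V \<psi> \<and>
            newform_space X V \<eta> (eta_space X V \<eta> 0) \<and>
            cfun_dim (eta_space X V \<eta> 0) = 1 \<and>
            (\<exists>f\<in>eta_space X V \<eta> 0. Lambda X \<mu> \<psi> f \<noteq> 0))
       \<and> (is_pi2 X chi V \<longrightarrow>
            \<not> generic X V \<psi> \<and> generic X V (\<lambda>x. \<psi> (unif X * x)) \<and>
            newform_space X V \<eta> (eta_space' X V \<eta> 0) \<and>
            cfun_dim (eta_space' X V \<eta> 0) = 1 \<and>
            (\<exists>f\<in>eta_space' X V \<eta> 0. Lambda X \<mu> (\<lambda>x. \<psi> (unif X * x)) f \<noteq> 0))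
       \<and> (\<not> (V = principal_series X chi \<and> ramified X chi \<and>
             (\<forall>x\<in>OE_units X. chi x = inverse (chi (gal X x)))) \<and>
            \<not> is_pi1 X chi V \<and> \<not> is_pi2 X chi V \<longrightarrow>
            generic X V \<psi> \<and>
            (\<forall>c. conductor X V = enat c \<longrightarrow>
               (\<forall>v\<in>eta_space X V \<eta> c. v \<noteq> 0 \<longrightarrow> Lambda X \<mu> \<psi> v \<noteq> 0)))"
proof -
  interpret unitary_ps X \<mu> chi \<psi>
    using assms by unfold_locales
  have gen: "generic X V \<psi> \<longleftrightarrow> (\<exists>f\<in>V. Lam 1 f \<noteq> 0)" by (rule generic_psi[OF V(1)])
  have c1: "generic X V \<psi> \<and> cfun_dim {f \<in> eta_space X V \<eta> 1. Lambda X \<mu> \<psi> f = 0} = 1"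
    if a: "V = PS" "\<forall>x\<in>OE_units X. chi x = inverse (chi (gal X x))"
  proof
    have s: unram_chi by (rule norm_trivial_unram_chi[OF a(2)])
    have "F0 \<in> V" using F0_PS[OF s] a(1) by simp
    note c = spherical_conductor[OF s V(1) disjI1[OF this] eta eta_min]
    show "generic X V \<psi>" unfolding gen using Lam_F0_F1(1,2)[OF s] a(1) by (intro bexI[of _ "F0 - F1"]) auto
    show "cfun_dim {f \<in> eta_space X V \<eta> 1. Lambda X \<mu> \<psi> f = 0} = 1"
      unfolding Lambda_psi a(1) by (rule dim_iwahori_kernel[OF s c(3,4)])
  qed
  have c2: "generic X V \<psi> \<and> newform_space X V \<eta> (eta_space X V \<eta> 0) \<and>
      cfun_dim (eta_space X V \<eta> 0) = 1 \<and> (\<exists>f\<in>eta_space X V \<eta> 0. Lambda X \<mu> \<psi> f \<noteq> 0)"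
    if a: "is_pi1 X chi V"
  proof -
    note p = pi1_F0[OF a]
    note c = spherical_conductor[OF p(1) V(1) disjI1[OF p(3)] eta eta_min]
    have e: "eta_space X V \<eta> 0 = {cscale c F0 | c. True}" by (rule eta_space_0_eq[OF p(1) V(1) p(3) c(3,4)])
    have "cscale 1 F0 \<in> eta_space X V \<eta> 0" unfolding e by blast
    hence m: "F0 \<in> eta_space X V \<eta> 0" by simp
    have "newform_space X V \<eta> (eta_space X V \<eta> 0)"
      by (rule newform_line[OF c(1,2)]) (use m F0_nz in auto)
    moreover have "cfun_dim (eta_space X V \<eta> 0) = 1" unfolding e by (rule dim_line[OF F0_nz])
    ultimately show ?thesis unfolding gen Lambda_psi using p(3,4) m by blast
  qed
  have c3: "\<not> generic X V \<psi> \<and> generic X V (\<lambda>x. \<psi> (unif X * x)) \<and>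
      newform_space X V \<eta> (eta_space' X V \<eta> 0) \<and> cfun_dim (eta_space' X V \<eta> 0) = 1 \<and>
      (\<exists>f\<in>eta_space' X V \<eta> 0. Lambda X \<mu> (\<lambda>x. \<psi> (unif X * x)) f \<noteq> 0)"
    if a: "is_pi2 X chi V"
  proof -
    note p = pi2_spherical[OF a V(3)]
    note c = spherical_conductor[OF p(1) V(1) disjI2[OF p(2)] eta eta_min]
    have e: "eta_space' X V \<eta> 0 = {cscale c F0' | c. True}" by (rule eta_space'_0_eq[OF p(1) V(1) p(2) c(3,4)])
    have "cscale 1 F0' \<in> eta_space' X V \<eta> 0" unfolding e by blast
    hence m: "F0' \<in> eta_space' X V \<eta> 0" by simp
    have "newform_space X V \<eta> (eta_space' X V \<eta> 0)"
      by (rule newform_line[OF c(1,2)]) (use m F0'_nz in auto)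
    moreover have "cfun_dim (eta_space' X V \<eta> 0) = 1" unfolding e by (rule dim_line[OF F0'_nz])
    moreover have "generic X V (\<lambda>x. \<psi> (unif X * x))"
      using generic_iff[OF V(1), of \<pi>] p(2,4) by auto
    moreover have "\<not> generic X V \<psi>" unfolding gen using p(3) by blast
    ultimately show ?thesis using p(4) m unfolding Lam_def by blast
  qed
  have c4: "generic X V \<psi>" if "\<not> is_pi2 X chi V"
    unfolding gen using nongeneric_is_pi2[OF V] that by blast
  have c5: "Lambda X \<mu> \<psi> f \<noteq> 0" if "conductor X V = enat c" "f \<in> eta_space X V \<eta> c" "f \<noteq> 0" for c f
    unfolding Lambda_psi using newform_Lam_nz[OF V eta _ that(2,3)] eta_min that(1) by simp
  show ?thesis using c1 c2 c3 c4 c5 by blast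
qed

end
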